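(* Let $D$ be a skeletal directed acyclic graph. For any congruence $\equiv$ of the acyclic reorientation lattice $\mathcal{AR}_D$, the quotient fan $\mathcal{F}_\equiv$ is the normal fan of (1) a Minkowski sum of (Hohlweg--Lange) associahedra $\mathbb{A}_\rho$ of ropes $\rho$ of $D$, and also of (2) a Minkowski sum of shard polytopes $\mathbb{SP}_\rho$ of ropes $\rho$ of $D$.
   Context: All directed graphs are finite and simple. A reorientation of a directed acyclic graph $D=(V,A)$ is a directed graph with the same underlying undirected graph, encoded by the set of arcs of $D$ that it reverses. $\mathcal{AR}_D$ is the poset of acyclic reorientations of $D$ ordered by inclusion of sets of reversed arcs. The transitive reduction of a directed acyclic graph is obtained by deleting all arcs whose endpoints are connected by a directed path of length at least $2$. A directed graph is a forest if its underlying undirected graph has no cycle. $D$ is vertebrate if the transitive reduction of every induced subgraph of $D$ is a forest; filled if for any directed path $\pi$ in $D$ whose endpoints are joined by an arc of $D$, all arcs joining any two vertices of $\pi$ belong to $D$; skeletal if vertebrate and filled. When $D$ is skeletal, $\mathcal{AR}_D$ is a lattice. A congruence of a lattice is an equivalence relation compatible with meets and joins. Quotient fan. For an acyclic reorientation $E$ of $D$, let $\mathbb{C}_E=\{x\in\mathbb{R}^V : x_u\le x_v \text{ for all arcs } (u,v) \text{ of } E\}$. The $\mathbb{C}_E$ are the chambers of the graphical fan $\mathcal{F}_D$, defined by the hyperplanes $x_u=x_v$ for $(u,v)\in A$. For a congruence $\equiv$ of $\mathcal{AR}_D$, the quotient fan $\mathcal{F}_\equiv$ is the complete fan in $\mathbb{R}^V$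 whose chambers are the unions $\bigcup_{E\in X}\mathbb{C}_E$ over the $\equiv$-classes $X$ (these are known to be the chambers of a fan). The normal fan of a polytope $P\subset\mathbb{R}^V$ is the collection of normal cones of its faces, where the normal cone of a face $F$ is the cone of vectors $v$ such that $F$ is the face of $P$ maximizing $x\mapsto\langle v,x\rangle$ (and its closure faces). An empty Minkowski sum is $\{0\}$. Ropes. The transitive support of an arc $(u,v)$ of $D$ is the set of vertices appearing along directed paths in $D$ from $u$ to $v$. A rope of $D$ is a quadruple $\rho=(u,v,\nabla,\Delta)$ where $(u,v)\in A$ and $\nabla\sqcup\Delta$ is a partition of the transitive support of $(u,v)$ minus $\{u,v\}$. Let $\pi$ be the directed path from $u$ to $v$ in the transitive reduction of $D$, with vertices $u=v_1,v_2,\dots,v_n=v$ in order; its vertex set is $S=\{u,v\}\cup\nabla\cup\Delta$. For $U\subseteq V$, write $\mathbf{1}_U=\sum_{w\in U}e_w$. Associahedron $\mathbb{A}_\rho$. It is the Cambrian associahedron of Hohlweg--Lange for the signature $(\nabla,\Delta)$ along $\pi$, embedded in $\mathbb{R}^V$: the set of $x\in\mathbb{R}^V$ with $x_w=0$ for $w\notin S$, $\langle\mathbf{1}_S,x\rangle=\binom{n+1}{2}$, and $\langle\mathbf{1}_U,x\rangle\ge\binom{|U|+1}{2}$ for all $\varnothing\ne U\subsetneq S$ such that for all $1\le i<j<k\le n$: if $v_i,v_k\in U$ and $v_j\in\nabla$ then $v_j\in U$; and if $v_i,v_k\notin U$ and $v_j\in\Delta$ then $v_j\notin U$. Shard polytope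 $\mathbb{SP}_\rho$. A $\rho$-alternating matching is a pair $(M_\nabla,M_\Delta)$ with $M_\nabla\subseteq\{u\}\cup\nabla$ and $M_\Delta\subseteq\Delta\cup\{v\}$ that alternate along $\pi$, i.e. $M_\nabla=\{a_1,\dots,a_q\}$, $M_\Delta=\{b_1,\dots,b_q\}$ with $a_1,b_1,a_2,b_2,\dots,a_q,b_q$ appearing in this order along $\pi$ ($q\ge0$). $\mathbb{SP}_\rho$ is the convex hull of the vectors $\mathbf{1}_{M_\nabla}-\mathbf{1}_{M_\Delta}$ over all $\rho$-alternating matchings. *)

theory Defs
  imports "HOL-Analysis.Analysis" "HOL-Algebra.Lattice" "HOL-Library.Sublist"
begin

section \<open>Directed graphs\<close>

text \<open>
  The vertex set \<open>V\<close> of a directed graph is a finite type \<open>'v\<close> and the graph is its arc relation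
  \<open>A\<close>, so that \<open>\<real>\<^sup>V\<close> is \<^typ>\<open>real ^ 'v\<close>. Loops and antiparallel arcs are excluded by \<^prop>\<open>acyclic A\<close>,
  and \<^term>\<open>Restr A X\<close> is the subgraph induced by \<open>X\<close>.
\<close>

definition dpath :: "'v rel \<Rightarrow> 'v \<Rightarrow> 'v list \<Rightarrow> 'v \<Rightarrow> bool" where
  "dpath A u p v \<longleftrightarrow> p \<noteq> [] \<and> hd p = u \<and> last p = v \<and> distinct p \<and>
     successively (\<lambda>x y. (x, y) \<in> A) p"

definition transitive_reduction :: "'v rel \<Rightarrow> 'v rel" where
  "transitive_reduction A =
     {(u, v) \<in> A. \<not> (\<exists>p. dpath A u p v \<and> length p - 1 \<ge> 2)}"

text \<open>The closing edge of a cycle joins the last vertex of \<open>c\<close> to its first one.\<close>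

definition forest :: "'v rel \<Rightarrow> bool" where
  "forest A \<longleftrightarrow> \<not> (\<exists>c. length c \<ge> 3 \<and> distinct c \<and>
     successively (\<lambda>x y. (x, y) \<in> A \<union> A\<inverse>) c \<and> (last c, hd c) \<in> A \<union> A\<inverse>)"

definition vertebrate :: "'v rel \<Rightarrow> bool" where
  "vertebrate A \<longleftrightarrow> (\<forall>X. forest (transitive_reduction (Restr A X)))"

definition filled :: "'v rel \<Rightarrow> bool" where
  "filled A \<longleftrightarrow> (\<forall>u p v. dpath A u p v \<and> (u, v) \<in> A \<longrightarrow>
     (\<forall>i j. i < j \<and> j < length p \<longrightarrow> (p ! i, p ! j) \<in> A))"

definition skeletal :: "'v rel \<Rightarrow> bool" where
  "skeletal A \<longleftrightarrow> vertebrate A \<and> filled A"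


section \<open>Acyclic reorientations and their congruences\<close>

definition reorient :: "'v rel \<Rightarrow> 'v rel \<Rightarrow> 'v rel" where
  "reorient A R = (A - R) \<union> R\<inverse>"

definition acyclic_reorientations :: "'v rel \<Rightarrow> 'v rel gorder" where
  "acyclic_reorientations A = \<lparr>carrier = {R. R \<subseteq> A \<and> acyclic (reorient A R)}, eq = (=), le = (\<subseteq>)\<rparr>"

definition lattice_congruence :: "('a, 'b) gorder_scheme \<Rightarrow> 'a rel \<Rightarrow> bool" where
  "lattice_congruence L r \<longleftrightarrow> equiv (carrier L) r \<and>
     (\<forall>(x, x') \<in> r. \<forall>(y, y') \<in> r.
        (x \<squnion>\<^bsub>L\<^esub> y, x' \<squnion>\<^bsub>L\<^esub> y') \<in> r \<and> (x \<sqinter>\<^bsub>L\<^esub> y, x' \<sqinter>\<^bsub>L\<^esub> y') \<in> r)"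


section \<open>Fans\<close>

definition chamber :: "'v rel \<Rightarrow> (real ^ 'v::finite) set" where
  "chamber E = {x. \<forall>(u, v) \<in> E. x $ u \<le> x $ v}"

text \<open>
  A fan with a given set of chambers consists of the nonempty faces of these chambers;
  see \<open>complete_fan_eq_fan_of_chambers\<close> below.
\<close>

definition fan_of_chambers :: "'a::euclidean_space set set \<Rightarrow> 'a set set" where
  "fan_of_chambers \<C> = {F. F \<noteq> {} \<and> (\<exists>C \<in> \<C>. F face_of C)}"

definition quotient_fan :: "'v::finite rel \<Rightarrow> 'v rel rel \<Rightarrow> (real ^ 'v) set set" where
  "quotient_fan A r =
     fan_of_chambers {\<Union>R \<in> X. chamber (reorient A R) | X. X \<in> carrier (acyclic_reorientations A) // r}"

definition max_face :: "'a::euclidean_space set \<Rightarrow> 'a \<Rightarrow> 'a set" where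
  "max_face P v = {x \<in> P. \<forall>y \<in> P. v \<bullet> y \<le> v \<bullet> x}"

definition normal_cone :: "'a::euclidean_space set \<Rightarrow> 'a set \<Rightarrow> 'a set" where
  "normal_cone P F = closure {v. max_face P v = F}"

definition normal_fan :: "'a::euclidean_space set \<Rightarrow> 'a set set" where
  "normal_fan P = {normal_cone P F | F. F face_of P \<and> F \<noteq> {}}"

definition complete_fan :: "'a::euclidean_space set set \<Rightarrow> bool" where
  "complete_fan \<F> \<longleftrightarrow> finite \<F> \<and>
     (\<forall>C \<in> \<F>. polyhedron C \<and> cone C \<and> C \<noteq> {}) \<and>
     (\<forall>C \<in> \<F>. \<forall>F. F face_of C \<and> F \<noteq> {} \<longrightarrow> F \<in> \<F>) \<and>
     (\<forall>C \<in> \<F>. \<forall>C' \<in> \<F>. C \<inter> C' face_of C) \<and>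
     \<Union>\<F> = UNIV"

lemma complete_fan_eq_fan_of_chambers:
  assumes "complete_fan \<F>"
  shows "\<F> = fan_of_chambers {C \<in> \<F>. \<forall>C' \<in> \<F>. C \<subseteq> C' \<longrightarrow> C' = C}"
proof (intro equalityI subsetI)
  fix F assume F: "F \<in> \<F>"
  have "finite \<F>" using assms by (simp add: complete_fan_def)
  then obtain C where C: "C \<in> \<F>" "F \<subseteq> C" "\<forall>C' \<in> \<F>. C \<subseteq> C' \<longrightarrow> C' = C"
    using finite_has_maximal2[OF _ F] by blast
  have "C \<inter> F face_of C" and "F \<noteq> {}"
    using assms C(1) F unfolding complete_fan_def by blast+
  moreover have "C \<inter> F = F" using C(2) by blast
  ultimately have "F face_of C" "F \<noteq> {}" by simp_all
  then show "F \<in> fan_of_chambers {C \<in> \<F>. \<forall>C' \<in> \<F>. C \<subseteq> C' \<longrightarrow> C' = C}"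
    using C(1,3) unfolding fan_of_chambers_def by blast
next
  fix F assume "F \<in> fan_of_chambers {C \<in> \<F>. \<forall>C' \<in> \<F>. C \<subseteq> C' \<longrightarrow> C' = C}"
  then show "F \<in> \<F>"
    using assms unfolding fan_of_chambers_def complete_fan_def by blast
qed

lemma normal_cone_eq:
  assumes "polytope P" "F face_of P" "F \<noteq> {}"
  shows "normal_cone P F = {v. F \<subseteq> max_face P v}"
proof
  have FP: "F \<subseteq> P" using assms(2) by (rule face_of_imp_subset)
  have eq: "{v. F \<subseteq> max_face P v} = (\<Inter>x \<in> F. \<Inter>y \<in> P. {v. v \<bullet> y \<le> v \<bullet> x})"
    using FP unfolding max_face_def by blast
  have "closed {v. F \<subseteq> max_face P v}"
    unfolding eq by (intro closed_INT ballI closed_Collect_le continuous_intros)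
  then show "normal_cone P F \<subseteq> {v. F \<subseteq> max_face P v}"
    unfolding normal_cone_def by (intro closure_minimal) auto
next
  have FP: "F \<subseteq> P" using assms(2) by (rule face_of_imp_subset)
  have "F exposed_face_of P"
    using assms by (simp add: exposed_face_of_polyhedron polytope_imp_polyhedron)
  then obtain a b where ab: "P \<subseteq> {x. a \<bullet> x \<le> b}" "F = P \<inter> {x. a \<bullet> x = b}"
    unfolding exposed_face_of_def by blast
  show "{v. F \<subseteq> max_face P v} \<subseteq> normal_cone P F"
  proof
    fix v assume "v \<in> {v. F \<subseteq> max_face P v}"
    then have v: "v \<bullet> y \<le> v \<bullet> x" if "x \<in> F" "y \<in> P" for x y
      using that by (auto simp: max_face_def)
    obtain z where z: "z \<in> F" using assms(3) by blast
    have face: "max_face P (v + t *\<^sub>R a) = F" if t: "t > 0" for t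
    proof
      show "max_face P (v + t *\<^sub>R a) \<subseteq> F"
      proof
        fix x assume "x \<in> max_face P (v + t *\<^sub>R a)"
        then have x: "x \<in> P" "(v + t *\<^sub>R a) \<bullet> z \<le> (v + t *\<^sub>R a) \<bullet> x"
          using z FP by (auto simp: max_face_def)
        have "t * (a \<bullet> z) \<le> t * (a \<bullet> x)"
          using x v[OF z x(1)] by (simp add: inner_add_left)
        then have "a \<bullet> z \<le> a \<bullet> x" using t by simp
        moreover have "a \<bullet> z = b" "a \<bullet> x \<le> b" using ab z x(1) by blast+
        ultimately show "x \<in> F" using ab(2) x(1) by simp
      qed
      show "F \<subseteq> max_face P (v + t *\<^sub>R a)"
      proof
        fix x assume x: "x \<in> F"
        have "(v + t *\<^sub>R a) \<bullet> y \<le> (v + t *\<^sub>R a) \<bullet> x" if y: "y \<in> P" for y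
        proof -
          have "a \<bullet> x = b" "a \<bullet> y \<le> b" using ab x y by blast+
          then have "a \<bullet> y \<le> a \<bullet> x" by simp
          then have "t * (a \<bullet> y) \<le> t * (a \<bullet> x)" using t by simp
          then show ?thesis using v[OF x y] by (simp only: inner_add_left inner_scaleR_left)
        qed
        then show "x \<in> max_face P (v + t *\<^sub>R a)" using x FP by (auto simp: max_face_def)
      qed
    qed
    define w where "w n = v + inverse (real (Suc n)) *\<^sub>R a" for n
    have "w \<longlonglongrightarrow> v + 0 *\<^sub>R a"
      unfolding w_def
      by (rule tendsto_add[OF tendsto_const tendsto_scaleR[OF LIMSEQ_inverse_real_of_nat tendsto_const]])
    then have "w \<longlonglongrightarrow> v" by simp
    moreover have "w n \<in> {v. max_face P v = F}" for n
      using face[of "inverse (real (Suc n))"] by (simp add: w_def)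
    ultimately show "v \<in> normal_cone P F"
      unfolding normal_cone_def closure_sequential by blast
  qed
qed


section \<open>Ropes, associahedra and shard polytopes\<close>

type_synonym 'v rope = "'v \<times> 'v \<times> 'v set \<times> 'v set"

definition transitive_support :: "'v rel \<Rightarrow> 'v \<Rightarrow> 'v \<Rightarrow> 'v set" where
  "transitive_support A u v = {w. \<exists>p. dpath A u p v \<and> w \<in> set p}"

text \<open>In a rope \<open>(u, v, N, \<Delta>)\<close>, the set \<open>N\<close> is the one written with a nabla.\<close>

definition ropes :: "'v rel \<Rightarrow> 'v rope set" where
  "ropes A = {(u, v, N, \<Delta>). (u, v) \<in> A \<and>
     N \<union> \<Delta> = transitive_support A u v - {u, v} \<and> N \<inter> \<Delta> = {}}"

text \<open>For skeletal \<open>A\<close> and an arc \<open>(u, v)\<close>, this path exists and is unique.\<close>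

definition reduction_path :: "'v rel \<Rightarrow> 'v \<Rightarrow> 'v \<Rightarrow> 'v list" where
  "reduction_path A u v = (THE p. dpath (transitive_reduction A) u p v)"

definition ones :: "'v set \<Rightarrow> real ^ 'v::finite" where
  "ones U = (\<Sum>w \<in> U. axis w 1)"

text \<open>The vertex \<open>v\<^sub>i\<close> of the path is \<open>\<pi> ! (i - 1)\<close>, hence the range \<open>0, \<dots>, n - 1\<close> of the indices.\<close>

definition associahedron :: "'v::finite rel \<Rightarrow> 'v rope \<Rightarrow> (real ^ 'v) set" where
  "associahedron A = (\<lambda>(u, v, N, \<Delta>).
     let S = {u, v} \<union> N \<union> \<Delta>; \<pi> = reduction_path A u v; n = length \<pi> in
     {x. (\<forall>w. w \<notin> S \<longrightarrow> x $ w = 0) \<and>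
         ones S \<bullet> x = real ((n + 1) choose 2) \<and>
         (\<forall>U. U \<noteq> {} \<and> U \<subset> S \<and>
            (\<forall>i j k. i < j \<and> j < k \<and> k < n \<longrightarrow>
               (\<pi> ! i \<in> U \<and> \<pi> ! k \<in> U \<and> \<pi> ! j \<in> N \<longrightarrow> \<pi> ! j \<in> U) \<and>
               (\<pi> ! i \<notin> U \<and> \<pi> ! k \<notin> U \<and> \<pi> ! j \<in> \<Delta> \<longrightarrow> \<pi> ! j \<notin> U)) \<longrightarrow>
            ones U \<bullet> x \<ge> real ((card U + 1) choose 2))})"

text \<open>The list \<open>ab\<close> is \<open>[(a\<^sub>1, b\<^sub>1), \<dots>, (a\<^sub>q, b\<^sub>q)]\<close>.\<close>

definition alternating_matchings :: "'v rel \<Rightarrow> 'v rope \<Rightarrow> ('v set \<times> 'v set) set" where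
  "alternating_matchings A = (\<lambda>(u, v, N, \<Delta>).
     {(M, M'). M \<subseteq> {u} \<union> N \<and> M' \<subseteq> \<Delta> \<union> {v} \<and>
        (\<exists>ab. M = fst ` set ab \<and> M' = snd ` set ab \<and>
              subseq (concat (map (\<lambda>(a, b). [a, b]) ab)) (reduction_path A u v))})"

definition shard_polytope :: "'v::finite rel \<Rightarrow> 'v rope \<Rightarrow> (real ^ 'v) set" where
  "shard_polytope A \<rho> =
     convex hull ((\<lambda>(M, M'). ones M - ones M') ` alternating_matchings A \<rho>)"

end

theory Submission
  imports Defs
begin

text \<open>
  For skeletal \<open>A\<close> the vertices on directed paths from \<open>u\<close> to \<open>v\<close> along an arc \<open>(u, v)\<close> form a clique, and a
  set of arcs is the reversed set of an acyclic reorientation iff it is closed and coclosed on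
  triangles. Joins are therefore transitive closures, and whether a congruence contracts the flip of
  an arc depends only on the rope recording which vertices of its support lie on either side of the
  flip; contracting a rope forces the contraction of all ropes containing it.

  A polytope with one vertex per acyclic reorientation, uniquely maximal on the open chamber, has the
  quotient fan as normal fan as soon as flips move its vertex in the direction of the flipped arc, and
  exactly the contracted flips do not move it. The vertex of a shard polytope moves only under flips whose rope is
  contained in \<open>\<rho>\<close>, and does so if the rope is \<open>\<rho>\<close> itself; hence the sum over the uncontracted ropes has
  the required property. Up to a translation, the associahedron of \<open>\<rho>\<close> has the vertices
  of the Minkowski sum of the shard polytopes of all ropes contained in \<open>\<rho>\<close>.
\<close>

text \<open>No list of the vertices of the polytopes is used. The fan only needs a point
  \<open>p R\<close> for each \<open>R\<close> that lies in the polytope and strictly beats its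
  other points in all directions of the open chamber. For shard polytopes this comes from an
  exchange property: two matching vectors differ by a sum of roots e_a - e_b, each of which can be
  applied alone to the first vector and undone alone at the second. So a vector that no single root
  improves is the global maximum, and between the optima before and after a flip only the flipped
  root can occur. For associahedra there is a gap to bridge: the defining inequalities speak of the
  facet sets only, whereas optimality in a generic direction needs the sums over all its lower sets,
  which may violate the facet condition. Cutting a set at a violating vertex closes this gap. The
  translation is (1, ..., n) along the path: its sum over a set \<open>U\<close> exceeds
  binom(|U|+1, 2) by the number of arcs of the support that enter \<open>U\<close>, and on facet
  sets this is exactly what the shard polytopes can take away.\<close>

locale skeletal_digraph =
  fixes A :: "'v::finite rel"
  assumes acyc: "acyclic A" and skel: "skeletal A"
begin

section \<open>Transitive supports of arcs are cliques\<close>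

lemma A_irrefl: "(x, x) \<notin> A"
  using acyc by (auto simp: acyclic_def)

lemma A_antisym: "(x, y) \<in> A \<Longrightarrow> (y, x) \<notin> A"
  using acyc by (meson acyclic_def trancl.simps)

lemma A_neq: "(x, y) \<in> A \<Longrightarrow> x \<noteq> y"
  using A_irrefl by blast

lemma filled_nth:
  "dpath A u p v \<Longrightarrow> (u, v) \<in> A \<Longrightarrow> i < j \<Longrightarrow> j < length p \<Longrightarrow> (p ! i, p ! j) \<in> A"
  using skel unfolding skeletal_def filled_def by blast

text \<open>The interior of the transitive support of an arc. All chords of a path with adjacent
  ends are present, so every inner vertex of such a path is one step away from both ends
  (\<open>transitive_support_eq\<close>).\<close>

definition inner :: "'v \<Rightarrow> 'v \<Rightarrow> 'v set" where
  "inner u v = {w. (u, w) \<in> A \<and> (w, v) \<in> A}"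

lemma dpath_triangle:
  assumes "(u, w) \<in> A" "(w, v) \<in> A" "(u, v) \<in> A"
  shows "dpath A u [u, w, v] v"
  using assms A_neq by (auto simp: dpath_def)

lemma transitive_support_eq:
  assumes "(u, v) \<in> A"
  shows "transitive_support A u v = {u, v} \<union> inner u v"
proof (intro equalityI subsetI)
  fix w assume "w \<in> transitive_support A u v"
  then obtain p where p: "dpath A u p v" "w \<in> set p"
    by (auto simp: transitive_support_def)
  then have ne: "p \<noteq> []" "p ! 0 = u" "p ! (length p - 1) = v"
    by (auto simp: dpath_def hd_conv_nth last_conv_nth)
  obtain i where i: "i < length p" "w = p ! i" using p(2) by (metis in_set_conv_nth)
  have "i \<noteq> 0 \<Longrightarrow> (u, w) \<in> A"
    using filled_nth[OF p(1) assms, of 0 i] i ne by simp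
  moreover have "i \<noteq> length p - 1 \<Longrightarrow> (w, v) \<in> A"
    using filled_nth[OF p(1) assms, of i "length p - 1"] i ne by simp
  ultimately show "w \<in> {u, v} \<union> inner u v"
    using i ne by (auto simp: inner_def)
next
  fix w assume w: "w \<in> {u, v} \<union> inner u v"
  show "w \<in> transitive_support A u v"
  proof (cases "w \<in> inner u v")
    case True
    then have "dpath A u [u, w, v] v" using assms by (intro dpath_triangle) (auto simp: inner_def)
    then show ?thesis unfolding transitive_support_def by force
  next
    case False
    have "dpath A u [u, v] v" using assms A_neq by (auto simp: dpath_def)
    then show ?thesis using False w unfolding transitive_support_def by force
  qed
qed

lemma dpath_mono: "dpath B u p v \<Longrightarrow> B \<subseteq> C \<Longrightarrow> dpath C u p v"
  unfolding dpath_def by (metis (mono_tags, lifting) subsetD successively_mono)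

lemma dpath_snoc_arc:
  assumes "dpath B u p v" "length p - 1 \<ge> 2"
  obtains w where "(w, v) \<in> B" "w \<noteq> u" "w \<noteq> v"
proof -
  obtain q where q: "p = q @ [v]" using assms(1) unfolding dpath_def
    by (metis append_butlast_last_id)
  then have qn: "q \<noteq> []" "tl q \<noteq> []" using assms(2) by (cases q; cases "tl q"; force)+
  have d: "distinct p" and u: "hd q = u" and s: "successively (\<lambda>x y. (x, y) \<in> B) p"
    using assms(1) q qn(1) by (auto simp: dpath_def)
  have "(last q, v) \<in> B" using s q qn by (auto simp: successively_append_iff)
  moreover have "last q \<noteq> v" using d q qn by auto
  moreover have "last q \<noteq> u" using d u q qn
    by (metis distinct_append distinct.simps(2) hd_Cons_tl last_in_set last_tl)
  ultimately show ?thesis using that by blast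
qed

text \<open>Otherwise the transitive reduction of the subgraph induced by \<open>u\<close>,
  \<open>v\<close>, \<open>w\<close>, \<open>w'\<close> contains the undirected 4-cycle through
  \<open>u\<close>, \<open>w\<close>, \<open>v\<close>, \<open>w'\<close> and is no forest.\<close>

lemma inner_comparable:
  assumes uv: "(u, v) \<in> A" and w: "w \<in> inner u v" and w': "w' \<in> inner u v" and "w \<noteq> w'"
  shows "(w, w') \<in> A \<or> (w', w) \<in> A"
proof (rule ccontr)
  assume n: "\<not> ((w, w') \<in> A \<or> (w', w) \<in> A)"
  define X where "X = {u, v, w, w'}"
  let ?B = "Restr A X"
  have arcs: "(u, w) \<in> A" "(w, v) \<in> A" "(u, w') \<in> A" "(w', v) \<in> A"
    using w w' by (auto simp: inner_def)
  have ne: "u \<noteq> v" "u \<noteq> w" "u \<noteq> w'" "w \<noteq> v" "w' \<noteq> v"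
    using arcs uv A_neq by auto
  have anti: "(w, u) \<notin> A" "(v, w) \<notin> A" "(w', u) \<notin> A" "(v, w') \<notin> A" "(v, u) \<notin> A"
    using arcs uv A_antisym by auto
  \<comment> \<open>Only \<open>(u, v)\<close> has a detour: a longer path needs a second arc into
    its end, so it ends at \<open>v\<close>, and its start \<open>w\<close> or \<open>w'\<close> has
    no arc except the one to \<open>v\<close>.\<close>
  have in1: "(x, y) \<in> transitive_reduction ?B"
    if "(x, y) \<in> ?B" "(x, y) \<noteq> (u, v)" for x y
  proof -
    have False if p: "dpath ?B x p y" "length p - 1 \<ge> 2" for p
    proof -
      obtain a where a: "(a, y) \<in> ?B" "a \<noteq> x" "a \<noteq> y" using dpath_snoc_arc[OF p] by blast
      have y: "y = v" "x = w \<or> x = w'"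
        using \<open>(x, y) \<in> ?B\<close> \<open>(x, y) \<noteq> (u, v)\<close> a anti n A_irrefl by (auto simp: X_def)
      obtain b where b: "(x, b) \<in> ?B" "b \<noteq> y"
      proof -
        obtain h t s where p': "p = h # t # s" using p(2) by (cases p; cases "tl p") auto
        then have "s \<noteq> []" using p(2) by auto
        then have "y \<in> set s" using p(1) p' by (auto simp: dpath_def)
        then have "t \<noteq> y" using p(1) p' by (auto simp: dpath_def)
        moreover have "(x, t) \<in> ?B" using p(1) p' by (auto simp: dpath_def)
        ultimately show ?thesis using that by blast
      qed
      then show False using y anti n A_irrefl by (auto simp: X_def)
    qed
    then show ?thesis using that unfolding transitive_reduction_def by blast
  qed
  let ?T = "transitive_reduction ?B"
  have "(u, w) \<in> ?T" "(w, v) \<in> ?T" "(u, w') \<in> ?T" "(w', v) \<in> ?T"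
    by (rule in1; use arcs ne in \<open>simp add: X_def\<close>)+
  then have "\<not> forest ?T"
    unfolding forest_def using ne \<open>w \<noteq> w'\<close> by (simp add: exI[of _ "[u, w, v, w']"])
  then show False using skel by (auto simp: skeletal_def vertebrate_def)
qed

section \<open>Acyclic reorientations as biclosed sets of arcs\<close>

definition AR :: "'v rel set" where
  "AR = {R. R \<subseteq> A \<and> acyclic (reorient A R)}"

lemma carrier_AR: "carrier (acyclic_reorientations A) = AR"
  by (simp add: acyclic_reorientations_def AR_def)

lemma AR_sub: "R \<in> AR \<Longrightarrow> R \<subseteq> A"
  by (simp add: AR_def)

lemma reorient_iff: "(x, y) \<in> reorient A R \<longleftrightarrow> (x, y) \<in> A \<and> (x, y) \<notin> R \<or> (y, x) \<in> R"
  by (auto simp: reorient_def)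

lemma trancl_sub: "R \<subseteq> B \<Longrightarrow> (x, y) \<in> R\<^sup>+ \<Longrightarrow> (x, y) \<in> B\<^sup>+"
  using trancl_mono by blast

lemma AR_closed_trancl:
  assumes R: "R \<in> AR" and "(x, y) \<in> R\<^sup>+" "(x, y) \<in> A"
  shows "(x, y) \<in> R"
proof (rule ccontr)
  assume "(x, y) \<notin> R"
  then have 1: "(x, y) \<in> reorient A R" using assms(3) by (simp add: reorient_iff)
  have "(y, x) \<in> (R\<inverse>)\<^sup>+" using assms(2) by (simp add: trancl_converse)
  then have "(y, x) \<in> (reorient A R)\<^sup>+" by (rule trancl_sub[rotated]) (auto simp: reorient_def)
  then have "(y, y) \<in> (reorient A R)\<^sup>+" using 1 by (rule trancl_into_trancl)
  then show False using R by (auto simp: AR_def acyclic_def)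
qed

lemma AR_coclosed_trancl:
  assumes R: "R \<in> AR" and "(x, y) \<in> (A - R)\<^sup>+" "(x, y) \<in> A"
  shows "(x, y) \<notin> R"
proof
  assume "(x, y) \<in> R"
  then have 1: "(y, x) \<in> reorient A R" using assms(3) by (simp add: reorient_iff)
  have "(x, y) \<in> (reorient A R)\<^sup>+"
    using assms(2) by (rule trancl_sub[rotated]) (auto simp: reorient_def)
  then have "(x, x) \<in> (reorient A R)\<^sup>+" using 1 by (rule trancl_into_trancl)
  then show False using R by (auto simp: AR_def acyclic_def)
qed

lemma AR_closed:
  "\<lbrakk>R \<in> AR; (x, y) \<in> R; (y, z) \<in> R; (x, z) \<in> A\<rbrakk> \<Longrightarrow> (x, z) \<in> R"
  by (meson AR_closed_trancl trancl.simps)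

lemma AR_coclosed:
  "\<lbrakk>R \<in> AR; (x, z) \<in> R; (x, y) \<in> A; (y, z) \<in> A\<rbrakk> \<Longrightarrow> (x, y) \<in> R \<or> (y, z) \<in> R"
proof (rule ccontr)
  assume a: "R \<in> AR" "(x, z) \<in> R" "(x, y) \<in> A" "(y, z) \<in> A" "\<not> ((x, y) \<in> R \<or> (y, z) \<in> R)"
  then have "(x, z) \<in> (A - R)\<^sup>+" by (meson DiffI r_into_trancl trancl_into_trancl)
  then show False using AR_coclosed_trancl a AR_sub by blast
qed

text \<open>A closed walk of least length, continued periodically over all naturals so that no index
  needs a wrap-around case.\<close>

lemma short_cycle:
  assumes "\<not> acyclic E"
  obtains n f where "n > 0" "\<And>i. (f i, f (Suc i)) \<in> E" "\<And>i. f (i + n) = f i"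
    "\<And>x k. 0 < k \<Longrightarrow> k < n \<Longrightarrow> (x, x) \<notin> E ^^ k"
proof -
  obtain x where "(x, x) \<in> E\<^sup>+" using assms by (auto simp: acyclic_def)
  then have ex: "\<exists>k>0. \<exists>x. (x, x) \<in> E ^^ k" by (auto simp: trancl_power)
  define n where "n = (LEAST k. k > 0 \<and> (\<exists>x. (x, x) \<in> E ^^ k))"
  have n: "n > 0 \<and> (\<exists>x. (x, x) \<in> E ^^ n)" unfolding n_def by (rule LeastI_ex) (use ex in blast)
  have min: "(x, x) \<notin> E ^^ k" if "0 < k" "k < n" for x k
    using not_less_Least[of k "\<lambda>k. k > 0 \<and> (\<exists>x. (x, x) \<in> E ^^ k)"] that n_def by blast
  obtain x where "(x, x) \<in> E ^^ n" using n by blast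
  then obtain g where g: "g 0 = x" "g n = x" "\<And>i. i < n \<Longrightarrow> (g i, g (Suc i)) \<in> E"
    by (auto simp: relpow_fun_conv)
  define f where "f i = g (i mod n)" for i
  have "(f i, f (Suc i)) \<in> E" for i
  proof (cases "Suc (i mod n) = n")
    case True
    then have "f (Suc i) = x" using g by (simp add: f_def mod_Suc)
    then show ?thesis using g(3)[of "i mod n"] True g(2) n by (simp add: f_def)
  next
    case False
    then show ?thesis using g(3)[of "i mod n"] n by (simp add: f_def mod_Suc)
  qed
  moreover have "f (i + n) = f i" for i by (simp add: f_def)
  ultimately show ?thesis using that n min by blast
qed

lemma relpow_steps:
  assumes "\<And>i. (f i, f (Suc i)) \<in> E"
  shows "(f i, f (i + k)) \<in> E ^^ k"
  by (induction k) (use assms in \<open>auto intro: relpow_Suc_I\<close>)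

text \<open>Triangles suffice because a shortest directed cycle of the reorientation has no chord.
  If its length is at least 4, its vertices span no triangle of \<open>A\<close>, so the transitive
  reduction of the subgraph induced by them keeps the whole cycle, which contradicts
  vertebracy.\<close>

lemma biclosed_imp_AR:
  assumes sub: "R \<subseteq> A"
    and cl: "\<And>x y z. \<lbrakk>(x, y) \<in> R; (y, z) \<in> R; (x, z) \<in> A\<rbrakk> \<Longrightarrow> (x, z) \<in> R"
    and cocl: "\<And>x y z. \<lbrakk>(x, z) \<in> R; (x, y) \<in> A; (y, z) \<in> A\<rbrakk> \<Longrightarrow> (x, y) \<in> R \<or> (y, z) \<in> R"
  shows "R \<in> AR"
proof -
  let ?E = "reorient A R"
  have adj: "(x, y) \<in> A \<or> (y, x) \<in> A" if "(x, y) \<in> ?E" for x y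
    using that sub by (auto simp: reorient_iff)
  have adj': "(x, y) \<in> ?E \<or> (y, x) \<in> ?E" if "(x, y) \<in> A" for x y
    using that by (auto simp: reorient_iff)
  have asym: "(y, x) \<notin> ?E" if "(x, y) \<in> ?E" for x y
    using that sub A_antisym by (auto simp: reorient_iff)
  have irr: "(x, x) \<notin> ?E" for x using asym by blast
  have "acyclic ?E"
  proof (rule ccontr)
    assume "\<not> acyclic ?E"
    then obtain n f where n: "n > 0" and f: "\<And>i. (f i, f (Suc i)) \<in> ?E"
      and per: "\<And>i. f (i + n) = f i" and min: "\<And>x k. 0 < k \<Longrightarrow> k < n \<Longrightarrow> (x, x) \<notin> ?E ^^ k"
      using short_cycle by metis
    have pow: "(f i, f (i + k)) \<in> ?E ^^ k" for i k by (rule relpow_steps) (rule f)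
    have n1: "n \<noteq> 1" using f[of 0] per[of 0] irr by auto
    have n2: "n \<noteq> 2" using f[of 0] f[of 1] per[of 0] asym by (auto simp: numeral_2_eq_2)
    have n3: "n \<noteq> 3"
    proof
      assume "n = 3"
      then have e: "(f 0, f 1) \<in> ?E" "(f 1, f 2) \<in> ?E" "(f 2, f 0) \<in> ?E"
        using f[of 0] f[of 1] f[of 2] per[of 0] by (auto simp: numeral_2_eq_2 numeral_3_eq_3)
      \<comment> \<open>The two cyclic orientations of a triangle: coclosedness excludes the one in
        which only the long arc is reversed, closedness the one in which only the two short arcs
        are.\<close>
      have no: False if xy: "(x, y) \<in> A" and yz: "(y, z) \<in> A" and xz: "(x, z) \<in> A"
        and c: "(x, y) \<in> ?E \<and> (y, z) \<in> ?E \<and> (z, x) \<in> ?E \<or> (y, x) \<in> ?E \<and> (z, y) \<in> ?E \<and> (x, z) \<in> ?E"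
        for x y z
        using c
      proof
        assume "(x, y) \<in> ?E \<and> (y, z) \<in> ?E \<and> (z, x) \<in> ?E"
        then show False using cocl[of x z y] xy yz xz A_antisym sub by (auto simp: reorient_iff)
      next
        assume "(y, x) \<in> ?E \<and> (z, y) \<in> ?E \<and> (x, z) \<in> ?E"
        then show False using cl[of x y z] xy yz xz A_antisym sub by (auto simp: reorient_iff)
      qed
      have cyc: False if "(x, y) \<in> A" "(y, z) \<in> A" "(z, x) \<in> A" for x y z
        using that acyc by (meson acyclic_def r_into_trancl trancl_trans)
      show False
        using e adj[OF e(1)] adj[OF e(2)] adj[OF e(3)]
          no[of "f 0" "f 1" "f 2"] no[of "f 1" "f 2" "f 0"] no[of "f 2" "f 0" "f 1"]
          no[of "f 2" "f 1" "f 0"] no[of "f 1" "f 0" "f 2"] no[of "f 0" "f 2" "f 1"]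
          cyc[of "f 0" "f 1" "f 2"] cyc[of "f 0" "f 2" "f 1"]
        by blast
    qed
    have n4: "n \<ge> 4" using n n1 n2 n3 by linarith
    have inj: "f i \<noteq> f j" if "i < j" "j < n" for i j
      using min[of "j - i" "f i"] pow[of i "j - i"] that by auto
    \<comment> \<open>A chord, in either direction, closes a shorter walk with one of the two parts
      of the cycle.\<close>
    have chord: "j = Suc i \<or> (i = 0 \<and> j = n - 1)"
      if "i < j" "j < n" and a: "(f i, f j) \<in> A \<or> (f j, f i) \<in> A" for i j
    proof (rule ccontr)
      assume ne: "\<not> (j = Suc i \<or> (i = 0 \<and> j = n - 1))"
      have "(f i, f j) \<in> ?E \<or> (f j, f i) \<in> ?E" using a adj' by blast
      then show False
      proof
        assume e: "(f i, f j) \<in> ?E"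
        have "(f j, f i) \<in> ?E ^^ (i + n - j)" using pow[of j "i + n - j"] per[of i] that by simp
        then have "(f j, f j) \<in> ?E ^^ Suc (i + n - j)" using e by (auto intro: relpow_Suc_I)
        moreover have "Suc (i + n - j) < n" using ne that by linarith
        ultimately show False using min by blast
      next
        assume e: "(f j, f i) \<in> ?E"
        have "(f i, f j) \<in> ?E ^^ (j - i)" using pow[of i "j - i"] that by simp
        then have "(f i, f i) \<in> ?E ^^ Suc (j - i)" using e by (auto intro: relpow_Suc_I)
        moreover have "Suc (j - i) < n" using ne that by linarith
        ultimately show False using min by blast
      qed
    qed
    define X where "X = f ` {..<n}"
    have fX: "f i \<in> X" for i
    proof -
      have "f i = f (i mod n)"
      proof (induction i rule: less_induct)
        case (less i)
        show ?case
        proof (cases "i < n")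
          case False
          then have "f i = f (i - n)" using per[of "i - n"] by simp
          also have "\<dots> = f ((i - n) mod n)" using less False n by simp
          finally show ?thesis using False by (simp add: le_mod_geq)
        qed simp
      qed
      then show ?thesis using n by (simp add: X_def)
    qed
    let ?B = "Restr A X" and ?T = "transitive_reduction (Restr A X)"
    have tri: False if abc: "a \<in> X" "b \<in> X" "c \<in> X" "(a, b) \<in> A" "(b, c) \<in> A" "(a, c) \<in> A" for a b c
    proof -
      obtain i j k where ijk: "i < n" "j < n" "k < n" "a = f i" "b = f j" "c = f k"
        using abc(1-3) by (auto simp: X_def)
      have ne: "i \<noteq> j" "j \<noteq> k" "i \<noteq> k" using abc ijk A_irrefl by auto
      have three: False if "p < q" "q < s" "s < n"
        "(f p, f q) \<in> A \<or> (f q, f p) \<in> A" "(f q, f s) \<in> A \<or> (f s, f q) \<in> A"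
        "(f p, f s) \<in> A \<or> (f s, f p) \<in> A" for p q s
        using chord[of p q] chord[of q s] chord[of p s] that n4 by linarith
      consider "i < j \<and> j < k" | "i < k \<and> k < j" | "j < i \<and> i < k" | "j < k \<and> k < i"
        | "k < i \<and> i < j" | "k < j \<and> j < i" using ne by linarith
      then show False
        using three[of i j k] three[of i k j] three[of j i k] three[of j k i] three[of k i j]
          three[of k j i] ijk abc(4-6) by cases simp_all
    qed
    \<comment> \<open>By filledness a path of length at least 2 with adjacent ends begins with a
      triangle, and there is none.\<close>
    have inT: "(x, y) \<in> ?T" if "(x, y) \<in> ?B" for x y
    proof -
      have False if p: "dpath ?B x p y" "length p - 1 \<ge> 2" for p
      proof -
        obtain a b c q where q: "p = a # b # c # q"
          using p(2) by (cases p; cases "tl p"; cases "tl (tl p)") auto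
        have "successively (\<lambda>x y. (x, y) \<in> ?B) p" using p by (simp add: dpath_def)
        then have B: "(a, b) \<in> ?B" "(b, c) \<in> ?B" using q by auto
        have "dpath A x p y" using p(1) by (rule dpath_mono) blast
        then have "(p ! 0, p ! 2) \<in> A" using \<open>(x, y) \<in> ?B\<close> q by (intro filled_nth) auto
        then show False using tri[of a b c] B q by auto
      qed
      then show ?thesis using that unfolding transitive_reduction_def by blast
    qed
    have edge: "(f i, f (Suc i)) \<in> ?T \<union> ?T\<inverse>" for i
      using adj[OF f[of i]] fX inT by auto
    let ?c = "map f [0..<n]"
    have "length ?c \<ge> 3" using n4 by simp
    moreover have "distinct ?c"
      using inj by (auto simp: distinct_map inj_on_def) (metis linorder_neqE_nat)
    moreover have "successively (\<lambda>x y. (x, y) \<in> ?T \<union> ?T\<inverse>) ?c"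
      using edge by (simp add: successively_conv_nth)
    moreover have "(last ?c, hd ?c) \<in> ?T \<union> ?T\<inverse>"
      using edge[of "n - 1"] per[of 0] n by (simp add: last_map hd_map)
    ultimately have "\<not> forest ?T" unfolding forest_def by blast
    then show False using skel by (auto simp: skeletal_def vertebrate_def)
  qed
  then show ?thesis using sub by (simp add: AR_def)
qed

lemma AR_compl: "R \<in> AR \<Longrightarrow> A - R \<in> AR"
proof -
  assume R: "R \<in> AR"
  then have "reorient A (A - R) = (reorient A R)\<inverse>" using AR_sub by (auto simp: reorient_def)
  then show ?thesis using R by (simp add: AR_def)
qed

lemma empty_AR: "{} \<in> AR"
  using acyc by (simp add: AR_def reorient_def)

section \<open>The lattice of acyclic reorientations\<close>

lemma rtrancl_walk:
  assumes "(x, y) \<in> B\<^sup>*"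
  obtains p where "hd (p @ [y]) = x" "successively (\<lambda>x y. (x, y) \<in> B) (p @ [y])"
  using assms
proof (induction arbitrary: thesis rule: converse_rtrancl_induct)
  case base
  show ?case by (rule base[of "[]"]) auto
next
  case (step x z)
  from step.IH obtain p where p: "hd (p @ [y]) = z" "successively (\<lambda>x y. (x, y) \<in> B) (p @ [y])"
    by blast
  show ?case
    by (rule step.prems[of "x # p"]) (use p step.hyps in \<open>auto simp: successively_Cons\<close>)
qed

lemma successively_imp_distinct:
  assumes "acyclic B" "successively (\<lambda>x y. (x, y) \<in> B) p"
  shows "distinct p"
proof -
  have "successively (\<lambda>x y. (x, y) \<in> B\<^sup>+) p"
    using assms(2) by (rule successively_mono) auto
  then have "sorted_wrt (\<lambda>x y. (x, y) \<in> B\<^sup>+) p"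
    by (subst successively_iff_sorted_wrt_strong[symmetric]) (auto intro: trancl_trans)
  then show ?thesis using assms(1)
    by (induction p) (auto simp: acyclic_def)
qed

text \<open>In an acyclic graph every walk is a path, so the two walks concatenate to a path from
  \<open>x\<close> to \<open>z\<close> through \<open>s\<close>.\<close>

lemma walk_through_inner:
  assumes "(x, s) \<in> A\<^sup>*" "(s, z) \<in> A\<^sup>*" "(x, z) \<in> A"
  shows "s = x \<or> s = z \<or> s \<in> inner x z"
proof -
  obtain p where p: "hd (p @ [s]) = x" "successively (\<lambda>x y. (x, y) \<in> A) (p @ [s])"
    using assms(1) by (rule rtrancl_walk)
  obtain q where q: "hd (q @ [z]) = s" "successively (\<lambda>x y. (x, y) \<in> A) (q @ [z])"
    using assms(2) by (rule rtrancl_walk)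
  have s: "successively (\<lambda>x y. (x, y) \<in> A) (p @ q @ [z])"
    using p q unfolding successively_append_iff by auto
  moreover have "hd (p @ q @ [z]) = x" using p q by (cases p) auto
  ultimately have "dpath A x (p @ q @ [z]) z"
    using successively_imp_distinct[OF acyc s] by (simp add: dpath_def)
  moreover have "s \<in> set (p @ q @ [z])" using q by (cases q) auto
  ultimately have "s \<in> transitive_support A x z" unfolding transitive_support_def by blast
  then show ?thesis using transitive_support_eq[OF assms(3)] by auto
qed

lemma acyc_trancl: "(x, x) \<notin> A\<^sup>+"
  using acyc by (simp add: acyclic_def)

text \<open>Coclosedness of the join. The endpoint is generalised from \<open>z\<close> to any
  vertex \<open>t\<close> of the walk at or after \<open>y\<close>, so that the induction can follow
  the walk; the path from \<open>t\<close> to \<open>z\<close> keeps \<open>t\<close> in the support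
  and hence comparable with \<open>y\<close>. When an arc of the walk steps over \<open>y\<close>,
  the coclosedness of the one of \<open>R\<close> and \<open>R'\<close> that contains it splits it
  at \<open>y\<close>.\<close>

lemma trancl_Un_coclosed:
  assumes R: "R \<in> AR" "R' \<in> AR"
    and xz: "(x, z) \<in> A" and y: "y \<in> inner x z"
    and "(x, t) \<in> (R \<union> R')\<^sup>+" "(t, z) \<in> A\<^sup>*" "y = t \<or> (y, t) \<in> A"
  shows "(x, y) \<in> (R \<union> R')\<^sup>+ \<or> (y, t) \<in> (R \<union> R')\<^sup>+"
proof -
  let ?K = "R \<union> R'"
  have KA: "?K \<subseteq> A" using R AR_sub by blast
  have xy: "(x, y) \<in> A" "(y, z) \<in> A" using y by (auto simp: inner_def)
  show ?thesis using assms(5-)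
  proof (induction rule: trancl_induct)
    case (base t)
    then show ?case using R AR_coclosed xy by blast
  next
    case (step t t')
    have tt': "(t, t') \<in> A" using step.hyps KA by blast
    have tz: "(t, z) \<in> A\<^sup>*" using tt' step.prems(1) by (rule converse_rtrancl_into_rtrancl)
    have xt: "(x, t) \<in> A\<^sup>+" using step.hyps(1) by (rule trancl_sub[OF KA])
    show ?case
    proof (cases "y = t'")
      case True
      then show ?thesis using step.hyps trancl_into_trancl by metis
    next
      case False
      then have yt': "(y, t') \<in> A" using step.prems by blast
      have "t \<noteq> x" using xt acyc_trancl by auto
      moreover have "t \<noteq> z"
        using tt' step.prems(1) acyc_trancl by (metis rtrancl_into_trancl2)
      ultimately have ti: "t \<in> inner x z" using walk_through_inner[OF trancl_into_rtrancl[OF xt] tz xz] by blast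
      consider "t = y" | "(y, t) \<in> A" | "(t, y) \<in> A"
        using inner_comparable[OF xz y ti] by blast
      then show ?thesis
      proof cases
        case 1
        then show ?thesis using step.hyps by blast
      next
        case 2
        then show ?thesis using step.IH[OF tz] step.hyps(2) trancl_into_trancl by metis
      next
        case 3
        then have "(t, y) \<in> ?K \<or> (y, t') \<in> ?K" using step.hyps(2) R AR_coclosed yt' by blast
        then show ?thesis using step.hyps(1) by (meson r_into_trancl trancl_into_trancl)
      qed
    qed
  qed
qed

definition rev_join :: "'v rel \<Rightarrow> 'v rel \<Rightarrow> 'v rel" where
  "rev_join R R' = A \<inter> (R \<union> R')\<^sup>+"

lemma rev_join_AR:
  assumes R: "R \<in> AR" "R' \<in> AR"
  shows "rev_join R R' \<in> AR"
proof (rule biclosed_imp_AR)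
  show "rev_join R R' \<subseteq> A" by (simp add: rev_join_def)
next
  fix x y z assume "(x, y) \<in> rev_join R R'" "(y, z) \<in> rev_join R R'" "(x, z) \<in> A"
  then show "(x, z) \<in> rev_join R R'" by (auto simp: rev_join_def)
next
  fix x y z assume "(x, z) \<in> rev_join R R'" "(x, y) \<in> A" "(y, z) \<in> A"
  then show "(x, y) \<in> rev_join R R' \<or> (y, z) \<in> rev_join R R'"
    using trancl_Un_coclosed[OF R, of x z y z] by (auto simp: rev_join_def inner_def)
qed

lemma join_eq:
  assumes R: "R \<in> AR" "R' \<in> AR"
  shows "R \<squnion>\<^bsub>acyclic_reorientations A\<^esub> R' = rev_join R R'"
proof -
  let ?L = "acyclic_reorientations A"
  have le: "le ?L = (\<subseteq>)" by (simp add: acyclic_reorientations_def)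
  have least: "rev_join R R' \<subseteq> T" if "T \<in> AR" "R \<subseteq> T" "R' \<subseteq> T" for T
    using that AR_closed_trancl trancl_sub[of "R \<union> R'" T] by (auto simp: rev_join_def)
  have up: "R \<subseteq> rev_join R R'" "R' \<subseteq> rev_join R R'"
    using R AR_sub by (auto simp: rev_join_def)
  have U: "Upper ?L {R, R'} = {T \<in> AR. R \<subseteq> T \<and> R' \<subseteq> T}"
    unfolding Upper_def carrier_AR le using R by blast
  have "least ?L (rev_join R R') (Upper ?L {R, R'})"
    unfolding least_def U carrier_AR le using rev_join_AR[OF R] least up by blast
  moreover have "S = rev_join R R'" if "least ?L S (Upper ?L {R, R'})" for S
    using that calculation unfolding least_def le by (meson subset_antisym)
  ultimately show ?thesis unfolding join_def sup_def by (rule some_equality)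
qed

text \<open>Complementation in \<open>A\<close> reverses all arcs once more, hence preserves
  \<open>AR\<close> and exchanges joins and meets.\<close>

definition rev_meet :: "'v rel \<Rightarrow> 'v rel \<Rightarrow> 'v rel" where
  "rev_meet R R' = A - rev_join (A - R) (A - R')"

lemma rev_meet_AR: "R \<in> AR \<Longrightarrow> R' \<in> AR \<Longrightarrow> rev_meet R R' \<in> AR"
  unfolding rev_meet_def by (intro AR_compl rev_join_AR)

lemma rev_meet_lower: "rev_meet R R' \<subseteq> R" "rev_meet R R' \<subseteq> R'"
  by (auto simp: rev_meet_def rev_join_def)

lemma rev_meet_greatest:
  assumes R: "R \<in> AR" "R' \<in> AR" and T: "T \<in> AR" "T \<subseteq> R" "T \<subseteq> R'"
  shows "T \<subseteq> rev_meet R R'"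
proof -
  have "(A - R) \<union> (A - R') \<subseteq> A - T" using T(2,3) by blast
  note sub = trancl_sub[OF this]
  have "rev_join (A - R) (A - R') \<subseteq> A - T"
  proof (rule subrelI)
    fix x y assume "(x, y) \<in> rev_join (A - R) (A - R')"
    then have "(x, y) \<in> A" "(x, y) \<in> (A - R \<union> (A - R'))\<^sup>+" by (auto simp: rev_join_def)
    then show "(x, y) \<in> A - T" using AR_closed_trancl[OF AR_compl[OF T(1)]] sub by blast
  qed
  then show ?thesis using AR_sub[OF T(1)] by (auto simp: rev_meet_def)
qed

lemma meet_eq:
  assumes R: "R \<in> AR" "R' \<in> AR"
  shows "R \<sqinter>\<^bsub>acyclic_reorientations A\<^esub> R' = rev_meet R R'"
proof -
  let ?L = "acyclic_reorientations A"
  have le: "le ?L = (\<subseteq>)" by (simp add: acyclic_reorientations_def)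
  have U: "Lower ?L {R, R'} = {T \<in> AR. T \<subseteq> R \<and> T \<subseteq> R'}"
    unfolding Lower_def carrier_AR le using R by blast
  have "greatest ?L (rev_meet R R') (Lower ?L {R, R'})"
    unfolding greatest_def U carrier_AR le
    using rev_meet_AR[OF R] rev_meet_greatest[OF R] rev_meet_lower[of R R'] by blast
  moreover have "S = rev_meet R R'" if "greatest ?L S (Lower ?L {R, R'})" for S
    using that calculation unfolding greatest_def le by (meson subset_antisym)
  ultimately show ?thesis unfolding meet_def inf_def by (rule some_equality)
qed

lemma rev_join_upper: "R \<in> AR \<Longrightarrow> R' \<in> AR \<Longrightarrow> R \<union> R' \<subseteq> rev_join R R'"
  using AR_sub by (auto simp: rev_join_def)

lemma rev_join_least: "T \<in> AR \<Longrightarrow> R \<subseteq> T \<Longrightarrow> R' \<subseteq> T \<Longrightarrow> rev_join R R' \<subseteq> T"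
  using AR_closed_trancl trancl_sub[of "R \<union> R'" T] by (auto simp: rev_join_def)

section \<open>Flips\<close>

definition open_chamber :: "'v rel \<Rightarrow> (real ^ 'v) set" where
  "open_chamber R = {x. \<forall>(u, v) \<in> reorient A R. x $ u < x $ v}"

lemma open_chamberD: "w \<in> open_chamber R \<Longrightarrow> (x, y) \<in> reorient A R \<Longrightarrow> w $ x < w $ y"
  by (auto simp: open_chamber_def)

lemma open_chamber_nonempty:
  assumes "R \<in> AR"
  obtains w where "w \<in> open_chamber R"
proof
  let ?E = "reorient A R"
  \<comment> \<open>The number of strict predecessors grows along every arc: the tail is counted at
    the head but not at itself.\<close>
  let ?w = "\<chi> x. real (card {y. (y, x) \<in> ?E\<^sup>+})"
  have "card {z. (z, x) \<in> ?E\<^sup>+} < card {z. (z, y) \<in> ?E\<^sup>+}" if "(x, y) \<in> ?E" for x y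
  proof (rule psubset_card_mono)
    have "x \<in> {z. (z, y) \<in> ?E\<^sup>+}" "x \<notin> {z. (z, x) \<in> ?E\<^sup>+}"
      using that assms by (auto simp: AR_def acyclic_def)
    moreover have "{z. (z, x) \<in> ?E\<^sup>+} \<subseteq> {z. (z, y) \<in> ?E\<^sup>+}" using that by auto
    ultimately show "{z. (z, x) \<in> ?E\<^sup>+} \<subset> {z. (z, y) \<in> ?E\<^sup>+}" by blast
  qed simp
  then show "?w \<in> open_chamber R" by (auto simp: open_chamber_def)
qed

lemma trancl_less:
  fixes w :: "real ^ 'v"
  assumes "\<And>x y. (x, y) \<in> B \<Longrightarrow> w $ x < w $ y" "(x, y) \<in> B\<^sup>+"
  shows "w $ x < w $ y"
  using assms(2) by induction (use assms(1) in \<open>auto intro: less_trans\<close>)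

lemma generic_AR:
  fixes w :: "real ^ 'v"
  assumes "R \<subseteq> A" "\<And>x y. (x, y) \<in> reorient A R \<Longrightarrow> w $ x < w $ y"
  shows "R \<in> AR" "w \<in> open_chamber R"
proof -
  have "(x, x) \<notin> (reorient A R)\<^sup>+" for x
    using trancl_less[of "reorient A R" w x x] assms(2) by blast
  then show "R \<in> AR" using assms(1) by (simp add: AR_def acyclic_def)
  show "w \<in> open_chamber R" using assms by (auto simp: open_chamber_def)
qed

text \<open>One flip brings \<open>R\<close> closer to \<open>R'\<close>. Among the arcs that the
  two orient differently, the one with the smallest height difference for a direction
  \<open>w\<close> in the chamber of \<open>R\<close> can be flipped.\<close>

lemma exists_flip:
  assumes R: "R \<in> AR" "R' \<in> AR" "R \<noteq> R'"
  obtains a where "a \<in> R' - R" "insert a R \<in> AR" | a where "a \<in> R - R'" "R - {a} \<in> AR"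
proof -
  let ?E = "reorient A R" and ?E' = "reorient A R'"
  have sub: "R \<subseteq> A" "R' \<subseteq> A" using R AR_sub by auto
  obtain w where w: "w \<in> open_chamber R" using open_chamber_nonempty[OF R(1)] .
  define D where "D = ?E - ?E'"
  have ac: "acyclic ?E" "acyclic ?E'" using R by (auto simp: AR_def)
  have "D \<noteq> {}"
  proof
    assume "D = {}"
    then have EE: "?E \<subseteq> ?E'" by (auto simp: D_def)
    have "(x, y) \<in> R \<longleftrightarrow> (x, y) \<in> R'" for x y
      using subsetD[OF EE, of "(x, y)"] subsetD[OF EE, of "(y, x)"] sub A_antisym[of x y]
      unfolding reorient_iff by blast
    then have "R = R'" by auto
    then show False using R by blast
  qed
  then obtain e where "is_arg_min (\<lambda>e. w $ snd e - w $ fst e) (\<lambda>e. e \<in> D) e"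
    using ex_is_arg_min_if_finite[of D "\<lambda>e. w $ snd e - w $ fst e"] by auto
  then have e: "e \<in> D" "\<And>e'. e' \<in> D \<Longrightarrow> w $ snd e - w $ fst e \<le> w $ snd e' - w $ fst e'"
    unfolding is_arg_min_linorder by blast+
  obtain x y where xy: "e = (x, y)" by force
  have xyE: "(x, y) \<in> ?E" "(x, y) \<notin> ?E'" using e xy by (auto simp: D_def)
  then have yxE': "(y, x) \<in> ?E'" using sub by (auto simp: reorient_iff)
  have less: "w $ s < w $ t" if "(s, t) \<in> ?E" for s t using w that by (rule open_chamberD)
  \<comment> \<open>A detour from \<open>x\<close> to \<open>y\<close> would consist of arcs with
    smaller height differences, on which \<open>R\<close> and \<open>R'\<close> agree by minimality;
    with \<open>(y, x)\<close> it would close a cycle in the orientation of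
    \<open>R'\<close>.\<close>
  have npath: "(x, y) \<notin> (?E - {(x, y)})\<^sup>+"
  proof
    let ?B = "?E - {(x, y)}"
    assume a: "(x, y) \<in> ?B\<^sup>+"
    have mono: "w $ s \<le> w $ t" if "(s, t) \<in> ?B\<^sup>*" for s t
      using that trancl_less[of ?B w s t] less by (cases "s = t") (auto simp: rtrancl_eq_or_trancl)
    have inE': "(s, t) \<in> ?E'" if st: "(s, t) \<in> ?B" "(x, s) \<in> ?B\<^sup>*" "(t, y) \<in> ?B\<^sup>*" for s t
    proof (rule ccontr)
      assume "(s, t) \<notin> ?E'"
      then have "(s, t) \<in> D" using st by (auto simp: D_def)
      then have "w $ y - w $ x \<le> w $ t - w $ s" using e(2)[of "(s, t)"] xy by simp
      then have "w $ s = w $ x" "w $ t = w $ y" using mono[OF st(2)] mono[OF st(3)] by auto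
      moreover have "s \<noteq> x \<Longrightarrow> w $ x < w $ s" 
        using st(2) trancl_less[of ?B w x s] less by (auto simp: rtrancl_eq_or_trancl)
      moreover have "t \<noteq> y \<Longrightarrow> w $ t < w $ y" 
        using st(3) trancl_less[of ?B w t y] less by (auto simp: rtrancl_eq_or_trancl)
      ultimately show False using st by force
    qed
    have "(x, t) \<in> ?E'\<^sup>+" if "(x, t) \<in> ?B\<^sup>+" "(t, y) \<in> ?B\<^sup>*" for t
      using that
    proof (induction rule: trancl_induct)
      case (base t)
      then show ?case using inE'[of x t] by auto
    next
      case (step t t')
      have "(t, t') \<in> ?E'"
        using inE'[of t t'] step by (auto intro: trancl_into_rtrancl)
      moreover have "(x, t) \<in> ?E'\<^sup>+" using step by (auto intro: converse_rtrancl_into_rtrancl)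
      ultimately show ?case by (rule trancl_into_trancl[rotated])
    qed
    then have "(x, y) \<in> ?E'\<^sup>+" using a by blast
    then have "(x, x) \<in> ?E'\<^sup>+" using yxE' by (rule trancl_into_trancl)
    then show False using ac by (auto simp: acyclic_def)
  qed
  have "x \<noteq> y" using less xyE by force
  then have ac1: "acyclic (insert (y, x) (?E - {(x, y)}))"
    using npath acyclic_subset[OF ac(1)] by (auto simp: rtrancl_eq_or_trancl)
  show ?thesis
  proof (cases "(x, y) \<in> A")
    case True
    then have "(x, y) \<notin> R" "(x, y) \<in> R'" using xyE sub A_antisym by (auto simp: reorient_iff)
    moreover have "reorient A (insert (x, y) R) = insert (y, x) (?E - {(x, y)})"
      using True sub A_antisym by (auto simp: reorient_def)
    ultimately show ?thesis using that(1)[of "(x, y)"] ac1 True sub by (simp add: AR_def)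
  next
    case False
    then have "(y, x) \<in> R" "(y, x) \<notin> R'" using xyE by (auto simp: reorient_iff)
    moreover have "reorient A (R - {(y, x)}) = insert (y, x) (?E - {(x, y)})"
      using False \<open>(y, x) \<in> R\<close> sub A_antisym by (auto simp: reorient_def)
    ultimately show ?thesis using that(2)[of "(y, x)"] ac1 sub by (auto simp: AR_def)
  qed
qed

definition flip :: "'v rel \<Rightarrow> 'v \<Rightarrow> 'v \<Rightarrow> bool" where
  "flip R x y \<longleftrightarrow> R \<in> AR \<and> insert (x, y) R \<in> AR \<and> (x, y) \<notin> R"

text \<open>At a flip no vertex lies between \<open>x\<close> and \<open>y\<close> in the
  orientation, so the arc from \<open>x\<close> alone tells on which side of both a vertex lies:
  those in the first set precede \<open>x\<close> and \<open>y\<close>, those in the second follow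
  them (\<open>flip_above\<close>).\<close>

definition flip_rope :: "'v rel \<Rightarrow> 'v \<Rightarrow> 'v \<Rightarrow> 'v rope" where
  "flip_rope R x y = (x, y, {l \<in> inner x y. (x, l) \<in> R}, {l \<in> inner x y. (x, l) \<notin> R})"

lemma flip_arc: "flip R x y \<Longrightarrow> (x, y) \<in> A"
  using AR_sub by (auto simp: flip_def)

lemma ropes_iff:
  "(u, v, N, \<Delta>) \<in> ropes A \<longleftrightarrow> (u, v) \<in> A \<and> N \<union> \<Delta> = inner u v \<and> N \<inter> \<Delta> = {}"
proof -
  have "transitive_support A u v - {u, v} = inner u v" if "(u, v) \<in> A"
    using A_irrefl transitive_support_eq[OF that] by (auto simp: inner_def)
  then show ?thesis unfolding ropes_def by auto
qed

lemma flip_rope_in_ropes: "flip R x y \<Longrightarrow> flip_rope R x y \<in> ropes A"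
  using flip_arc by (auto simp: flip_rope_def ropes_iff)

lemma flip_above:
  assumes f: "flip R x y" and l: "l \<in> inner x y" "(x, l) \<notin> R"
  shows "(l, y) \<in> R"
proof -
  have "(x, l) \<in> insert (x, y) R \<or> (l, y) \<in> insert (x, y) R"
    using f l by (intro AR_coclosed) (auto simp: flip_def inner_def)
  then show ?thesis using l A_irrefl by (auto simp: inner_def)
qed

section \<open>Congruences and ropes\<close>

text \<open>The join irreducible of the rope: the least upper end of all flips with this rope.
  Removing \<open>(u, v)\<close> gives the lower end of the same flip.\<close>

definition rope_rev :: "'v \<Rightarrow> 'v \<Rightarrow> 'v set \<Rightarrow> 'v set \<Rightarrow> 'v rel" where
  "rope_rev u v N \<Delta> = {(p, q) \<in> A. p \<in> {u} \<union> \<Delta> \<and> q \<in> N \<union> {v}}"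

lemma inner_trans:
  assumes uv: "(u, v) \<in> A" and "p \<in> {u, v} \<union> inner u v" "q \<in> {u, v} \<union> inner u v"
    "(p, l) \<in> A" "(l, q) \<in> A"
  shows "l \<in> inner u v"
proof -
  have "(u, p) \<in> A\<^sup>*" "(q, v) \<in> A\<^sup>*" using assms by (auto simp: inner_def)
  then have "(u, l) \<in> A\<^sup>*" "(l, v) \<in> A\<^sup>*" using assms
    by (meson rtrancl.rtrancl_into_rtrancl converse_rtrancl_into_rtrancl)+
  then have "l = u \<or> l = v \<or> l \<in> inner u v" using walk_through_inner uv by blast
  moreover have "l \<noteq> u" using assms A_irrefl A_antisym by (auto simp: inner_def)
  moreover have "l \<noteq> v" using assms A_irrefl A_antisym by (auto simp: inner_def)
  ultimately show ?thesis by blast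
qed

context
  fixes u v N \<Delta>
  assumes rope: "(u, v, N, \<Delta>) \<in> ropes A"
begin

lemma rope_arc: "(u, v) \<in> A" and rope_inner: "N \<union> \<Delta> = inner u v" and rope_disj: "N \<inter> \<Delta> = {}"
  using rope by (auto simp: ropes_iff)

lemma rope_uv: "u \<notin> N" "u \<notin> \<Delta>" "v \<notin> N" "v \<notin> \<Delta>" "u \<noteq> v"
  using rope_inner rope_arc A_irrefl by (auto simp: inner_def)

lemma rope_rev_AR: "rope_rev u v N \<Delta> \<in> AR"
  and rope_rev_minus_AR: "rope_rev u v N \<Delta> - {(u, v)} \<in> AR"
proof -
  have mid: "l \<in> N \<union> \<Delta>" if "(p, q) \<in> rope_rev u v N \<Delta>" "(p, l) \<in> A" "(l, q) \<in> A" for p q l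
    using inner_trans[OF rope_arc _ _ that(2,3)] that(1) rope_inner by (auto simp: rope_rev_def)
  show "rope_rev u v N \<Delta> \<in> AR"
    by (rule biclosed_imp_AR) (use rope_disj rope_uv mid in \<open>auto simp: rope_rev_def\<close>)
  show "rope_rev u v N \<Delta> - {(u, v)} \<in> AR"
  proof (rule biclosed_imp_AR)
    fix x y z assume *: "(x, z) \<in> rope_rev u v N \<Delta> - {(u, v)}" "(x, y) \<in> A" "(y, z) \<in> A"
    then have "y \<in> N \<union> \<Delta>" using mid by blast
    then show "(x, y) \<in> rope_rev u v N \<Delta> - {(u, v)} \<or> (y, z) \<in> rope_rev u v N \<Delta> - {(u, v)}"
      using * rope_uv by (auto simp: rope_rev_def)
  qed (use rope_disj rope_uv in \<open>auto simp: rope_rev_def\<close>)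
qed

lemma rope_rev_uv: "(u, v) \<in> rope_rev u v N \<Delta>"
  using rope_arc by (simp add: rope_rev_def)

end

lemma rev_join_eqI: "T \<in> AR \<Longrightarrow> R \<in> AR \<Longrightarrow> R' \<in> AR \<Longrightarrow> R \<subseteq> T \<Longrightarrow> R' \<subseteq> T \<Longrightarrow>
    (\<And>S. S \<in> AR \<Longrightarrow> R \<subseteq> S \<Longrightarrow> R' \<subseteq> S \<Longrightarrow> T \<subseteq> S) \<Longrightarrow> rev_join R R' = T"
  using rev_join_AR rev_join_least rev_join_upper by (meson Un_subset_iff subset_antisym)

lemma rev_meet_eqI: "T \<in> AR \<Longrightarrow> R \<in> AR \<Longrightarrow> R' \<in> AR \<Longrightarrow> T \<subseteq> R \<Longrightarrow> T \<subseteq> R' \<Longrightarrow>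
    R \<inter> R' \<subseteq> T \<Longrightarrow> rev_meet R R' = T"
  using rev_meet_lower rev_meet_greatest by (meson Int_greatest subset_antisym subset_trans)

definition subrope :: "'v rope \<Rightarrow> 'v rope \<Rightarrow> bool" where
  "subrope = (\<lambda>(x, y, N', \<Delta>') (u, v, N, \<Delta>).
     (x, y) \<in> A \<and> {x, y} \<subseteq> {u, v} \<union> N \<union> \<Delta> \<and> N' = N \<inter> inner x y \<and> \<Delta>' = \<Delta> \<inter> inner x y)"

context
  fixes r :: "'v rel rel"
  assumes cong: "lattice_congruence (acyclic_reorientations A) r"
begin

lemma cong_equiv: "equiv AR r"
  using cong by (simp add: lattice_congruence_def carrier_AR)

lemma cong_AR: "(R, R') \<in> r \<Longrightarrow> R \<in> AR \<and> R' \<in> AR"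
  using cong_equiv by (auto simp: equiv_def refl_on_def)

lemma cong_refl: "R \<in> AR \<Longrightarrow> (R, R) \<in> r"
  using cong_equiv by (simp add: equiv_def refl_on_def)

lemma cong_sym: "(R, R') \<in> r \<Longrightarrow> (R', R) \<in> r"
  using cong_equiv by (meson equiv_def symE)

lemma cong_trans: "(R, R') \<in> r \<Longrightarrow> (R', R'') \<in> r \<Longrightarrow> (R, R'') \<in> r"
  using cong_equiv by (meson equiv_def transE)

lemma cong_join:
  assumes "(R, R') \<in> r" "T \<in> AR"
  shows "(rev_join R T, rev_join R' T) \<in> r"
proof -
  have "(R \<squnion>\<^bsub>acyclic_reorientations A\<^esub> T, R' \<squnion>\<^bsub>acyclic_reorientations A\<^esub> T) \<in> r"
    using cong assms cong_refl unfolding lattice_congruence_def by fast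
  then show ?thesis using assms cong_AR by (simp add: join_eq)
qed

lemma cong_meet:
  assumes "(R, R') \<in> r" "T \<in> AR"
  shows "(rev_meet R T, rev_meet R' T) \<in> r"
proof -
  have "(R \<sqinter>\<^bsub>acyclic_reorientations A\<^esub> T, R' \<sqinter>\<^bsub>acyclic_reorientations A\<^esub> T) \<in> r"
    using cong assms cong_refl unfolding lattice_congruence_def by fast
  then show ?thesis using assms cong_AR by (simp add: meet_eq)
qed

text \<open>The flip and the flip at the join irreducible of its rope are perspective intervals:
  meeting with \<open>?j\<close> carries the first to the second, and joining with \<open>R\<close>
  carries the second back.\<close>

lemma flip_cong_iff:
  assumes f: "flip R x y" and fr: "flip_rope R x y = (x, y, N, \<Delta>)"
  shows "(R, insert (x, y) R) \<in> r \<longleftrightarrow> (rope_rev x y N \<Delta> - {(x, y)}, rope_rev x y N \<Delta>) \<in> r"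
proof -
  let ?j = "rope_rev x y N \<Delta>" and ?j' = "rope_rev x y N \<Delta> - {(x, y)}" and ?R = "insert (x, y) R"
  have rope: "(x, y, N, \<Delta>) \<in> ropes A" using flip_rope_in_ropes[OF f] fr by simp
  have AR: "R \<in> AR" "?R \<in> AR" "?j \<in> AR" "?j' \<in> AR"
    using f rope_rev_AR[OF rope] rope_rev_minus_AR[OF rope] by (auto simp: flip_def)
  have xy: "(x, y) \<notin> R" "(x, y) \<in> ?j" using f rope_rev_uv[OF rope] by (auto simp: flip_def)
  have N: "N = {l \<in> inner x y. (x, l) \<in> R}" and D: "\<Delta> = {l \<in> inner x y. (x, l) \<notin> R}"
    using fr by (auto simp: flip_rope_def)
  have sub: "?j' \<subseteq> R"
  proof (rule subrelI)
    fix p q assume a: "(p, q) \<in> ?j'"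
    then have pq: "(p, q) \<in> A" "p = x \<or> p \<in> \<Delta>" "q \<in> N \<or> q = y" "(p, q) \<noteq> (x, y)"
      by (auto simp: rope_rev_def)
    show "(p, q) \<in> R"
    proof (cases "p = x")
      case True
      then show ?thesis using pq N by auto
    next
      case False
      then have p: "p \<in> inner x y" "(x, p) \<notin> R" using pq D by auto
      show ?thesis
      proof (cases "q = y")
        case True
        then show ?thesis using flip_above[OF f p] by simp
      next
        case False
        then have "(x, q) \<in> R" using pq N by auto
        then show ?thesis using AR_coclosed[OF AR(1), of x q p] p pq by (auto simp: inner_def)
      qed
    qed
  qed
  show ?thesis
  proof
    assume "(R, ?R) \<in> r"
    then have "(rev_meet R ?j, rev_meet ?R ?j) \<in> r" using AR by (intro cong_meet)
    moreover have "rev_meet R ?j = ?j'" by (rule rev_meet_eqI) (use AR sub xy in auto)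
    moreover have "rev_meet ?R ?j = ?j" by (rule rev_meet_eqI) (use AR sub xy in auto)
    ultimately show "(?j', ?j) \<in> r" by simp
  next
    assume "(?j', ?j) \<in> r"
    then have "(rev_join ?j' R, rev_join ?j R) \<in> r" using AR by (intro cong_join)
    moreover have "rev_join ?j' R = R" by (rule rev_join_eqI) (use AR sub xy in auto)
    moreover have "rev_join ?j R = ?R" by (rule rev_join_eqI) (use AR sub xy in auto)
    ultimately show "(R, ?R) \<in> r" by simp
  qed
qed

text \<open>Exchanging the sides of \<open>x\<close> and \<open>y\<close> produces the reorientation with which the contraction of
  the smaller rope is joined in order to contract the larger one.\<close>

lemma subrope_cong:
  assumes rope: "(u, v, N, \<Delta>) \<in> ropes A" and sub: "subrope (x, y, N', \<Delta>') (u, v, N, \<Delta>)"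
    and r: "(rope_rev x y N' \<Delta>' - {(x, y)}, rope_rev x y N' \<Delta>') \<in> r"
  shows "(rope_rev u v N \<Delta> - {(u, v)}, rope_rev u v N \<Delta>) \<in> r"
proof -
  note uv = rope_arc[OF rope] and inn = rope_inner[OF rope] and disj = rope_disj[OF rope]
    and ne = rope_uv[OF rope]
  have xy: "(x, y) \<in> A" "x \<in> {u, v} \<union> inner u v" "y \<in> {u, v} \<union> inner u v"
    and N': "N' = N \<inter> inner x y" and D': "\<Delta>' = \<Delta> \<inter> inner x y"
    using sub inn by (auto simp: subrope_def)
  have xv: "x \<noteq> v" using xy uv A_irrefl A_antisym by (auto simp: inner_def)
  have yu: "y \<noteq> u" using xy uv A_irrefl A_antisym by (auto simp: inner_def)
  have ux: "x \<noteq> u \<Longrightarrow> (u, x) \<in> A" and yv: "y \<noteq> v \<Longrightarrow> (y, v) \<in> A"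
    using xy xv yu by (auto simp: inner_def)
  have uy: "(u, y) \<in> A" and xv': "(x, v) \<in> A" using xy xv yu uv by (auto simp: inner_def)
  \<comment> \<open>\<open>x\<close> is put on the nabla side and \<open>y\<close> on the \<Delta>
    side, unless they are ends of the larger rope. Then \<open>(u, x)\<close> and
    \<open>(y, v)\<close> are reversed in \<open>?X'\<close>, and reversing \<open>(x, y)\<close> as
    well forces \<open>(u, v)\<close> by closedness.\<close>
  define L where "L = (N - {y}) \<union> ({x} - {u})"
  define H where "H = (\<Delta> - {x}) \<union> ({y} - {v})"
  have rX: "(u, v, L, H) \<in> ropes A"
    using uv inn disj xy xv yu ne A_irrefl by (auto simp: ropes_iff L_def H_def)
  have xy_in: "inner x y \<subseteq> inner u v"
    using inner_trans[OF uv xy(2,3)] by (auto simp: inner_def)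
  have rs: "(x, y, N', \<Delta>') \<in> ropes A"
    using xy(1) xy_in inn disj by (auto simp: ropes_iff N' D')
  let ?j = "rope_rev u v N \<Delta>" and ?s = "rope_rev x y N' \<Delta>'" and ?X = "rope_rev u v L H"
  let ?j' = "?j - {(u, v)}" and ?s' = "?s - {(x, y)}" and ?X' = "?X - {(u, v)}"
  have AR: "?j \<in> AR" "?j' \<in> AR" "?s \<in> AR" "?s' \<in> AR" "?X' \<in> AR"
    using rope_rev_AR rope_rev_minus_AR rope rs rX by auto
  let ?T = "rev_join ?s ?X'" and ?T' = "rev_join ?s' ?X'"
  have TT: "?T \<in> AR" "?T' \<in> AR" using AR by (auto intro: rev_join_AR)
  have Ts: "?s \<subseteq> ?T" and TX: "?X' \<subseteq> ?T" using rev_join_upper AR by blast+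
  have Ttr: "(a, c) \<in> ?T" if "(a, b) \<in> ?T" "(b, c) \<in> ?T" "(a, c) \<in> A" for a b c
    using AR_closed[OF TT(1)] that by blast
  \<comment> \<open>As long as \<open>(x, y)\<close> is not reversed, no step of the two sets leaves
    \<open>{u} \<union> L\<close>, and this set misses \<open>v\<close>.\<close>
  have nT': "(u, v) \<notin> ?T'"
  proof
    assume "(u, v) \<in> ?T'"
    then have p: "(u, v) \<in> (?s' \<union> ?X')\<^sup>+" by (simp add: rev_join_def)
    have st: "t \<in> {u} \<union> L" if K: "(s, t) \<in> ?s' \<union> ?X'" and s: "s \<in> {u} \<union> L" for s t
    proof -
      have sH: "s \<notin> H" using s rope_disj[OF rX] rope_uv[OF rX] by blast
      consider "(s, t) \<in> ?s'" | "(s, t) \<in> ?X'" using K by blast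
      then show ?thesis
      proof cases
        case 1
        then have "s = x \<or> s \<in> \<Delta>'" "t \<in> N' \<or> t = y" "(s, t) \<noteq> (x, y)" by (auto simp: rope_rev_def)
        moreover have "s \<notin> \<Delta>'" using sH D' A_irrefl by (auto simp: H_def inner_def)
        ultimately have "t \<in> N'" by blast
        then show ?thesis using N' A_irrefl by (auto simp: L_def inner_def)
      next
        case 2
        then have "s = u \<or> s \<in> H" "t \<in> L \<or> t = v" "(s, t) \<noteq> (u, v)" by (auto simp: rope_rev_def)
        then show ?thesis using sH by blast
      qed
    qed
    have "t \<in> {u} \<union> L" if "(u, t) \<in> (?s' \<union> ?X')\<^sup>+" for t
      using that by (induction rule: trancl_induct) (use st in blast)+
    then have "v \<in> {u} \<union> L" using p by blast
    then show False using rope_uv[OF rX] by auto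
  qed
  have xyT: "(x, y) \<in> ?T" using rope_rev_uv[OF rs] Ts by blast
  have uxT: "x \<noteq> u \<Longrightarrow> (u, x) \<in> ?T" using ux TX xv by (auto simp: rope_rev_def L_def)
  have yvT: "y \<noteq> v \<Longrightarrow> (y, v) \<in> ?T" using yv TX yu by (auto simp: rope_rev_def H_def)
  have uyT: "(u, y) \<in> ?T" using Ttr[OF uxT xyT uy] xyT by blast
  have xvT: "(x, v) \<in> ?T" using Ttr[OF xyT yvT xv'] xyT by blast
  have uvT: "(u, v) \<in> ?T" using Ttr[OF uyT yvT uv] uyT by blast
  \<comment> \<open>Only arcs leaving \<open>x\<close> or entering \<open>y\<close> are affected by
    the change of sides. Such an arc either passes through the other end of \<open>(x, y)\<close> or
    lies in \<open>?s\<close>, according to the order of the vertices.\<close>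
  have jT: "?j \<subseteq> ?T"
  proof (rule subrelI)
    fix p q assume "(p, q) \<in> ?j"
    then have pq: "(p, q) \<in> A" "p = u \<or> p \<in> \<Delta>" "q \<in> N \<or> q = v" by (auto simp: rope_rev_def)
    have pX: "(p, t) \<in> ?T" if "(p, t) \<in> A" "p \<noteq> x \<or> x = u" "t \<in> L \<or> t = v" "(p, t) \<noteq> (u, v)" for t
      using TX that pq by (auto simp: rope_rev_def H_def)
    have qX: "(t, q) \<in> ?T" if "(t, q) \<in> A" "q \<noteq> y \<or> y = v" "t \<in> H \<or> t = u" "(t, q) \<noteq> (u, v)" for t
      using TX that pq by (auto simp: rope_rev_def L_def)
    show "(p, q) \<in> ?T"
    proof (cases "(p, q) = (u, v)")
      case True
      then show ?thesis using uvT by simp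
    next
      case nuv: False
      consider "p = x" "q = y" | "p = x" "q \<noteq> y" | "p \<noteq> x" "q = y" | "p \<noteq> x" "q \<noteq> y" by blast
      then show ?thesis
      proof cases
        case 1
        then show ?thesis using xyT by simp
      next
        case 2
        show ?thesis
        proof (cases "q = v")
          case True
          then show ?thesis using xvT 2 by simp
        next
          case False
          then have qN: "q \<in> N" "q \<in> inner u v" using pq inn by auto
          then have "(y, q) \<in> A \<or> (q, y) \<in> A"
            using inner_comparable[OF uv, of y q] xy(3) yu 2 by (auto simp: inner_def)
          then show ?thesis
          proof
            assume yq: "(y, q) \<in> A"
            then have "y \<noteq> v" using qN A_antisym by (auto simp: inner_def)
            then have "(y, q) \<in> ?T" using qX[of y] 2 yq yu by (auto simp: H_def)
            then show ?thesis using Ttr[OF xyT] 2 pq by blast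
          next
            assume "(q, y) \<in> A"
            then have "q \<in> N'" using 2 pq qN by (auto simp: N' inner_def)
            then have "(x, q) \<in> ?s" using 2 pq by (auto simp: rope_rev_def)
            then show ?thesis using Ts 2 by blast
          qed
        qed
      next
        case 3
        show ?thesis
        proof (cases "p = u")
          case True
          then show ?thesis using uyT 3 by simp
        next
          case False
          then have pD: "p \<in> \<Delta>" "p \<in> inner u v" using pq inn by auto
          then have "(p, x) \<in> A \<or> (x, p) \<in> A"
            using inner_comparable[OF uv, of x p] xy(2) xv 3 by (auto simp: inner_def)
          then show ?thesis
          proof
            assume px: "(p, x) \<in> A"
            then have "x \<noteq> u" using pD A_antisym by (auto simp: inner_def)
            then have "(p, x) \<in> ?T" using pX[of x] 3 px xv by (auto simp: L_def)
            then show ?thesis using Ttr[OF _ xyT] 3 pq by blast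
          next
            assume "(x, p) \<in> A"
            then have "p \<in> \<Delta>'" using 3 pq pD by (auto simp: D' inner_def)
            then have "(p, y) \<in> ?s" using 3 pq by (auto simp: rope_rev_def)
            then show ?thesis using Ts 3 by blast
          qed
        qed
      next
        case 4
        then show ?thesis using pX[of q] pq nuv by (auto simp: L_def)
      qed
    qed
  qed
  \<comment> \<open>Meeting with \<open>?j\<close> brings the pair below \<open>?j\<close>, where
    the lower element misses \<open>(u, v)\<close> and so lies below \<open>?j'\<close>; joining
    with \<open>?j'\<close> then gives the pair wanted.\<close>
  have "(?T', ?T) \<in> r" using cong_join[OF r AR(5)] .
  then have "(rev_meet ?T' ?j, rev_meet ?T ?j) \<in> r" using AR by (intro cong_meet)
  moreover have "rev_meet ?T ?j = ?j" by (rule rev_meet_eqI) (use AR TT jT in auto)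
  ultimately have 1: "(rev_meet ?T' ?j, ?j) \<in> r" by simp
  have m: "rev_meet ?T' ?j \<in> AR" using TT AR by (auto intro: rev_meet_AR)
  have "rev_meet ?T' ?j \<subseteq> ?j'" using rev_meet_lower nT' by blast
  then have "rev_join (rev_meet ?T' ?j) ?j' = ?j'" by (intro rev_join_eqI) (use AR m in auto)
  moreover have "rev_join ?j ?j' = ?j" by (rule rev_join_eqI) (use AR in auto)
  ultimately show ?thesis using cong_join[OF 1 AR(2)] by simp
qed

lemma flip_cong_subrope:
  assumes "flip R x y" "flip R' u v" "subrope (flip_rope R x y) (flip_rope R' u v)"
    "(R, insert (x, y) R) \<in> r"
  shows "(R', insert (u, v) R') \<in> r"
proof -
  obtain N' D' where 1: "flip_rope R x y = (x, y, N', D')" by (simp add: flip_rope_def)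
  obtain N D where 2: "flip_rope R' u v = (u, v, N, D)" by (simp add: flip_rope_def)
  show ?thesis
    using assms flip_cong_iff[OF _ 1] flip_cong_iff[OF _ 2] subrope_cong[of u v N D x y N' D']
      flip_rope_in_ropes[OF assms(2)] 1 2 by simp
qed

lemma cong_between:
  assumes "(R, T) \<in> r" "R \<subseteq> S" "S \<subseteq> T" "S \<in> AR"
  shows "(R, S) \<in> r"
proof -
  have AR: "R \<in> AR" "T \<in> AR" using assms cong_AR by auto
  have "rev_meet R S = R" by (rule rev_meet_eqI) (use assms AR in auto)
  moreover have "rev_meet T S = S" by (rule rev_meet_eqI) (use assms AR in auto)
  ultimately show ?thesis using cong_meet[OF assms(1,4)] by simp
qed

text \<open>Both elements are congruent to their meet, which reduces the claim to comparable
  elements. These are connected by flips inside their interval, and all such flips are contracted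
  because classes are convex.\<close>

lemma cong_invariant:
  assumes inv: "\<And>R x y. flip R x y \<Longrightarrow> (R, insert (x, y) R) \<in> r \<Longrightarrow> f R = f (insert (x, y) R)"
    and "(R, R') \<in> r"
  shows "f R = f R'"
proof -
  have up: "f S = f T" if "(S, T) \<in> r" "S \<subseteq> T" for S T
    using that
  proof (induction "card (T - S)" arbitrary: S rule: less_induct)
    case less
    show ?case
    proof (cases "S = T")
      case False
      have AR: "S \<in> AR" "T \<in> AR" using less cong_AR by auto
      obtain a where a: "a \<in> T - S" "insert a S \<in> AR"
        using exists_flip[OF AR False] less.prems by blast
      obtain x y where xy: "a = (x, y)" by force
      have 1: "(S, insert a S) \<in> r" using cong_between[OF less.prems(1)] a less.prems by blast
      have "f S = f (insert a S)" using inv[of S x y] 1 a AR xy by (auto simp: flip_def)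
      also have "\<dots> = f T"
      proof (rule less.hyps)
        show "card (T - insert a S) < card (T - S)" using a by (intro psubset_card_mono) auto
        show "(insert a S, T) \<in> r" using 1 less.prems cong_sym cong_trans by blast
      qed (use a less.prems in auto)
      finally show ?thesis .
    qed simp
  qed
  have AR: "R \<in> AR" "R' \<in> AR" using assms cong_AR by auto
  have "(rev_meet R R', rev_meet R' R') \<in> r" using cong_meet assms AR by blast
  moreover have "rev_meet R' R' = R'" by (rule rev_meet_eqI) (use AR in auto)
  ultimately have 1: "(rev_meet R R', R') \<in> r" by simp
  then have 2: "(rev_meet R R', R) \<in> r" using assms cong_sym cong_trans by blast
  show ?thesis using up[OF 1] up[OF 2] rev_meet_lower by metis
qed

end

section \<open>Polytopes with a vertex for each acyclic reorientation\<close>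

text \<open>The vertices are ordered by \<open>v\<close>, and ties are broken by \<open>R0\<close>.
  A small multiple of \<open>w\<close> realises this order, so every \<open>v\<close> lies in a
  closed chamber whose interior is reached from \<open>v\<close> in direction
  \<open>w\<close>.\<close>

lemma open_chamber_perturb:
  assumes R0: "R0 \<in> AR" and w: "w \<in> open_chamber R0"
  obtains \<epsilon> R where "\<epsilon> > 0" "R \<in> AR" "v + \<epsilon> *\<^sub>R w \<in> open_chamber R" "v \<in> chamber (reorient A R)"
proof -
  define R where "R = {(x, y) \<in> A. v $ y < v $ x \<or> v $ x = v $ y \<and> (x, y) \<in> R0}"
  have "\<forall>\<^sub>F \<epsilon> in at_right (0::real). v $ x < v $ y \<longrightarrow> v $ x + \<epsilon> * w $ x < v $ y + \<epsilon> * w $ y" for x y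
  proof (cases "v $ x < v $ y")
    case True
    have "((\<lambda>\<epsilon>. v $ y + \<epsilon> * w $ y - (v $ x + \<epsilon> * w $ x)) \<longlongrightarrow> v $ y + 0 * w $ y - (v $ x + 0 * w $ x))
        (at_right 0)"
      by (intro tendsto_intros)
    then have "\<forall>\<^sub>F \<epsilon> in at_right (0::real). 0 < v $ y + \<epsilon> * w $ y - (v $ x + \<epsilon> * w $ x)"
      by (rule order_tendstoD) (use True in simp)
    then show ?thesis by (rule eventually_mono) simp
  qed simp
  then have "\<forall>\<^sub>F \<epsilon> in at_right (0::real). \<forall>x y. v $ x < v $ y \<longrightarrow> v $ x + \<epsilon> * w $ x < v $ y + \<epsilon> * w $ y"
    by (intro eventually_all_finite)
  then have "\<forall>\<^sub>F \<epsilon> in at_right (0::real). \<epsilon> > 0 \<and> (\<forall>x y. v $ x < v $ y \<longrightarrow> v $ x + \<epsilon> * w $ x < v $ y + \<epsilon> * w $ y)"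
    using eventually_at_right_less by (rule eventually_conj[rotated])
  then obtain \<epsilon> :: real where e: "\<epsilon> > 0"
    "\<And>x y. v $ x < v $ y \<Longrightarrow> v $ x + \<epsilon> * w $ x < v $ y + \<epsilon> * w $ y"
    using eventually_happens'[OF trivial_limit_at_right_real] by blast
  have RA: "R \<subseteq> A" by (auto simp: R_def)
  have R0A: "R0 \<subseteq> A" using R0 AR_sub by blast
  have E: "v $ x < v $ y \<or> v $ x = v $ y \<and> (x, y) \<in> reorient A R0" if "(x, y) \<in> reorient A R" for x y
    using that R0A by (auto simp: reorient_def R_def)
  have less: "(v + \<epsilon> *\<^sub>R w) $ x < (v + \<epsilon> *\<^sub>R w) $ y" if "(x, y) \<in> reorient A R" for x y
    using E[OF that] e open_chamberD[OF w, of x y] by auto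
  show ?thesis
  proof (rule that[OF e(1)])
    show "R \<in> AR" "v + \<epsilon> *\<^sub>R w \<in> open_chamber R" using generic_AR[OF RA] less by blast+
    show "v \<in> chamber (reorient A R)" using E by (fastforce simp: chamber_def)
  qed
qed

lemma AR_finite: "finite AR" by (rule finite_subset[of _ "Pow A"]) (use AR_sub in auto)

context
  fixes P :: "(real ^ 'v) set" and p :: "'v rel \<Rightarrow> real ^ 'v"
  assumes conv: "convex P"
    and pP: "\<And>R. R \<in> AR \<Longrightarrow> p R \<in> P"
    and pmax: "\<And>R w x. \<lbrakk>R \<in> AR; w \<in> open_chamber R; x \<in> P; x \<noteq> p R\<rbrakk> \<Longrightarrow> w \<bullet> x < w \<bullet> p R"
begin

lemma chamber_max:
  assumes R: "R \<in> AR" and v: "v \<in> chamber (reorient A R)" and x: "x \<in> P"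
  shows "v \<bullet> x \<le> v \<bullet> p R"
proof (rule ccontr)
  assume "\<not> v \<bullet> x \<le> v \<bullet> p R"
  then have gt: "v \<bullet> x - v \<bullet> p R > 0" "x \<noteq> p R" by auto
  obtain w where w: "w \<in> open_chamber R" using open_chamber_nonempty[OF R] .
  have pos: "w \<bullet> p R - w \<bullet> x > 0" using pmax[OF R w x] gt by simp
  \<comment> \<open>The multiple of \<open>w\<close> at which the supposed gain of \<open>x\<close>
    in direction \<open>v\<close> just balances its loss in direction \<open>w\<close>. The
    perturbed direction is in the open chamber and would have to favour \<open>p R\<close>
    strictly.\<close>
  define \<epsilon> where "\<epsilon> = (v \<bullet> x - v \<bullet> p R) / (w \<bullet> p R - w \<bullet> x)"
  have e: "\<epsilon> > 0" using gt pos by (simp add: \<epsilon>_def)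
  have "v + \<epsilon> *\<^sub>R w \<in> open_chamber R"
    using v w e by (fastforce simp: chamber_def open_chamber_def intro!: add_le_less_mono)
  then have "(v + \<epsilon> *\<^sub>R w) \<bullet> x < (v + \<epsilon> *\<^sub>R w) \<bullet> p R" using pmax R x gt by blast
  then have "v \<bullet> x - v \<bullet> p R < \<epsilon> * (w \<bullet> p R - w \<bullet> x)" by (simp add: inner_add_left algebra_simps)
  then show False using pos by (simp add: \<epsilon>_def)
qed

definition vertex_cone :: "'v rel \<Rightarrow> (real ^ 'v) set" where
  "vertex_cone R = {v. \<forall>y\<in>P. v \<bullet> y \<le> v \<bullet> p R}"

text \<open>Moving from \<open>v\<close> slightly into the open chamber of \<open>R\<close> ends in
  the open chamber of some \<open>R'\<close> whose closure contains \<open>v\<close>. If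
  \<open>p R\<close> and \<open>p R'\<close> differed, strictness in both chambers would contradict
  the maximality of \<open>p R\<close> at \<open>v\<close>.\<close>

lemma vertex_cone_eq:
  assumes R: "R \<in> AR"
  shows "vertex_cone R = (\<Union>R' \<in> {R' \<in> AR. p R' = p R}. chamber (reorient A R'))"
proof (intro equalityI subsetI)
  fix v assume v: "v \<in> vertex_cone R"
  obtain w where w: "w \<in> open_chamber R" using open_chamber_nonempty[OF R] .
  obtain \<epsilon> R' where e: "\<epsilon> > 0" "R' \<in> AR" "v + \<epsilon> *\<^sub>R w \<in> open_chamber R'" "v \<in> chamber (reorient A R')"
    using open_chamber_perturb[OF R w] .
  have "p R' = p R"
  proof (rule ccontr)
    assume ne: "p R' \<noteq> p R"
    have 1: "(v + \<epsilon> *\<^sub>R w) \<bullet> p R < (v + \<epsilon> *\<^sub>R w) \<bullet> p R'" using pmax[OF e(2,3) pP[OF R]] ne by simp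
    have 2: "w \<bullet> p R' < w \<bullet> p R" using pmax[OF R w pP[OF e(2)]] ne by simp
    have 3: "v \<bullet> p R' \<le> v \<bullet> p R" using v pP[OF e(2)] by (simp add: vertex_cone_def)
    have "\<epsilon> * (w \<bullet> p R') < \<epsilon> * (w \<bullet> p R)" using 2 e by simp
    then show False using 1 3 by (simp add: inner_add_left)
  qed
  then show "v \<in> (\<Union>R' \<in> {R' \<in> AR. p R' = p R}. chamber (reorient A R'))" using e by blast
next
  fix v assume "v \<in> (\<Union>R' \<in> {R' \<in> AR. p R' = p R}. chamber (reorient A R'))"
  then obtain R' where R': "R' \<in> AR" "p R' = p R" "v \<in> chamber (reorient A R')" by blast
  then show "v \<in> vertex_cone R" using chamber_max[OF R'(1,3)] by (simp add: vertex_cone_def)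
qed

text \<open>The normal of a hyperplane separating a point from the hull lies in some closed chamber,
  and the vertex of that chamber is at least as good as the point.\<close>

lemma hull_eq: "P = convex hull (p ` AR)"
proof
  show "convex hull (p ` AR) \<subseteq> P" using conv pP by (intro hull_minimal) auto
  show "P \<subseteq> convex hull (p ` AR)"
  proof
    fix x assume x: "x \<in> P"
    show "x \<in> convex hull (p ` AR)"
    proof (rule ccontr)
      assume "x \<notin> convex hull (p ` AR)"
      moreover have "closed (convex hull (p ` AR))"
        using AR_finite by (intro compact_imp_closed finite_imp_compact_convex_hull) auto
      ultimately obtain a b where ab: "a \<bullet> x < b" "\<And>y. y \<in> convex hull (p ` AR) \<Longrightarrow> b < a \<bullet> y"
        using separating_hyperplane_closed_point[OF convex_convex_hull] by metis
      \<comment> \<open>Any generic direction will do: it only breaks ties to place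
        \<open>- a\<close> in a chamber.\<close>
      obtain w where w: "w \<in> open_chamber {}" using open_chamber_nonempty[OF empty_AR] .
      obtain \<epsilon> R where R: "R \<in> AR" "- a \<in> chamber (reorient A R)"
        using open_chamber_perturb[OF empty_AR w] by metis
      have "(- a) \<bullet> x \<le> (- a) \<bullet> p R" by (rule chamber_max[OF R x])
      moreover have "b < a \<bullet> p R" using R by (intro ab hull_inc) auto
      ultimately show False using ab(1) by simp
    qed
  qed
qed

lemma polytope_P: "polytope P"
  unfolding polytope_def using AR_finite hull_eq by blast

text \<open>Within the cone of the vertex, maximality on all of \<open>F\<close> adds the reverses
  of inequalities that already hold there, so these become equations, and linear inequalities that
  turn into equations cut out a face.\<close>

lemma normal_cone_face:
  assumes R: "R \<in> AR" and F: "F face_of P" "p R \<in> F"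
  shows "normal_cone P F face_of vertex_cone R"
proof -
  have FP: "F \<subseteq> P" using F face_of_imp_subset by blast
  have N: "normal_cone P F = {v. F \<subseteq> max_face P v}"
    using normal_cone_eq[OF polytope_P F(1)] F(2) by blast
  have mem: "v \<in> normal_cone P F \<longleftrightarrow> v \<in> vertex_cone R \<and> (\<forall>y\<in>F. v \<bullet> p R \<le> v \<bullet> y)" for v
    unfolding N max_face_def vertex_cone_def using FP F(2) pP[OF R] by (auto; meson order_trans)
  have cv: "convex (vertex_cone R)"
    unfolding vertex_cone_def convex_def
    by (auto simp: inner_add_left intro!: add_mono mult_left_mono)
  show ?thesis
    unfolding face_of_def
  proof (intro conjI ballI impI)
    show "normal_cone P F \<subseteq> vertex_cone R" using mem by blast
    show "convex (normal_cone P F)"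
      unfolding convex_def
    proof (intro ballI allI impI)
      fix x y and s t :: real assume a: "x \<in> normal_cone P F" "y \<in> normal_cone P F" "0 \<le> s" "0 \<le> t" "s + t = 1"
      then have "s *\<^sub>R x + t *\<^sub>R y \<in> vertex_cone R" using cv mem unfolding convex_def by blast
      then show "s *\<^sub>R x + t *\<^sub>R y \<in> normal_cone P F"
        using a by (auto simp: mem inner_add_left intro!: add_mono mult_left_mono)
    qed
    fix a b x assume h: "a \<in> vertex_cone R" "b \<in> vertex_cone R" "x \<in> normal_cone P F" "x \<in> open_segment a b"
    obtain s where s: "0 < s" "s < 1" "x = (1 - s) *\<^sub>R a + s *\<^sub>R b"
      using h(4) by (auto simp: in_segment)
    have "a \<bullet> p R \<le> a \<bullet> y \<and> b \<bullet> p R \<le> b \<bullet> y" if y: "y \<in> F" for y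
    proof -
      have 1: "a \<bullet> (p R - y) \<ge> 0" "b \<bullet> (p R - y) \<ge> 0"
        using h y FP by (auto simp: vertex_cone_def inner_diff_right)
      have "x \<bullet> (p R - y) \<le> 0" using h(3) y mem by (simp add: inner_diff_right)
      then have "(1 - s) * (a \<bullet> (p R - y)) + s * (b \<bullet> (p R - y)) \<le> 0"
        by (simp add: s(3) inner_add_left)
      moreover have "0 \<le> (1 - s) * (a \<bullet> (p R - y))" "0 \<le> s * (b \<bullet> (p R - y))" using s 1 by auto
      ultimately have "(1 - s) * (a \<bullet> (p R - y)) = 0" "s * (b \<bullet> (p R - y)) = 0" by linarith+
      then show ?thesis using s by (simp add: inner_diff_right)
    qed
    then show "a \<in> normal_cone P F" "b \<in> normal_cone P F" using h mem by auto
  qed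
qed

text \<open>A relative interior point \<open>v\<close> of \<open>G\<close> selects the face
  \<open>F\<close>. Its normal cone is a face that meets the relative interior of \<open>G\<close>,
  so it contains \<open>G\<close>; conversely, each of its points \<open>h\<close> is an end of a
  segment through \<open>v\<close> inside the vertex cone, so it belongs to
  \<open>G\<close>.\<close>

lemma face_is_normal_cone:
  assumes R: "R \<in> AR" and G: "G face_of vertex_cone R" "G \<noteq> {}"
  shows "G \<in> normal_fan P"
proof -
  let ?N = "vertex_cone R"
  have "rel_interior G \<noteq> {}" using face_of_imp_convex G rel_interior_eq_empty by blast
  then obtain v where v: "v \<in> rel_interior G" by blast
  then have vG: "v \<in> G" using rel_interior_subset by blast
  then have vN: "v \<in> ?N" using G face_of_imp_subset by blast
  define F where "F = max_face P v"
  have Feq: "F = P \<inter> {x. v \<bullet> x = v \<bullet> p R}"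
    using vN pP[OF R] by (force simp: F_def max_face_def vertex_cone_def)
  have pF: "p R \<in> F" using pP[OF R] Feq by simp
  have face: "F face_of P"
    unfolding Feq
    by (rule face_of_Int_supporting_hyperplane_le[OF conv]) (use vN in \<open>auto simp: vertex_cone_def\<close>)
  let ?H = "normal_cone P F"
  have H: "?H = {h. F \<subseteq> max_face P h}" using normal_cone_eq[OF polytope_P face] pF by blast
  have Hface: "?H face_of ?N" by (rule normal_cone_face[OF R face pF])
  have vH: "v \<in> ?H" unfolding H by (simp add: F_def)
  have "G \<subseteq> ?H"
    by (rule subset_of_face_of[OF Hface])
      (use G v vH face_of_imp_subset in \<open>auto simp: disjnt_iff\<close>)
  moreover have "?H \<subseteq> G"
  proof
    fix h assume h: "h \<in> ?H"
    show "h \<in> G"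
    proof (cases "v = h")
      case False
      \<comment> \<open>The segment from \<open>h\<close> can be prolonged beyond \<open>v\<close>:
        vertices of \<open>F\<close> tie with \<open>p R\<close> at both \<open>v\<close> and
        \<open>h\<close>, and for the finitely many others the strict inequality at \<open>v\<close>
        survives a small step.\<close>
      have "\<forall>\<^sub>F t in at_right (0::real). (v + t *\<^sub>R (v - h)) \<bullet> p R' \<le> (v + t *\<^sub>R (v - h)) \<bullet> p R"
        if R': "R' \<in> AR" for R'
      proof (cases "p R' \<in> F")
        case True
        have "h \<bullet> p R' = h \<bullet> p R"
        proof -
          have "p R' \<in> max_face P h" "p R \<in> max_face P h" using h True pF unfolding H by blast+
          then show ?thesis by (auto simp: max_face_def intro: antisym)
        qed
        then show ?thesis using True Feq by (simp add: inner_add_left inner_diff_left)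
      next
        case False
        then have lt: "v \<bullet> p R' < v \<bullet> p R" using vN pP[OF R'] Feq by (force simp: vertex_cone_def)
        have "((\<lambda>t. (v + t *\<^sub>R (v - h)) \<bullet> (p R - p R')) \<longlongrightarrow> (v + 0 *\<^sub>R (v - h)) \<bullet> (p R - p R')) (at_right 0)"
          by (intro tendsto_intros)
        then have "\<forall>\<^sub>F t in at_right (0::real). 0 < (v + t *\<^sub>R (v - h)) \<bullet> (p R - p R')"
          by (rule order_tendstoD) (use lt in \<open>simp add: inner_diff_right\<close>)
        then show ?thesis by (rule eventually_mono) (simp add: inner_diff_right)
      qed
      then have "\<forall>\<^sub>F t in at_right (0::real). \<forall>R'\<in>AR. (v + t *\<^sub>R (v - h)) \<bullet> p R' \<le> (v + t *\<^sub>R (v - h)) \<bullet> p R"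
        using AR_finite by (simp add: eventually_ball_finite)
      then have "\<forall>\<^sub>F t in at_right (0::real). t > 0 \<and>
          (\<forall>R'\<in>AR. (v + t *\<^sub>R (v - h)) \<bullet> p R' \<le> (v + t *\<^sub>R (v - h)) \<bullet> p R)"
        using eventually_at_right_less by (rule eventually_conj[rotated])
      then obtain t :: real where t: "t > 0"
        "\<And>R'. R' \<in> AR \<Longrightarrow> (v + t *\<^sub>R (v - h)) \<bullet> p R' \<le> (v + t *\<^sub>R (v - h)) \<bullet> p R"
        using eventually_happens'[OF trivial_limit_at_right_real] by blast
      define a where "a = v + t *\<^sub>R (v - h)"
      have "convex hull (p ` AR) \<subseteq> {x. a \<bullet> x \<le> a \<bullet> p R}"
        by (rule hull_minimal) (use t in \<open>auto simp: a_def convex_halfspace_le\<close>)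
      then have "P \<subseteq> {x. a \<bullet> x \<le> a \<bullet> p R}" using hull_eq by simp
      then have aN: "a \<in> ?N" by (auto simp: vertex_cone_def)
      have "v = (1 - t / (1 + t)) *\<^sub>R a + (t / (1 + t)) *\<^sub>R h"
      proof -
        have "(1 + t) *\<^sub>R v = a + t *\<^sub>R h" by (simp add: a_def algebra_simps)
        then have "v = (1 / (1 + t)) *\<^sub>R (a + t *\<^sub>R h)"
          using t(1) by (metis add_pos_pos divide_self_if less_numeral_extra(1) less_numeral_extra(3) mult.commute
              scaleR_one scaleR_scaleR times_divide_eq_right mult.right_neutral)
        moreover have "1 - t / (1 + t) = 1 / (1 + t)" using t(1) by (simp add: field_simps)
        ultimately show ?thesis by (simp add: scaleR_add_right)
      qed
      moreover have "a \<noteq> h"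
      proof
        assume "a = h"
        then have "(1 + t) *\<^sub>R (v - h) = 0" by (simp add: a_def algebra_simps)
        then show False using t(1) False by simp
      qed
      moreover have "0 < t / (1 + t)" "t / (1 + t) < 1" using t(1) by auto
      ultimately have "v \<in> open_segment a h" unfolding in_segment by blast
      moreover have "h \<in> ?N" using h Hface face_of_imp_subset by blast
      ultimately show ?thesis using face_ofD[OF G(1)] aN vG by blast
    qed (use vG in simp)
  qed
  ultimately have "G = ?H" by blast
  then show ?thesis unfolding normal_fan_def using face pF by blast
qed

text \<open>A functional that exposes a face lies in some closed chamber, and then the vertex of
  that chamber belongs to the face.\<close>

lemma normal_fan_eq: "normal_fan P = fan_of_chambers (vertex_cone ` AR)"
proof (intro equalityI subsetI)
  fix G assume "G \<in> normal_fan P"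
  then obtain F where F: "F face_of P" "F \<noteq> {}" "G = normal_cone P F" by (auto simp: normal_fan_def)
  have "F exposed_face_of P"
    using F by (simp add: exposed_face_of_polyhedron polytope_imp_polyhedron polytope_P)
  then obtain a b where ab: "P \<subseteq> {x. a \<bullet> x \<le> b}" "F = P \<inter> {x. a \<bullet> x = b}"
    unfolding exposed_face_of_def by blast
  obtain w where w: "w \<in> open_chamber {}" using open_chamber_nonempty[OF empty_AR] .
  obtain \<epsilon> R where R: "R \<in> AR" "a \<in> chamber (reorient A R)"
    using open_chamber_perturb[OF empty_AR w] by metis
  obtain z where z: "z \<in> P" "a \<bullet> z = b" using F(2) ab by blast
  have "a \<bullet> z \<le> a \<bullet> p R" by (rule chamber_max[OF R z(1)])
  then have "p R \<in> F" using ab pP[OF R(1)] z by force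
  then have "G face_of vertex_cone R" using normal_cone_face[OF R(1) F(1)] F by blast
  moreover have "0 \<in> G"
    using F face_of_imp_subset[OF F(1)] by (auto simp: normal_cone_eq[OF polytope_P] max_face_def)
  ultimately show "G \<in> fan_of_chambers (vertex_cone ` AR)"
    using R by (auto simp: fan_of_chambers_def)
next
  fix G assume "G \<in> fan_of_chambers (vertex_cone ` AR)"
  then show "G \<in> normal_fan P" using face_is_normal_cone by (auto simp: fan_of_chambers_def)
qed

text \<open>It remains to see that the fibres of \<open>p\<close> are the classes. If
  \<open>p R = p R'\<close>, the first flip from \<open>R\<close> towards \<open>R'\<close> cannot
  move the vertex: a displacement along e_x - e_y would have to be negative in a direction of each
  of the two open chambers, but these order \<open>x\<close> and \<open>y\<close> oppositely. That
  flip is thus contracted, and induction on the symmetric difference finishes.\<close>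

lemma quotient_fan_eq:
  assumes cong: "lattice_congruence (acyclic_reorientations A) r"
    and flip: "\<And>R x y. flip R x y \<Longrightarrow> (R, insert (x, y) R) \<in> r \<longleftrightarrow> p R = p (insert (x, y) R)"
    and dir: "\<And>R x y. flip R x y \<Longrightarrow> \<exists>k. p (insert (x, y) R) - p R = k *\<^sub>R (axis x 1 - axis y 1)"
  shows "quotient_fan A r = normal_fan P"
proof -
  have eq: "(R, R') \<in> r" if "R \<in> AR" "R' \<in> AR" "p R = p R'" for R R'
    using that
  proof (induction "card ((R - R') \<union> (R' - R))" arbitrary: R rule: less_induct)
    case less
    note R = less.prems(1) and R' = less.prems(2) and pp = less.prems(3)
    obtain w where w: "w \<in> open_chamber R" using open_chamber_nonempty[OF R] .
    obtain w' where w': "w' \<in> open_chamber R'" using open_chamber_nonempty[OF R'] .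
    show ?case
    proof (cases "R = R'")
      case True
      then show ?thesis using cong_refl[OF cong R] by simp
    next
      case False
      have "\<exists>T x y. T \<in> AR \<and> (flip R x y \<and> T = insert (x, y) R \<and> (x, y) \<in> R' - R \<or>
          flip T x y \<and> R = insert (x, y) T \<and> (x, y) \<in> R - R' \<and> (x, y) \<notin> T)"
        using exists_flip[OF R R' False]
      proof cases
        case (1 a)
        then show ?thesis using R by (cases a) (auto simp: flip_def)
      next
        case (2 a)
        obtain x y where a: "a = (x, y)" by force
        have ins: "R = insert (x, y) (R - {a})" using 2 a by blast
        then have "flip (R - {a}) x y" unfolding flip_def using 2 a R by simp
        then show ?thesis using 2 a ins by blast
      qed
      then obtain T x y where T: "T \<in> AR" "flip R x y \<and> T = insert (x, y) R \<and> (x, y) \<in> R' - R \<or>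
          flip T x y \<and> R = insert (x, y) T \<and> (x, y) \<in> R - R' \<and> (x, y) \<notin> T" by blast
      have xy: "(x, y) \<in> A" using T(2) flip_arc by blast
      have "\<exists>k. p T - p R = k *\<^sub>R (axis x 1 - axis y 1)"
        using T(2)
      proof
        assume "flip T x y \<and> R = insert (x, y) T \<and> (x, y) \<in> R - R' \<and> (x, y) \<notin> T"
        then obtain k where "p R - p T = k *\<^sub>R (axis x 1 - axis y 1)" using dir by blast
        then have "p T - p R = (- k) *\<^sub>R (axis x 1 - axis y 1)" by (metis minus_diff_eq scaleR_minus_left)
        then show ?thesis by blast
      qed (use dir in blast)
      then obtain k where k: "p T - p R = k *\<^sub>R (axis x 1 - axis y 1)" by blast
      have opp: "w $ x < w $ y \<and> w' $ y < w' $ x \<or> w $ y < w $ x \<and> w' $ x < w' $ y"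
        using T(2) xy open_chamberD[OF w, of x y] open_chamberD[OF w, of y x]
          open_chamberD[OF w', of x y] open_chamberD[OF w', of y x] by (auto simp: reorient_iff)
      have pe: "p T = p R"
      proof (rule ccontr)
        assume ne: "p T \<noteq> p R"
        have "w \<bullet> (p T - p R) < 0" "w' \<bullet> (p T - p R) < 0"
          using pmax[OF R w pP[OF T(1)] ne] pmax[OF R' w' pP[OF T(1)]] ne pp
          by (auto simp: inner_diff_right)
        then have "k * (w $ x - w $ y) < 0" "k * (w' $ x - w' $ y) < 0"
          unfolding k by (simp_all add: inner_diff_right inner_axis)
        then show False using opp by (auto simp: mult_less_0_iff)
      qed
      have "(R, T) \<in> r" using T(2) flip pe cong_sym[OF cong] by metis
      moreover have "(T, R') \<in> r"
      proof (rule less.hyps)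
        show "card ((T - R') \<union> (R' - T)) < card ((R - R') \<union> (R' - R))"
          by (rule psubset_card_mono) (use T(2) in auto)
      qed (use T(1) R' pp pe in auto)
      ultimately show ?thesis by (rule cong_trans[OF cong])
    qed
  qed
  have "p R = p R'" if "(R, R') \<in> r" for R R'
    using cong_invariant[OF cong, of p] flip that by blast
  then have "r `` {R} = {R' \<in> AR. p R' = p R}" if R: "R \<in> AR" for R
  proof (intro equalityI subsetI)
    fix R' assume "R' \<in> r `` {R}"
    then have "(R, R') \<in> r" by simp
    then show "R' \<in> {R' \<in> AR. p R' = p R}"
      using \<open>\<And>R R'. (R, R') \<in> r \<Longrightarrow> p R = p R'\<close>[of R R'] cong_AR[OF cong] by simp
  next
    fix R' assume "R' \<in> {R' \<in> AR. p R' = p R}"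
    then show "R' \<in> r `` {R}" using eq[OF R] by simp
  qed
  then have q: "AR // r = (\<lambda>R. {R' \<in> AR. p R' = p R}) ` AR"
    unfolding quotient_def by auto
  have "{\<Union>R \<in> X. chamber (reorient A R) | X. X \<in> AR // r}
      = (\<lambda>X. \<Union>R \<in> X. chamber (reorient A R)) ` (AR // r)" by blast
  also have "\<dots> = vertex_cone ` AR"
    unfolding q image_image by (rule image_cong[OF refl]) (simp add: vertex_cone_eq)
  finally have "{\<Union>R \<in> X. chamber (reorient A R) | X. X \<in> AR // r} = vertex_cone ` AR" .
  then show ?thesis unfolding quotient_fan_def normal_fan_eq carrier_AR by simp
qed

end

end

section \<open>Alternating vectors\<close>

text \<open>An automaton reading the path: in state \<open>True\<close> an entry +1 still waits for
  its -1. \<open>s\<close> and \<open>t\<close> are the initial and the final state. With both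
  \<open>False\<close> these are the vectors of the alternating matchings; the other states let
  inductions stop and resume inside a pair.\<close>

fun alt_vecs :: "'v::finite set \<Rightarrow> 'v set \<Rightarrow> bool \<Rightarrow> bool \<Rightarrow> 'v list \<Rightarrow> (real ^ 'v) set" where
  "alt_vecs U D s t [] = (if s = t then {0} else {})"
| "alt_vecs U D s t (x # xs) = alt_vecs U D s t xs
     \<union> (if \<not> s \<and> x \<in> U then (\<lambda>z. z + axis x 1) ` alt_vecs U D True t xs else {})
     \<union> (if s \<and> x \<in> D then (\<lambda>z. z - axis x 1) ` alt_vecs U D False t xs else {})"

lemma alt_vecs_skip: "z \<in> alt_vecs U D s t xs \<Longrightarrow> z \<in> alt_vecs U D s t (x # xs)"
  by simp

lemma alt_vecs_up: "z \<in> alt_vecs U D True t xs \<Longrightarrow> x \<in> U \<Longrightarrow> z + axis x 1 \<in> alt_vecs U D False t (x # xs)"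
  by simp

lemma alt_vecs_down: "z \<in> alt_vecs U D False t xs \<Longrightarrow> x \<in> D \<Longrightarrow> z - axis x 1 \<in> alt_vecs U D True t (x # xs)"
  by simp

lemma alt_vecs_zero: "0 \<in> alt_vecs U D s s xs"
  by (induction xs) auto

lemma finite_alt_vecs: "finite (alt_vecs U D s t xs)"
  by (induction xs arbitrary: s) auto

lemma alt_vecs_support: "z \<in> alt_vecs U D s t xs \<Longrightarrow> a \<notin> set xs \<Longrightarrow> z $ a = 0"
  by (induction xs arbitrary: s z) (auto simp: axis_def split: if_splits)

text \<open>As \<open>x\<close> does not recur, the coordinate at \<open>x\<close> reveals the
  transition taken there, so two vectors can be compared step by step.\<close>

lemma alt_vecs_Cons_cases [consumes 2, case_names skip up down]:
  assumes "z \<in> alt_vecs U D s t (x # xs)" "x \<notin> set xs"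
  obtains (skip) "z $ x = 0" "z \<in> alt_vecs U D s t xs"
  | (up) y where "\<not> s" "x \<in> U" "z $ x = 1" "z = y + axis x 1" "y \<in> alt_vecs U D True t xs"
  | (down) y where "s" "x \<in> D" "z $ x = - 1" "z = y - axis x 1" "y \<in> alt_vecs U D False t xs"
  using assms alt_vecs_support[of _ U D _ t xs x] by (fastforce split: if_splits)

lemma alt_vecs_append:
  "z \<in> alt_vecs U D s t (xs @ ys) \<longleftrightarrow>
     (\<exists>m. \<exists>x \<in> alt_vecs U D s m xs. \<exists>y \<in> alt_vecs U D m t ys. z = x + y)"
proof (induction xs arbitrary: s z)
  case Nil
  then show ?case by auto
next
  case (Cons a xs)
  show ?case (is "?L \<longleftrightarrow> ?R")
  proof
    assume ?L
    then consider "z \<in> alt_vecs U D s t (xs @ ys)"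
      | w where "\<not> s" "a \<in> U" "w \<in> alt_vecs U D True t (xs @ ys)" "z = w + axis a 1"
      | w where "s" "a \<in> D" "w \<in> alt_vecs U D False t (xs @ ys)" "z = w - axis a 1"
      by (auto split: if_splits)
    then show ?R
    proof cases
      case 1
      then show ?thesis using Cons.IH alt_vecs_skip by blast
    next
      case 2
      then obtain m x y where "x \<in> alt_vecs U D True m xs" "y \<in> alt_vecs U D m t ys" "w = x + y"
        using Cons.IH by blast
      then show ?thesis using 2 alt_vecs_up[of x U D m xs a]
        by (intro exI[of _ m] bexI[of _ "x + axis a 1"] bexI[of _ y]) auto
    next
      case 3
      then obtain m x y where "x \<in> alt_vecs U D False m xs" "y \<in> alt_vecs U D m t ys" "w = x + y"
        using Cons.IH by blast
      then show ?thesis using 3 alt_vecs_down[of x U D m xs a]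
        by (intro exI[of _ m] bexI[of _ "x - axis a 1"] bexI[of _ y]) auto
    qed
  next
    assume ?R
    then obtain m x y where m: "x \<in> alt_vecs U D s m (a # xs)" "y \<in> alt_vecs U D m t ys" "z = x + y"
      by blast
    then consider "x \<in> alt_vecs U D s m xs"
      | w where "\<not> s" "a \<in> U" "w \<in> alt_vecs U D True m xs" "x = w + axis a 1"
      | w where "s" "a \<in> D" "w \<in> alt_vecs U D False m xs" "x = w - axis a 1"
      by (auto split: if_splits)
    then show ?L
    proof cases
      case 1
      then have "z \<in> alt_vecs U D s t (xs @ ys)" using Cons.IH m by blast
      then show ?thesis by simp
    next
      case 2
      then have "w + y \<in> alt_vecs U D True t (xs @ ys)" using Cons.IH m by blast
      then have "w + y + axis a 1 \<in> alt_vecs U D False t (a # xs @ ys)" using 2 by (intro alt_vecs_up)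
      moreover have "w + y + axis a 1 = z" using 2 m by simp
      ultimately show ?thesis using 2 by simp
    next
      case 3
      then have "w + y \<in> alt_vecs U D False t (xs @ ys)" using Cons.IH m by blast
      then have "w + y - axis a 1 \<in> alt_vecs U D True t (a # xs @ ys)" using 3 by (intro alt_vecs_down)
      moreover have "w + y - axis a 1 = z" using 3 m by simp
      ultimately show ?thesis using 3 by simp
    qed
  qed
qed

lemma inner_ones: "ones U \<bullet> x = (\<Sum>w\<in>U. x $ w)"
  by (simp add: ones_def inner_sum_left inner_axis')

lemma inner_ones_axis: "ones U \<bullet> axis a 1 = of_bool (a \<in> U)"
  by (auto simp: inner_ones axis_def sum.delta)

text \<open>The entries are the changes of state, so their sum telescopes.\<close>

lemma alt_vecs_total:
  "z \<in> alt_vecs U D s t xs \<Longrightarrow> set xs \<subseteq> X \<Longrightarrow> ones X \<bullet> z = of_bool t - of_bool s"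
  by (induction xs arbitrary: s z)
    (auto simp: inner_add_right inner_diff_right inner_ones_axis split: if_splits)

definition is_root :: "'v::finite set \<Rightarrow> real ^ 'v \<Rightarrow> bool" where
  "is_root S c \<longleftrightarrow> (\<exists>a\<in>S. \<exists>b\<in>S. a \<noteq> b \<and> c = axis a 1 - axis b 1)"

lemma is_rootI: "a \<in> S \<Longrightarrow> b \<in> S \<Longrightarrow> a \<noteq> b \<Longrightarrow> is_root S (axis a 1 - axis b 1)"
  by (auto simp: is_root_def)

lemma is_root_uminus: "is_root S c \<Longrightarrow> is_root S (- c)"
  unfolding is_root_def by (metis minus_diff_eq)

lemma is_root_mono: "is_root S c \<Longrightarrow> S \<subseteq> T \<Longrightarrow> is_root T c"
  unfolding is_root_def by blast

lemma sum_list_uminus: "sum_list (map uminus cs) = - sum_list (cs :: 'a::ab_group_add list)"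
  by (induction cs) auto

context
  notes alt_vecs.simps(2) [simp del]
begin

text \<open>Running along the list, two alternating vectors disagree on segments of prefix sums, and on
  each such segment either of them can be changed into the other one independently.\<close>

lemma alt_vecs_exchange:
  assumes "U \<inter> D = {}" "distinct xs"
  shows "z \<in> alt_vecs U D s t xs \<Longrightarrow> z' \<in> alt_vecs U D s t xs \<Longrightarrow>
      \<exists>cs. z' = z + sum_list cs \<and> (\<forall>c\<in>set cs. is_root (set xs) c \<and>
        z + c \<in> alt_vecs U D s t xs \<and> z' - c \<in> alt_vecs U D s t xs)"
    and "z \<in> alt_vecs U D False t xs \<Longrightarrow> z' \<in> alt_vecs U D True t xs \<Longrightarrow>
      \<exists>b\<in>set xs. \<exists>cs. z' = z - axis b 1 + sum_list cs \<and>
        z - axis b 1 \<in> alt_vecs U D True t xs \<and> z' + axis b 1 \<in> alt_vecs U D False t xs \<and>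
        (\<forall>c\<in>set cs. is_root (set xs) c \<and>
          z + c \<in> alt_vecs U D False t xs \<and> z' - c \<in> alt_vecs U D True t xs)"
  using assms(2)
proof (induction xs arbitrary: s z z')
  case Nil
  {
    case 1
    then show ?case by (intro exI[of _ "[]"]) (auto split: if_splits)
  next
    case 2
    then show ?case by (auto split: if_splits)
  }
next
  case (Cons x xs)
  let ?V = "\<lambda>s. alt_vecs U D s t xs" and ?W = "\<lambda>s. alt_vecs U D s t (x # xs)"
  have up: "y + axis x 1 \<in> ?W False" if "y \<in> ?V True" "x \<in> U" for y using that by (rule alt_vecs_up)
  have dn: "y - axis x 1 \<in> ?W True" if "y \<in> ?V False" "x \<in> D" for y using that by (rule alt_vecs_down)
  have sk: "y \<in> ?W s" if "y \<in> ?V s" for y s using that by (rule alt_vecs_skip)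
  have rt: "is_root (set (x # xs)) c" if "is_root (set xs) c" for c using that by (rule is_root_mono) auto
  {
    case 1
    have x: "x \<notin> set xs" and d: "distinct xs" using 1(3) by auto
    note IH1 = Cons.IH(1)[OF _ _ d] and IH2 = Cons.IH(2)[OF _ _ d]
    let ?ex = "\<lambda>s z z'. \<exists>cs. z' = z + sum_list cs \<and> (\<forall>c\<in>set cs. is_root (set (x # xs)) c \<and>
        z + c \<in> ?W s \<and> z' - c \<in> ?W s)"
    \<comment> \<open>The two runs enter different states at \<open>x\<close>. The second claim
      supplies the position \<open>b\<close> where they meet again, and e_x - e_b exchanges exactly
      this stretch. The offset \<open>e\<close> covers both ways to part: one run goes up and the
      other skips, or one skips and the other goes down.\<close>
    have cross: "?ex s z z'"
      if f: "f \<in> ?V False" and g: "g \<in> ?V True" and z: "z = f + e" "z' = g + e + axis x 1"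
        and lift: "\<And>y. y \<in> ?V False \<Longrightarrow> y + e \<in> ?W s" "\<And>y. y \<in> ?V True \<Longrightarrow> y + e + axis x 1 \<in> ?W s"
      for z z' f g e s
    proof -
      obtain b cs where b: "b \<in> set xs" "g = f - axis b 1 + sum_list cs" "f - axis b 1 \<in> ?V True"
        "g + axis b 1 \<in> ?V False" "\<forall>c\<in>set cs. is_root (set xs) c \<and> f + c \<in> ?V False \<and> g - c \<in> ?V True"
        using IH2[OF f g] by blast
      let ?c = "axis x 1 - axis b 1"
      have "is_root (set (x # xs)) ?c" using b x by (intro is_rootI) auto
      moreover have "z + ?c = f - axis b 1 + e + axis x 1" "z' - ?c = g + axis b 1 + e" using z by simp_all
      then have "z + ?c \<in> ?W s \<and> z' - ?c \<in> ?W s" using lift b(3,4) by metis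
      moreover have "z + c \<in> ?W s \<and> z' - c \<in> ?W s" if "c \<in> set cs" for c
      proof -
        have "z + c = f + c + e" "z' - c = g - c + e + axis x 1" using z by simp_all
        then show ?thesis using lift b(5) that by metis
      qed
      moreover have "z' = z + sum_list (?c # cs)" using b(2) z by (simp add: algebra_simps)
      ultimately show ?thesis using b(5) rt by (intro exI[of _ "?c # cs"]) auto
    qed
    have crossF: "?ex False z z'"
      if "z \<in> ?V False" "z' = y + axis x 1" "y \<in> ?V True" "x \<in> U" for z z' y
      by (rule cross[OF that(1,3), of z 0]) (use that(2,4) up sk in auto)
    have crossT: "?ex True z z'"
      if "z = y - axis x 1" "y \<in> ?V False" "x \<in> D" "z' \<in> ?V True" for z z' y
      by (rule cross[OF that(2,4), of z "- axis x 1"]) (use that(1,3) dn sk in auto)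
    \<comment> \<open>The statement is symmetric in the two vectors, with all roots negated.\<close>
    have swap: "?ex s z z'"
      if ex: "?ex s z' z" for z z' s
    proof -
      obtain cs where "z = z' + sum_list cs" "\<forall>c\<in>set cs. is_root (set (x # xs)) c \<and>
        z' + c \<in> ?W s \<and> z - c \<in> ?W s" using ex by blast
      then show ?thesis
        by (intro exI[of _ "map uminus cs"]) (auto simp: sum_list_uminus intro: is_root_uminus)
    qed
    have shift: "?ex s z z'"
      if yy: "y \<in> ?V s'" "y' \<in> ?V s'" and e: "z = y + e" "z' = y' + e"
        and lift: "\<And>y. y \<in> ?V s' \<Longrightarrow> y + e \<in> ?W s"
      for z z' y y' e s s'
    proof -
      obtain cs where cs: "y' = y + sum_list cs" "\<forall>c\<in>set cs. is_root (set xs) c \<and>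
        y + c \<in> ?V s' \<and> y' - c \<in> ?V s'" using IH1[OF yy] by blast
      have "z + c \<in> ?W s \<and> z' - c \<in> ?W s" if c: "c \<in> set cs" for c
      proof -
        have "(y + c) + e \<in> ?W s" "(y' - c) + e \<in> ?W s" using cs(2) c lift by blast+
        then show ?thesis using e by (simp add: algebra_simps)
      qed
      then show ?thesis using cs e rt
        by (intro exI[of _ cs]) (auto simp: algebra_simps)
    qed
    from 1(1) show ?case
    using x proof (cases rule: alt_vecs_Cons_cases)
      case skip
      note z = this
      from 1(2) show ?thesis
      using x proof (cases rule: alt_vecs_Cons_cases)
        case skip
        show ?thesis by (rule shift[OF z(2) skip(2), of z 0 z' s]) (use sk in simp_all)
      next
        case (up y)
        have s: "s = False" using up(1) by simp
        show ?thesis unfolding s by (rule crossF[OF z(2)[unfolded s] up(4,5,2)])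
      next
        case (down y)
        have s: "s = True" using down(1) by simp
        show ?thesis unfolding s by (rule swap, rule crossT[OF down(4,5,2) z(2)[unfolded s]])
      qed
    next
      case (up y)
      note z = this
      from 1(2) show ?thesis
      using x proof (cases rule: alt_vecs_Cons_cases)
        case skip
        have s: "s = False" using z(1) by simp
        show ?thesis unfolding s by (rule swap, rule crossF[OF skip(2)[unfolded s] z(4,5,2)])
      next
        case (up y')
        have s: "s = False" using z(1) by simp
        show ?thesis unfolding s
          by (rule shift[OF z(5) up(5) z(4) up(4)]) (rule alt_vecs_up[OF _ z(2)])
      qed (use z in simp)
    next
      case (down y)
      note z = this
      from 1(2) show ?thesis
      using x proof (cases rule: alt_vecs_Cons_cases)
        case skip
        have s: "s = True" using z(1) by simp
        show ?thesis unfolding s by (rule crossT[OF z(4,5,2) skip(2)[unfolded s]])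
      next
        case (down y')
        have s: "s = True" using z(1) by simp
        show ?thesis unfolding s
          by (rule shift[OF z(5) down(5), of z "- axis x 1"]) (use z(4,2) down(4) dn in simp_all)
      qed (use z in simp)
    qed
  next
    case 2
    have x: "x \<notin> set xs" and d: "distinct xs" using 2(3) by auto
    note IH1 = Cons.IH(1)[OF _ _ d] and IH2 = Cons.IH(2)[OF _ _ d]
    from 2(1) show ?case
    using x proof (cases rule: alt_vecs_Cons_cases)
      case skip
      note z = this
      from 2(2) show ?thesis
      using x proof (cases rule: alt_vecs_Cons_cases)
        case skip
        then obtain b cs where "b \<in> set xs" "z' = z - axis b 1 + sum_list cs" "z - axis b 1 \<in> ?V True"
          "z' + axis b 1 \<in> ?V False" "\<forall>c\<in>set cs. is_root (set xs) c \<and> z + c \<in> ?V False \<and> z' - c \<in> ?V True"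
          using IH2[OF z(2)] by blast
        then show ?thesis using sk rt
          by (intro bexI[of _ b] exI[of _ cs]) auto
      next
        case (down y')
        obtain cs where cs: "y' = z + sum_list cs" "\<forall>c\<in>set cs. is_root (set xs) c \<and>
          z + c \<in> ?V False \<and> y' - c \<in> ?V False" using IH1[OF z(2) down(5)] by blast
        have "z' - c \<in> ?W True" if "c \<in> set cs" for c
        proof -
          have "z' - c = (y' - c) - axis x 1" using down(4) by simp
          moreover have "(y' - c) - axis x 1 \<in> ?W True" using dn that cs(2) down(2) by blast
          ultimately show ?thesis by (rule ssubst)
        qed
        moreover have "z' + axis x 1 \<in> ?W False" using down sk by simp
        moreover have "z' = z - axis x 1 + sum_list cs" using cs(1) down(4) by simp
        ultimately show ?thesis using cs(2) dn[OF z(2) down(2)] sk rt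
          by (intro bexI[of _ x] exI[of _ cs]) auto
      qed (use z in simp)
    next
      case (up y)
      note z = this
      from 2(2) show ?thesis
      using x proof (cases rule: alt_vecs_Cons_cases)
        case skip
        obtain cs where cs: "z' = y + sum_list cs" "\<forall>c\<in>set cs. is_root (set xs) c \<and>
          y + c \<in> ?V True \<and> z' - c \<in> ?V True" using IH1[OF z(5) skip(2)] by blast
        have upx: "y + axis x 1 \<in> ?W False" if "y \<in> ?V True" for y using that z(2) by (rule alt_vecs_up)
        have "z + c \<in> ?W False" if "c \<in> set cs" for c
        proof -
          have "z + c = (y + c) + axis x 1" using z(4) by simp
          moreover have "(y + c) + axis x 1 \<in> ?W False" using upx that cs(2) by blast
          ultimately show ?thesis by (rule ssubst)
        qed
        moreover have "z - axis x 1 \<in> ?W True" using z sk by simp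
        moreover have "z' = z - axis x 1 + sum_list cs" using cs(1) z(4) by simp
        ultimately show ?thesis using cs(2) upx[OF skip(2)] sk rt
          by (intro bexI[of _ x] exI[of _ cs]) auto
      qed (use z assms(1) in auto)
    qed simp
  }
qed

text \<open>Up to \<open>b\<close> the two vectors agree while their runs are in opposite states, so
  neither can make a transition before \<open>b\<close>. At \<open>l\<close> a run can therefore
  change over from one to the other, upwards for \<open>l \<in> U\<close> and downwards for
  \<open>l \<in> D\<close>.\<close>

lemma alt_vecs_between1:
  assumes "z \<in> alt_vecs U D False t (as @ l # bs)" "z - axis b 1 \<in> alt_vecs U D True t (as @ l # bs)"
    and "distinct (as @ l # bs)" "b \<in> set bs"
  shows "l \<in> U \<Longrightarrow> z + axis l 1 - axis b 1 \<in> alt_vecs U D False t (as @ l # bs)"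
    and "l \<in> D \<Longrightarrow> z - axis l 1 \<in> alt_vecs U D True t (as @ l # bs)"
proof -
  have *: "z \<in> alt_vecs U D False t xs \<and> z - axis b 1 \<in> alt_vecs U D True t xs"
    if h: "z \<in> alt_vecs U D False t (x # xs)" "z - axis b 1 \<in> alt_vecs U D True t (x # xs)"
      "x \<notin> set xs" "x \<noteq> b" for x xs
  proof -
    have eq: "(z - axis b 1) $ x = z $ x" using h(4) by (simp add: axis_def)
    show ?thesis
      using h(1)
    using h(3) proof (cases rule: alt_vecs_Cons_cases)
      case skip
      show ?thesis using h(2) using h(3) by (cases rule: alt_vecs_Cons_cases) (use skip eq in auto)
    next
      case (up y)
      show ?thesis using h(2) using h(3) by (cases rule: alt_vecs_Cons_cases) (use up eq in auto)
    qed simp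
  qed
  have "(l \<in> U \<longrightarrow> z + axis l 1 - axis b 1 \<in> alt_vecs U D False t (as @ l # bs)) \<and>
      (l \<in> D \<longrightarrow> z - axis l 1 \<in> alt_vecs U D True t (as @ l # bs))"
    using assms
  proof (induction as)
    case Nil
    then have "l \<notin> set bs" "l \<noteq> b" by auto
    then have "z \<in> alt_vecs U D False t bs" "z - axis b 1 \<in> alt_vecs U D True t bs"
      using *[of l bs] Nil by (simp_all)
    then show ?case
      using alt_vecs_up[of "z - axis b 1" U D t bs l] alt_vecs_down[of z U D t bs l]
      by (simp add: algebra_simps)
  next
    case (Cons a as)
    then have d: "a \<notin> set (as @ l # bs)" "a \<noteq> b" "distinct (as @ l # bs)" by auto
    then have "z \<in> alt_vecs U D False t (as @ l # bs)" "z - axis b 1 \<in> alt_vecs U D True t (as @ l # bs)"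
      using *[of a "as @ l # bs"] Cons.prems(1,2) by (simp_all)
    then show ?case
      using Cons.IH[OF _ _ d(3) Cons.prems(4)] by (auto intro: alt_vecs_skip)
  qed
  then show "l \<in> U \<Longrightarrow> z + axis l 1 - axis b 1 \<in> alt_vecs U D False t (as @ l # bs)"
    and "l \<in> D \<Longrightarrow> z - axis l 1 \<in> alt_vecs U D True t (as @ l # bs)" by blast+
qed

text \<open>An admissible move e_a - e_b can be shortened to start or to end at any \<open>l\<close>
  between: the runs coincide before \<open>a\<close>, part at \<open>a\<close> and stay in opposite
  states until \<open>b\<close>. This is what relates the sides of the intermediate vertices to
  those of the rope.\<close>

lemma alt_vecs_between:
  assumes "z \<in> alt_vecs U D s t (cs @ a # as @ l # bs)"
    "z + axis a 1 - axis b 1 \<in> alt_vecs U D s t (cs @ a # as @ l # bs)"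
    and "distinct (cs @ a # as @ l # bs)" "b \<in> set bs"
  shows "(l \<in> U \<longrightarrow> z + axis l 1 - axis b 1 \<in> alt_vecs U D s t (cs @ a # as @ l # bs)) \<and>
    (l \<in> D \<longrightarrow> z + axis a 1 - axis l 1 \<in> alt_vecs U D s t (cs @ a # as @ l # bs))"
  using assms
proof (induction cs arbitrary: s z)
  case Nil
  let ?xs = "as @ l # bs"
  have a: "a \<notin> set ?xs" and d: "distinct ?xs" and ab: "a \<noteq> b" and b: "b \<in> set bs" using Nil by auto
  have z2: "(z + axis a 1 - axis b 1) $ a = z $ a + 1" using ab by (simp add: axis_def)
  have m2: "z + axis a 1 - axis b 1 \<in> alt_vecs U D s t (a # ?xs)" using Nil(2) by simp
  from Nil(1) have "z \<in> alt_vecs U D s t (a # ?xs)" by simp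
  then show ?case
  using a proof (cases rule: alt_vecs_Cons_cases)
    case skip
    from m2 show ?thesis
    using a proof (cases rule: alt_vecs_Cons_cases)
      case (up y)
      have y: "y = z - axis b 1" using up(4) by (simp add: algebra_simps)
      have z: "z \<in> alt_vecs U D False t ?xs" using skip up by simp
      show ?thesis
        using alt_vecs_between1[OF z up(5)[unfolded y] d b] up
          alt_vecs_up[of "z - axis l 1" U D t ?xs a] alt_vecs_skip[of _ U D False t ?xs a]
        by (auto simp: algebra_simps)
    qed (use skip z2 in auto)
  next
    case (up y)
    from m2 show ?thesis using a by (cases rule: alt_vecs_Cons_cases) (use up z2 in auto)
  next
    case (down y)
    from m2 show ?thesis
    using a proof (cases rule: alt_vecs_Cons_cases)
      case skip
      have y': "y - axis b 1 \<in> alt_vecs U D True t ?xs" using skip down by (simp add: algebra_simps)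
      show ?thesis
        using alt_vecs_between1[OF down(5) y' d b] down
          alt_vecs_down[of "y + axis l 1 - axis b 1" U D t ?xs a] alt_vecs_skip[of _ U D True t ?xs a]
        by (auto simp: algebra_simps)
    qed (use down z2 ab in \<open>auto simp: axis_def\<close>)
  qed
next
  case (Cons c cs)
  let ?xs = "cs @ a # as @ l # bs"
  have c: "c \<notin> set ?xs" and d: "distinct ?xs" and ne: "c \<noteq> a" "c \<noteq> b" and b: "b \<in> set bs"
    using Cons.prems by auto
  have z2: "(z + axis a 1 - axis b 1) $ c = z $ c" using ne by (simp add: axis_def)
  note IH = Cons.IH[OF _ _ d b]
  have m2: "z + axis a 1 - axis b 1 \<in> alt_vecs U D s t (c # ?xs)" using Cons.prems(2) by simp
  from Cons.prems(1) have "z \<in> alt_vecs U D s t (c # ?xs)" by simp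
  then show ?case
  using c proof (cases rule: alt_vecs_Cons_cases)
    case skip
    from m2 have "z + axis a 1 - axis b 1 \<in> alt_vecs U D s t ?xs"
      using c by (cases rule: alt_vecs_Cons_cases) (use skip z2 in auto)
    then show ?thesis using IH[OF skip(2)] by (auto intro: alt_vecs_skip)
  next
    case (up y)
    from m2 have "y + axis a 1 - axis b 1 \<in> alt_vecs U D True t ?xs"
      using c by (cases rule: alt_vecs_Cons_cases) (use up z2 in \<open>auto simp: algebra_simps\<close>)
    then show ?thesis using IH[OF up(5)] up
        alt_vecs_up[of "y + axis l 1 - axis b 1" U D t ?xs c] alt_vecs_up[of "y + axis a 1 - axis l 1" U D t ?xs c]
      by (auto simp: algebra_simps)
  next
    case (down y)
    from m2 have "y + axis a 1 - axis b 1 \<in> alt_vecs U D False t ?xs"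
      using c by (cases rule: alt_vecs_Cons_cases) (use down z2 in \<open>auto simp: algebra_simps\<close>)
    then show ?thesis using IH[OF down(5)] down
        alt_vecs_down[of "y + axis l 1 - axis b 1" U D t ?xs c] alt_vecs_down[of "y + axis a 1 - axis l 1" U D t ?xs c]
      by (auto simp: algebra_simps)
  qed
qed

end

text \<open>The first up entry is deleted; if there is none, the vector is 0 and a down entry is
  placed at the last position. Neither raises a sum over a vertex set.\<close>

lemma alt_vecs_start_True:
  assumes "z \<in> alt_vecs U D False False ys" "ys \<noteq> []" "last ys \<in> D"
  obtains z' where "z' \<in> alt_vecs U D True False ys" "ones X \<bullet> z' \<le> ones X \<bullet> z"
proof -
  have "\<exists>z'\<in>alt_vecs U D True False ys. ones X \<bullet> z' \<le> ones X \<bullet> z"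
    using assms
  proof (induction ys arbitrary: z)
    case (Cons y ys)
    show ?case
    proof (cases "ys = []")
      case True
      then have "z = 0" using Cons.prems by (auto split: if_splits)
      moreover have "- axis y 1 \<in> alt_vecs U D True False (y # ys)" using True Cons.prems by simp
      ultimately show ?thesis
        by (intro bexI[of _ "- axis y 1"]) (auto simp: inner_ones_axis simp del: alt_vecs.simps)
    next
      case False
      consider "z \<in> alt_vecs U D False False ys"
        | w where "y \<in> U" "z = w + axis y 1" "w \<in> alt_vecs U D True False ys"
        using Cons.prems(1) by (auto split: if_splits)
      then show ?thesis
      proof cases
        case 1
        then show ?thesis using Cons.IH[OF 1] Cons.prems False alt_vecs_skip by auto
      next
        case 2
        then show ?thesis
          by (intro bexI[of _ w]) (auto simp: inner_add_right inner_ones_axis)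
      qed
    qed
  qed simp
  then show ?thesis using that by blast
qed

text \<open>The first down entry is deleted, at a cost of at most 1.\<close>

lemma alt_vecs_start_False:
  assumes "z \<in> alt_vecs U D True False ys"
  obtains z' where "z' \<in> alt_vecs U D False False ys" "ones X \<bullet> z' \<le> ones X \<bullet> z + 1"
proof -
  have "\<exists>z'\<in>alt_vecs U D False False ys. ones X \<bullet> z' \<le> ones X \<bullet> z + 1"
    using assms
  proof (induction ys arbitrary: z)
    case (Cons y ys)
    consider "z \<in> alt_vecs U D True False ys"
      | w where "y \<in> D" "z = w - axis y 1" "w \<in> alt_vecs U D False False ys"
      using Cons.prems(1) by (auto split: if_splits)
    then show ?case
    proof cases
      case 1
      then show ?thesis using Cons.IH[OF 1] alt_vecs_skip by auto
    next
      case 2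
      then show ?thesis
        by (intro bexI[of _ w]) (auto simp: inner_diff_right inner_ones_axis)
    qed
  qed simp
  then show ?thesis using that by blast
qed

section \<open>Alternating matchings as lists of pairs\<close>

abbreviation pairs_concat :: "('v \<times> 'v) list \<Rightarrow> 'v list" where
  "pairs_concat ab \<equiv> concat (map (\<lambda>(a, b). [a, b]) ab)"

definition pairs_vec :: "('v::finite \<times> 'v) list \<Rightarrow> real ^ 'v" where
  "pairs_vec ab = (\<Sum>(a, b)\<leftarrow>ab. axis a 1 - axis b 1)"

lemma pairs_vec_simps [simp]:
  "pairs_vec [] = 0" "pairs_vec ((a, b) # ab) = axis a 1 - axis b 1 + pairs_vec ab"
  by (simp_all add: pairs_vec_def)

text \<open>Two claims for a mutual induction: in the second one, reading starts inside a pair whose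
  lower entry \<open>b\<close> is still to come.\<close>

lemma pairs_vec_in_alt_vecs:
  assumes "fst ` set ab \<subseteq> U" "snd ` set ab \<subseteq> D"
  shows "subseq (pairs_concat ab) xs \<Longrightarrow> pairs_vec ab \<in> alt_vecs U D False False xs"
    and "b \<in> D \<Longrightarrow> subseq (b # pairs_concat ab) xs \<Longrightarrow> pairs_vec ab - axis b 1 \<in> alt_vecs U D True False xs"
  using assms
proof (induction xs arbitrary: ab b)
  case Nil
  {
    case 1
    then show ?case by (cases ab) auto
  next
    case 2
    then show ?case by simp
  }
next
  case (Cons x xs)
  {
    case 1
    show ?case
    proof (cases ab)
      case Nil
      then show ?thesis using alt_vecs_zero[of U D False "x # xs"] by (simp del: alt_vecs.simps)
    next
      case (Cons p ab')
      obtain a b where p: "p = (a, b)" by force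
      show ?thesis
      proof (cases "a = x")
        case True
        then have "pairs_vec ab' - axis b 1 \<in> alt_vecs U D True False xs"
          using 1 Cons p by (intro Cons.IH(2)) auto
        then have "pairs_vec ab' - axis b 1 + axis x 1 \<in> alt_vecs U D False False (x # xs)"
          using 1 Cons p True by (intro alt_vecs_up) auto
        then show ?thesis using Cons p True by (simp add: algebra_simps del: alt_vecs.simps)
      next
        case False
        then show ?thesis using 1 Cons p by (intro alt_vecs_skip Cons.IH(1)) auto
      qed
    qed
  next
    case 2
    show ?case
    proof (cases "b = x")
      case True
      then have "pairs_vec ab \<in> alt_vecs U D False False xs"
        using 2 by (intro Cons.IH(1)) auto
      then show ?thesis using 2 True alt_vecs_down by metis
    next
      case False
      then show ?thesis using 2 by (intro alt_vecs_skip Cons.IH(2)) auto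
    qed
  }
qed

lemma alt_vecs_pairs:
  shows "z \<in> alt_vecs U D False False xs \<Longrightarrow> \<exists>ab. z = pairs_vec ab \<and> fst ` set ab \<subseteq> U \<and>
      snd ` set ab \<subseteq> D \<and> subseq (pairs_concat ab) xs"
    and "z \<in> alt_vecs U D True False xs \<Longrightarrow> \<exists>b ab. z = pairs_vec ab - axis b 1 \<and> b \<in> D \<and>
      fst ` set ab \<subseteq> U \<and> snd ` set ab \<subseteq> D \<and> subseq (b # pairs_concat ab) xs"
proof (induction xs arbitrary: z)
  case Nil
  {
    case 1
    then show ?case by (intro exI[of _ "[]"]) auto
  next
    case 2
    then show ?case by simp
  }
next
  case (Cons x xs)
  {
    case 1
    then consider "z \<in> alt_vecs U D False False xs"
      | w where "x \<in> U" "z = w + axis x 1" "w \<in> alt_vecs U D True False xs"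
      by (auto split: if_splits)
    then show ?case
    proof cases
      case 1
      obtain ab where "z = pairs_vec ab" "fst ` set ab \<subseteq> U" "snd ` set ab \<subseteq> D"
        "subseq (pairs_concat ab) xs" using Cons.IH(1)[OF 1] by blast
      then show ?thesis by (intro exI[of _ ab]) (auto intro: list_emb_Cons)
    next
      case 2
      obtain b ab where "w = pairs_vec ab - axis b 1" "b \<in> D"
        "fst ` set ab \<subseteq> U" "snd ` set ab \<subseteq> D" "subseq (b # pairs_concat ab) xs"
        using Cons.IH(2)[OF 2(3)] by blast
      then show ?thesis using 2 by (intro exI[of _ "(x, b) # ab"]) auto
    qed
  next
    case 2
    then consider "z \<in> alt_vecs U D True False xs"
      | w where "x \<in> D" "z = w - axis x 1" "w \<in> alt_vecs U D False False xs"
      by (auto split: if_splits)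
    then show ?case
    proof cases
      case 1
      obtain b ab where "z = pairs_vec ab - axis b 1" "b \<in> D" "fst ` set ab \<subseteq> U"
        "snd ` set ab \<subseteq> D" "subseq (b # pairs_concat ab) xs" using Cons.IH(2)[OF 1] by blast
      then show ?thesis by (intro exI[of _ b] exI[of _ ab] conjI list_emb_Cons)
    next
      case 2
      obtain ab where "w = pairs_vec ab"
        "fst ` set ab \<subseteq> U" "snd ` set ab \<subseteq> D" "subseq (pairs_concat ab) xs"
        using Cons.IH(1)[OF 2(3)] by blast
      then show ?thesis using 2 by (intro exI[of _ x] exI[of _ ab]) auto
    qed
  }
qed

lemma pairs_concat_set: "set (pairs_concat ab) = fst ` set ab \<union> snd ` set ab"
  by (induction ab) auto

lemma ones_insert: "a \<notin> M \<Longrightarrow> ones (insert a M) = axis a 1 + ones M"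
  by (simp add: ones_def)

lemma pairs_vec_ones:
  "distinct (pairs_concat ab) \<Longrightarrow> ones (fst ` set ab) - ones (snd ` set ab) = pairs_vec ab"
proof (induction ab)
  case Nil
  then show ?case by (simp add: ones_def)
next
  case (Cons p ab)
  obtain a b where p: "p = (a, b)" by force
  have "a \<notin> fst ` set ab" "b \<notin> snd ` set ab" "distinct (pairs_concat ab)"
    using Cons.prems p pairs_concat_set[of ab] by auto
  then show ?case using Cons.IH p by (simp add: ones_insert algebra_simps)
qed

context skeletal_digraph begin

section \<open>The path of an arc in the transitive reduction\<close>

definition support :: "'v \<Rightarrow> 'v \<Rightarrow> 'v set" where
  "support u v = {u, v} \<union> inner u v"

lemma support_total:
  "\<lbrakk>(u, v) \<in> A; x \<in> support u v; y \<in> support u v; x \<noteq> y\<rbrakk> \<Longrightarrow> (x, y) \<in> A \<or> (y, x) \<in> A"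
  using inner_comparable[of u v x y] by (auto simp: support_def inner_def)

lemma support_between:
  "\<lbrakk>(u, v) \<in> A; x \<in> support u v; z \<in> support u v; (x, y) \<in> A; (y, z) \<in> A\<rbrakk>
    \<Longrightarrow> y \<in> inner u v"
  unfolding support_def by (rule inner_trans)

lemma acyc2: "(x, y) \<in> A \<Longrightarrow> (y, z) \<in> A \<Longrightarrow> (z, x) \<notin> A"
  using acyc_trancl by (meson r_into_trancl trancl_trans)

lemma support_trans:
  "\<lbrakk>(u, v) \<in> A; x \<in> support u v; z \<in> support u v; (x, y) \<in> A; (y, z) \<in> A\<rbrakk> \<Longrightarrow> (x, z) \<in> A"
  using support_total[of u v x z] acyc2[of x y z] A_antisym[of x y] by blast

lemma support_mono:
  "\<lbrakk>(u, v) \<in> A; x \<in> support u v; y \<in> support u v; (x, y) \<in> A\<rbrakk> \<Longrightarrow> support x y \<subseteq> support u v"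
  using support_between[of u v x y] by (auto simp: support_def inner_def)

lemma support_first: "(u, v) \<in> A \<Longrightarrow> x \<in> support u v \<Longrightarrow> (x, u) \<notin> A"
  using A_antisym A_irrefl by (auto simp: support_def inner_def)

lemma support_last: "(u, v) \<in> A \<Longrightarrow> x \<in> support u v \<Longrightarrow> (v, x) \<notin> A"
  using A_antisym A_irrefl by (auto simp: support_def inner_def)

abbreviation arc_sorted :: "'v list \<Rightarrow> bool" where
  "arc_sorted \<equiv> sorted_wrt (\<lambda>x y. (x, y) \<in> A)"

lemma arc_sorted_distinct: "arc_sorted p \<Longrightarrow> distinct p"
  by (induction p) (use A_irrefl in auto)

lemma arc_height: "\<exists>w :: real ^ 'v. \<forall>x y. (x, y) \<in> A \<longrightarrow> w $ x < w $ y"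
proof -
  obtain w where "w \<in> open_chamber {}" using open_chamber_nonempty[OF empty_AR] .
  then have "w $ x < w $ y" if "(x, y) \<in> A" for x y using that by (auto simp: open_chamber_def reorient_def)
  then show ?thesis by blast
qed

lemma arc_sorted_unique:
  assumes "arc_sorted p" "arc_sorted q" "set p = set q"
  shows "p = q"
  using assms
proof (induction p arbitrary: q)
  case Nil
  then show ?case by simp
next
  case (Cons x p)
  then obtain y q' where q: "q = y # q'" by (cases q) auto
  have "x = y"
  proof (rule ccontr)
    assume "x \<noteq> y"
    moreover have "x \<in> set q" "y \<in> set (x # p)" using Cons.prems(3) q by auto
    ultimately have "(y, x) \<in> A" "(x, y) \<in> A" using Cons.prems(1,2) q by auto
    then show False using A_antisym by blast
  qed
  then show ?case using Cons.prems q arc_sorted_distinct[of q] arc_sorted_distinct[of "x # p"]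
    by (auto intro!: Cons.IH simp: insert_eq_iff)
qed

lemma exists_arc_sorted:
  assumes uv: "(u, v) \<in> A"
  obtains p where "arc_sorted p" "set p = support u v"
proof -
  obtain w :: "real ^ 'v" where w: "\<And>x y. (x, y) \<in> A \<Longrightarrow> w $ x < w $ y"
    using arc_height by blast
  have "\<exists>p. arc_sorted p \<and> set p = T" if "T \<subseteq> support u v" for T
    using finite[of T] that
  proof (induction rule: finite_ranking_induct[where f = "\<lambda>x. w $ x"])
    case empty
    then show ?case by (intro exI[of _ "[]"]) simp
  next
    case (insert x T)
    then obtain p where p: "arc_sorted p" "set p = T" by blast
    show ?case
    proof (cases "x \<in> T")
      case True
      then show ?thesis using p by (intro exI[of _ p]) auto
    next
      case False
      have "(y, x) \<in> A" if y: "y \<in> T" for y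
        using support_total[OF uv, of x y] insert y False w[of x y] by force
      then show ?thesis using p by (intro exI[of _ "p @ [x]"]) (auto simp: sorted_wrt_append)
    qed
  qed
  then show ?thesis using that by blast
qed

lemma arc_sorted_reduction_dpath:
  assumes uv: "(u, v) \<in> A" and p: "arc_sorted p" "set p = support u v"
  shows "dpath (transitive_reduction A) u p v"
proof -
  have ne: "p \<noteq> []" using p by (auto simp: support_def)
  have "u \<in> set p" "v \<in> set p" using p(2) by (auto simp: support_def)
  have "hd p = u"
  proof (rule ccontr)
    assume "hd p \<noteq> u"
    then have "(hd p, u) \<in> A" using p(1) ne \<open>u \<in> set p\<close> by (cases p) auto
    then show False using support_first[OF uv, of "hd p"] p(2) hd_in_set[OF ne] by simp
  qed
  moreover have "last p = v"
  proof (rule ccontr)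
    assume "last p \<noteq> v"
    then have "(v, last p) \<in> A" using p(1) ne \<open>v \<in> set p\<close>
      by (cases p rule: rev_cases) (auto simp: sorted_wrt_append)
    then show False using support_last[OF uv, of "last p"] p(2) last_in_set[OF ne] by simp
  qed
  moreover have "(p ! i, p ! Suc i) \<in> transitive_reduction A" if i: "Suc i < length p" for i
  proof -
    let ?x = "p ! i" and ?y = "p ! Suc i"
    have xy: "(?x, ?y) \<in> A" using p(1) i by (auto simp: sorted_wrt_iff_nth_less)
    have xyS: "?x \<in> support u v" "?y \<in> support u v" using p(2) i by (metis Suc_lessD nth_mem)+
    \<comment> \<open>By filledness the second vertex of a longer path would lie strictly between
      two neighbours of the sorted list.\<close>
    have False if q: "dpath A ?x q ?y" "length q - 1 \<ge> 2" for q
    proof -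
      let ?w = "q ! 1"
      have "(q ! 0, ?w) \<in> A" "(?w, q ! (length q - 1)) \<in> A"
        by (rule filled_nth[OF q(1) xy]; use q(2) in simp)+
      moreover have "q ! 0 = ?x" "q ! (length q - 1) = ?y"
        using q(1) by (auto simp: dpath_def hd_conv_nth last_conv_nth)
      ultimately have w: "(?x, ?w) \<in> A" "(?w, ?y) \<in> A" by auto
      then have "?w \<in> set p" using support_between[OF uv xyS] p(2) by (auto simp: support_def)
      then obtain j where j: "j < length p" "p ! j = ?w" by (auto simp: in_set_conv_nth)
      have "j = i \<or> j < i \<or> j = Suc i \<or> Suc i < j" by linarith
      then show False
        using w j i p(1) A_antisym A_irrefl
        by (metis sorted_wrt_iff_nth_less Suc_lessD)
    qed
    then show ?thesis using xy unfolding transitive_reduction_def by blast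
  qed
  ultimately show ?thesis
    using ne arc_sorted_distinct[OF p(1)] by (auto simp: dpath_def successively_conv_nth)
qed

text \<open>A discrete intermediate value argument: a list that starts before \<open>s\<close>, ends
  after \<open>s\<close> and avoids it must step over it.\<close>

lemma successively_jump:
  assumes "successively Q p" "p \<noteq> []" "(hd p, s) \<in> A" "(s, last p) \<in> A"
    "\<And>x. x \<in> set p \<Longrightarrow> (x, s) \<in> A \<or> (s, x) \<in> A"
  obtains x y where "Q x y" "(x, s) \<in> A" "(s, y) \<in> A"
  using assms
proof (induction p arbitrary: thesis)
  case (Cons x p)
  show ?case
  proof (cases p)
    case Nil
    then show ?thesis using Cons.prems A_antisym by auto
  next
    case (Cons y p')
    then consider "(s, y) \<in> A" | "(y, s) \<in> A" using Cons.prems(6)[of y] by auto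
    then show ?thesis
    proof cases
      case 1
      then show ?thesis using Cons.prems(1)[of x y] Cons.prems(2,4) Cons by auto
    next
      case 2
      then show ?thesis using Cons.IH[OF Cons.prems(1)] Cons.prems Cons by auto
    qed
  qed
qed simp

text \<open>A path in the reduction that missed a vertex \<open>s\<close> of the support would step
  over it by an arc that has a detour through \<open>s\<close>, and such an arc is deleted. So the
  path lists the whole clique in its order and is unique.\<close>

lemma reduction_path_props:
  assumes uv: "(u, v) \<in> A"
  shows "arc_sorted (reduction_path A u v)" "set (reduction_path A u v) = support u v"
proof -
  obtain p where p: "arc_sorted p" "set p = support u v" using exists_arc_sorted[OF uv] .
  have "q = p" if q: "dpath (transitive_reduction A) u q v" for q
  proof (rule arc_sorted_unique)
    have TA: "transitive_reduction A \<subseteq> A" by (auto simp: transitive_reduction_def)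
    have qA: "dpath A u q v" using q TA by (rule dpath_mono)
    show "arc_sorted q" using filled_nth[OF qA uv] by (auto simp: sorted_wrt_iff_nth_less)
    have "set q \<subseteq> transitive_support A u v" using qA by (auto simp: transitive_support_def)
    then have sub: "set q \<subseteq> support u v" using transitive_support_eq[OF uv] by (simp add: support_def)
    have ends: "u \<in> set q" "v \<in> set q" using qA by (auto simp: dpath_def)
    have "s \<in> set q" if s: "s \<in> support u v" for s
    proof (rule ccontr)
      assume n: "s \<notin> set q"
      then have "s \<noteq> u" "s \<noteq> v" using ends by auto
      then have us: "(u, s) \<in> A" "(s, v) \<in> A" using s by (auto simp: support_def inner_def)
      obtain x y where xy: "(x, y) \<in> transitive_reduction A" "(x, s) \<in> A" "(s, y) \<in> A"
      proof (rule successively_jump[of "\<lambda>x y. (x, y) \<in> transitive_reduction A" q s])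
        show "(x, s) \<in> A \<or> (s, x) \<in> A" if "x \<in> set q" for x
          using support_total[OF uv, of x s] sub that s n by blast
      qed (use q us in \<open>auto simp: dpath_def\<close>)
      have "dpath A x [x, s, y] y" using xy TA by (intro dpath_triangle) auto
      then show False using xy(1) unfolding transitive_reduction_def by force
    qed
    then show "set q = set p" using sub p by blast
  qed (rule p)
  then have "reduction_path A u v = p"
    unfolding reduction_path_def using arc_sorted_reduction_dpath[OF uv p] by (rule the_equality[rotated])
  then show "arc_sorted (reduction_path A u v)" "set (reduction_path A u v) = support u v"
    using p by auto
qed

lemma reduction_path_last:
  assumes uv: "(u, v) \<in> A"
  shows "last (reduction_path A u v) = v"
proof -
  have "dpath (transitive_reduction A) u (reduction_path A u v) v"
    using arc_sorted_reduction_dpath[OF uv] reduction_path_props[OF uv] by blast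
  then show ?thesis by (simp add: dpath_def)
qed

lemma arc_sorted_split:
  assumes "arc_sorted (xs @ j # ys)"
  shows "(x, j) \<in> A \<Longrightarrow> x \<in> set (xs @ j # ys) \<Longrightarrow> x \<in> set xs"
    and "(j, x) \<in> A \<Longrightarrow> x \<in> set (xs @ j # ys) \<Longrightarrow> x \<in> set ys"
  using assms A_antisym A_irrefl by (auto simp: sorted_wrt_append)

section \<open>Shard polytopes\<close>

fun rope_vecs :: "'v rope \<Rightarrow> (real ^ 'v) set" where
  "rope_vecs (u, v, N, \<Delta>) = alt_vecs ({u} \<union> N) (\<Delta> \<union> {v}) False False (reduction_path A u v)"

fun rope_support :: "'v rope \<Rightarrow> 'v set" where
  "rope_support (u, v, N, \<Delta>) = support u v"

lemma finite_rope_vecs: "finite (rope_vecs \<rho>)"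
  by (cases \<rho>) (simp add: finite_alt_vecs)

lemma zero_rope_vecs: "0 \<in> rope_vecs \<rho>"
  by (cases \<rho>) (simp add: alt_vecs_zero)

lemma sorted_wrt_subseq:
  assumes "subseq xs ys" "sorted_wrt Q ys"
  shows "sorted_wrt Q xs"
  using assms by (induction rule: list_emb.induct) (auto dest: list_emb_set)

lemma rope_disjoint:
  "(u, v, N, \<Delta>) \<in> ropes A \<Longrightarrow> ({u} \<union> N) \<inter> (\<Delta> \<union> {v}) = {}"
  using rope_uv[of u v N \<Delta>] rope_disj[of u v N \<Delta>] by blast

lemma rope_exchange:
  assumes "\<rho> \<in> ropes A" "z \<in> rope_vecs \<rho>" "z' \<in> rope_vecs \<rho>"
  obtains cs where "z' = z + sum_list cs"
    "\<And>c. c \<in> set cs \<Longrightarrow> is_root (rope_support \<rho>) c \<and> z + c \<in> rope_vecs \<rho> \<and> z' - c \<in> rope_vecs \<rho>"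
proof -
  obtain u v N \<Delta> where \<rho>: "\<rho> = (u, v, N, \<Delta>)" by (cases \<rho>)
  have uv: "(u, v) \<in> A" using assms \<rho> by (simp add: ropes_iff)
  have dis: "({u} \<union> N) \<inter> (\<Delta> \<union> {v}) = {}" using rope_disjoint assms \<rho> by blast
  have d: "distinct (reduction_path A u v)" using arc_sorted_distinct reduction_path_props[OF uv] by blast
  let ?p = "reduction_path A u v"
  let ?V = "alt_vecs ({u} \<union> N) (\<Delta> \<union> {v}) False False ?p"
  obtain cs where cs: "z' = z + sum_list cs"
    "\<forall>c\<in>set cs. is_root (set ?p) c \<and> z + c \<in> ?V \<and> z' - c \<in> ?V"
    using alt_vecs_exchange(1)[OF dis d assms(2,3)[unfolded \<rho> rope_vecs.simps]] by blast
  show ?thesis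
  proof (rule that[OF cs(1)])
    fix c assume "c \<in> set cs"
    then show "is_root (rope_support \<rho>) c \<and> z + c \<in> rope_vecs \<rho> \<and> z' - c \<in> rope_vecs \<rho>"
      using cs(2) unfolding \<rho> rope_vecs.simps rope_support.simps reduction_path_props(2)[OF uv] by blast
  qed
qed

lemma shard_polytope_eq:
  assumes "\<rho> \<in> ropes A"
  shows "shard_polytope A \<rho> = convex hull (rope_vecs \<rho>)"
proof -
  obtain u v N \<Delta> where \<rho>: "\<rho> = (u, v, N, \<Delta>)" by (cases \<rho>)
  have uv: "(u, v) \<in> A" using assms \<rho> by (simp add: ropes_iff)
  have vec: "ones (fst ` set ab) - ones (snd ` set ab) = pairs_vec ab"
    if "subseq (pairs_concat ab) (reduction_path A u v)" for ab
    using arc_sorted_distinct[OF sorted_wrt_subseq[OF that reduction_path_props(1)[OF uv]]]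
    by (rule pairs_vec_ones)
  have "(\<lambda>(M, M'). ones M - ones M') ` alternating_matchings A \<rho> = rope_vecs \<rho>"
  proof (intro equalityI subsetI)
    fix z assume "z \<in> (\<lambda>(M, M'). ones M - ones M') ` alternating_matchings A \<rho>"
    then obtain ab where ab: "fst ` set ab \<subseteq> {u} \<union> N" "snd ` set ab \<subseteq> \<Delta> \<union> {v}"
      "subseq (pairs_concat ab) (reduction_path A u v)" "z = ones (fst ` set ab) - ones (snd ` set ab)"
      by (auto simp: alternating_matchings_def \<rho>)
    then have "z = pairs_vec ab" using vec by simp
    then show "z \<in> rope_vecs \<rho>" using pairs_vec_in_alt_vecs(1)[OF ab(1,2,3)] by (simp add: \<rho>)
  next
    fix z assume "z \<in> rope_vecs \<rho>"
    then obtain ab where ab: "z = pairs_vec ab" "fst ` set ab \<subseteq> {u} \<union> N" "snd ` set ab \<subseteq> \<Delta> \<union> {v}"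
      "subseq (pairs_concat ab) (reduction_path A u v)"
      using alt_vecs_pairs(1)[of z "{u} \<union> N" "\<Delta> \<union> {v}" "reduction_path A u v"] unfolding \<rho> rope_vecs.simps by blast
    then have "(fst ` set ab, snd ` set ab) \<in> alternating_matchings A \<rho>"
      by (auto simp: alternating_matchings_def \<rho>)
    moreover have "z = (\<lambda>(M, M'). ones M - ones M') (fst ` set ab, snd ` set ab)"
      using ab vec by simp
    ultimately show "z \<in> (\<lambda>(M, M'). ones M - ones M') ` alternating_matchings A \<rho>" by (rule rev_image_eqI)
  qed
  then show ?thesis by (simp add: shard_polytope_def)
qed

text \<open>Optimality tested on single roots and expressed by orientations, hence independent of
  the direction within the chamber. By \<open>rope_exchange\<close> it implies global optimality,
  strict on the open chamber (\<open>shard_opt_less\<close>), so that the choice in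
  \<open>shard_vertex\<close> is unambiguous.\<close>

definition shard_opt :: "'v rel \<Rightarrow> 'v rope \<Rightarrow> real ^ 'v \<Rightarrow> bool" where
  "shard_opt R \<rho> z \<longleftrightarrow> z \<in> rope_vecs \<rho> \<and> (\<forall>a\<in>rope_support \<rho>. \<forall>b\<in>rope_support \<rho>.
     a \<noteq> b \<longrightarrow> z + (axis a 1 - axis b 1) \<in> rope_vecs \<rho> \<longrightarrow> (a, b) \<in> reorient A R)"

definition shard_vertex :: "'v rope \<Rightarrow> 'v rel \<Rightarrow> real ^ 'v" where
  "shard_vertex \<rho> R = (SOME z. shard_opt R \<rho> z)"

lemma inner_root: "w \<bullet> (axis a 1 - axis b 1) = w $ a - w $ b" for w :: "real ^ 'v"
  by (simp add: inner_diff_right inner_axis)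

lemma rope_support_total:
  "\<lbrakk>\<rho> \<in> ropes A; x \<in> rope_support \<rho>; y \<in> rope_support \<rho>; x \<noteq> y\<rbrakk> \<Longrightarrow> (x, y) \<in> A \<or> (y, x) \<in> A"
  by (cases \<rho>) (auto simp: ropes_iff dest: support_total)

lemma shard_opt_vertex:
  assumes R: "R \<in> AR" and \<rho>: "\<rho> \<in> ropes A"
  shows "shard_opt R \<rho> (shard_vertex \<rho> R)"
proof -
  obtain w where w: "w \<in> open_chamber R" using open_chamber_nonempty[OF R] .
  obtain z where "is_arg_min (\<lambda>z. - (w \<bullet> z)) (\<lambda>z. z \<in> rope_vecs \<rho>) z"
    using ex_is_arg_min_if_finite[OF finite_rope_vecs, of \<rho> "\<lambda>z. - (w \<bullet> z)"] zero_rope_vecs[of \<rho>] by blast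
  then have z: "z \<in> rope_vecs \<rho>" "\<And>z'. z' \<in> rope_vecs \<rho> \<Longrightarrow> w \<bullet> z' \<le> w \<bullet> z"
    unfolding is_arg_min_linorder by auto
  have "shard_opt R \<rho> z"
    unfolding shard_opt_def
  proof (intro conjI ballI impI)
    fix a b assume h: "a \<in> rope_support \<rho>" "b \<in> rope_support \<rho>" "a \<noteq> b"
      "z + (axis a 1 - axis b 1) \<in> rope_vecs \<rho>"
    have "w $ a \<le> w $ b" using z(2)[OF h(4)] by (simp add: inner_add_right inner_root)
    moreover have "(a, b) \<in> reorient A R \<or> (b, a) \<in> reorient A R"
      using rope_support_total[OF \<rho> h(1-3)] by (auto simp: reorient_iff)
    ultimately show "(a, b) \<in> reorient A R" using open_chamberD[OF w, of b a] by force
  qed (rule z(1))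
  then show ?thesis unfolding shard_vertex_def by (rule someI)
qed

lemma sum_list_inner_le:
  fixes w :: "'a::real_inner"
  assumes "\<And>c. c \<in> set cs \<Longrightarrow> w \<bullet> c \<le> 0"
  shows "w \<bullet> sum_list cs \<le> 0"
  using assms by (induction cs) (auto simp: inner_add_right intro: add_nonpos_nonpos)

lemma sum_list_inner_less:
  fixes w :: "'a::real_inner"
  assumes "\<And>c. c \<in> set cs \<Longrightarrow> w \<bullet> c < 0" "cs \<noteq> []"
  shows "w \<bullet> sum_list cs < 0"
  using assms
proof (induction cs)
  case (Cons c cs)
  then show ?case
    using sum_list_inner_le[of cs w] by (force simp: inner_add_right intro: add_neg_nonpos)
qed simp

text \<open>The weight need only be weakly monotone on the support of the rope, so the lemma also
  applies to weights on walls, such as negated indicators of lower sets.\<close>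

lemma shard_opt_le:
  assumes \<rho>: "\<rho> \<in> ropes A" and z: "shard_opt R \<rho> z" and z': "z' \<in> rope_vecs \<rho>"
    and w: "\<And>a b. \<lbrakk>a \<in> rope_support \<rho>; b \<in> rope_support \<rho>; (a, b) \<in> reorient A R\<rbrakk> \<Longrightarrow> w $ a \<le> w $ b"
  shows "w \<bullet> z' \<le> w \<bullet> z"
proof -
  have zv: "z \<in> rope_vecs \<rho>" using z by (simp add: shard_opt_def)
  obtain cs where cs: "z' = z + sum_list cs" "\<And>c. c \<in> set cs \<Longrightarrow> is_root (rope_support \<rho>) c \<and>
    z + c \<in> rope_vecs \<rho> \<and> z' - c \<in> rope_vecs \<rho>" using rope_exchange[OF \<rho> zv z'] by blast
  have "w \<bullet> c \<le> 0" if "c \<in> set cs" for c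
    using cs(2)[OF that] z w unfolding is_root_def shard_opt_def by (auto simp: inner_root)
  then have "w \<bullet> sum_list cs \<le> 0" by (rule sum_list_inner_le)
  then show ?thesis by (simp add: cs(1) inner_add_right)
qed

lemma shard_opt_less:
  assumes \<rho>: "\<rho> \<in> ropes A" and z: "shard_opt R \<rho> z" and z': "z' \<in> rope_vecs \<rho>" "z' \<noteq> z"
    and w: "w \<in> open_chamber R"
  shows "w \<bullet> z' < w \<bullet> z"
proof -
  have zv: "z \<in> rope_vecs \<rho>" using z by (simp add: shard_opt_def)
  obtain cs where cs: "z' = z + sum_list cs" "\<And>c. c \<in> set cs \<Longrightarrow> is_root (rope_support \<rho>) c \<and>
    z + c \<in> rope_vecs \<rho> \<and> z' - c \<in> rope_vecs \<rho>" using rope_exchange[OF \<rho> zv z'(1)] by blast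
  have "w \<bullet> c < 0" if "c \<in> set cs" for c
    using cs(2)[OF that] z open_chamberD[OF w] unfolding is_root_def shard_opt_def by (auto simp: inner_root)
  moreover have "cs \<noteq> []" using cs(1) z'(2) by auto
  ultimately have "w \<bullet> sum_list cs < 0" by (rule sum_list_inner_less)
  then show ?thesis by (simp add: cs(1) inner_add_right)
qed

lemma shard_vertex_in: "R \<in> AR \<Longrightarrow> \<rho> \<in> ropes A \<Longrightarrow> shard_vertex \<rho> R \<in> rope_vecs \<rho>"
  using shard_opt_vertex by (simp add: shard_opt_def)

lemma sum_list_const:
  fixes c :: "'a::real_vector"
  shows "(\<And>x. x \<in> set xs \<Longrightarrow> x = c) \<Longrightarrow> sum_list xs = real (length xs) *\<^sub>R c"
  by (induction xs) (auto simp: scaleR_add_left)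

text \<open>A root exchanged between the two optima worsens the first, and its negative worsens the
  second. Its arc is thus oriented oppositely by the two reorientations, so it is the flipped
  one.\<close>

lemma shard_vertex_flip:
  assumes \<rho>: "\<rho> \<in> ropes A" and f: "flip R x y"
    and ne: "shard_vertex \<rho> (insert (x, y) R) \<noteq> shard_vertex \<rho> R"
  shows "\<exists>k. shard_vertex \<rho> (insert (x, y) R) - shard_vertex \<rho> R = k *\<^sub>R (axis x 1 - axis y 1)"
    and "subrope (flip_rope R x y) \<rho>"
proof -
  let ?R = "insert (x, y) R" and ?z = "shard_vertex \<rho> R" and ?z' = "shard_vertex \<rho> (insert (x, y) R)"
  have AR: "R \<in> AR" "?R \<in> AR" and xyR: "(x, y) \<notin> R" using f by (auto simp: flip_def)
  have xy: "(x, y) \<in> A" using flip_arc[OF f] .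
  have RA: "R \<subseteq> A" using AR AR_sub by blast
  note o = shard_opt_vertex[OF AR(1) \<rho>] and o' = shard_opt_vertex[OF AR(2) \<rho>]
  obtain cs where cs: "?z' = ?z + sum_list cs" "\<And>c. c \<in> set cs \<Longrightarrow> is_root (rope_support \<rho>) c \<and>
    ?z + c \<in> rope_vecs \<rho> \<and> ?z' - c \<in> rope_vecs \<rho>"
    using rope_exchange[OF \<rho> shard_vertex_in[OF AR(1) \<rho>] shard_vertex_in[OF AR(2) \<rho>]] by blast
  have c: "c = axis x 1 - axis y 1 \<and> x \<in> rope_support \<rho> \<and> y \<in> rope_support \<rho> \<and> ?z + c \<in> rope_vecs \<rho>"
    if "c \<in> set cs" for c
  proof -
    note c = cs(2)[OF that]
    obtain a b where ab: "a \<in> rope_support \<rho>" "b \<in> rope_support \<rho>" "a \<noteq> b" "c = axis a 1 - axis b 1"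
      using c by (auto simp: is_root_def)
    have "(a, b) \<in> reorient A R" using c o ab by (auto simp: shard_opt_def)
    moreover have "?z' - c = ?z' + (axis b 1 - axis a 1)" using ab(4) by simp
    then have "?z' + (axis b 1 - axis a 1) \<in> rope_vecs \<rho>" using c by metis
    then have "(b, a) \<in> reorient A ?R" using o' ab by (simp add: shard_opt_def)
    ultimately have "a = x \<and> b = y" using A_antisym RA xy by (auto simp: reorient_iff)
    then show ?thesis using ab c by simp
  qed
  have "sum_list cs = real (length cs) *\<^sub>R (axis x 1 - axis y 1)"
    using c by (intro sum_list_const) blast
  then show "\<exists>k. ?z' - ?z = k *\<^sub>R (axis x 1 - axis y 1)"
    using cs(1) by (intro exI[of _ "real (length cs)"]) simp
  have "cs \<noteq> []" using ne cs(1) by auto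
  then have xyS: "x \<in> rope_support \<rho>" "y \<in> rope_support \<rho>"
    and zc: "?z + (axis x 1 - axis y 1) \<in> rope_vecs \<rho>" using c by (metis list.set_intros(1) neq_Nil_conv)+
  obtain u v N \<Delta> where r: "\<rho> = (u, v, N, \<Delta>)" by (cases \<rho>)
  have rope: "(u, v, N, \<Delta>) \<in> ropes A" using \<rho> r by simp
  note uv = rope_arc[OF rope] and inn = rope_inner[OF rope]
  let ?p = "reduction_path A u v" and ?V = "alt_vecs ({u} \<union> N) (\<Delta> \<union> {v}) False False"
  have xyS': "x \<in> support u v" "y \<in> support u v" using xyS r by auto
  note path = reduction_path_props[OF uv]
  \<comment> \<open>Shortening the admissible move e_x - e_y at \<open>l\<close> gives e_l - e_y or
    e_x - e_l according to the side of \<open>l\<close> in \<open>\<rho>\<close>, and local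
    optimality orients the corresponding arc.\<close>
  have side: "(l \<in> N \<longrightarrow> (x, l) \<in> R) \<and> (l \<in> \<Delta> \<longrightarrow> (x, l) \<notin> R)" if l: "l \<in> inner x y" for l
  proof -
    have xl: "(x, l) \<in> A" "(l, y) \<in> A" using l by (auto simp: inner_def)
    have lS: "l \<in> support u v" using support_between[OF uv xyS' xl] by (simp add: support_def)
    obtain as1 bs1 where 1: "?p = as1 @ l # bs1" using lS path(2) by (metis split_list)
    have "x \<in> set as1" "y \<in> set bs1"
      using arc_sorted_split[OF path(1)[unfolded 1]] xl xyS' path(2) unfolding 1 by auto
    then obtain cs2 as2 where "as1 = cs2 @ x # as2" by (meson split_list)
    then have p: "?p = cs2 @ x # as2 @ l # bs1" using 1 by simp
    have d: "distinct (cs2 @ x # as2 @ l # bs1)" using arc_sorted_distinct[OF path(1)] p by simp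
    have 2: "?z \<in> ?V (cs2 @ x # as2 @ l # bs1)" "?z + axis x 1 - axis y 1 \<in> ?V (cs2 @ x # as2 @ l # bs1)"
      using shard_vertex_in[OF AR(1) \<rho>] zc unfolding r rope_vecs.simps p by (simp_all add: algebra_simps)
    note b = alt_vecs_between[OF 2 d \<open>y \<in> set bs1\<close>]
    have "(l, y) \<in> reorient A R" if "l \<in> N"
    proof -
      have "?z + axis l 1 - axis y 1 \<in> rope_vecs \<rho>" using b that by (simp add: r p)
      then show ?thesis using o lS xyS A_neq[OF xl(2)] unfolding shard_opt_def r by (simp add: add_diff_eq)
    qed
    moreover have "(x, l) \<in> reorient A R" if "l \<in> \<Delta>"
    proof -
      have "?z + axis x 1 - axis l 1 \<in> rope_vecs \<rho>" using b that by (simp add: r p)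
      then show ?thesis using o lS xyS A_neq[OF xl(1)] unfolding shard_opt_def r by (simp add: add_diff_eq)
    qed
    ultimately show ?thesis
      using flip_above[OF f l] xl A_antisym RA by (auto simp: reorient_iff)
  qed
  have "inner x y \<subseteq> N \<union> \<Delta>" using support_between[OF uv xyS'] inn by (auto simp: inner_def)
  then show "subrope (flip_rope R x y) \<rho>"
    using side xy xyS' inn rope_disj[OF rope] unfolding r subrope_def flip_rope_def support_def by auto
qed

lemma rope_root_mem:
  assumes "(u, v, N, \<Delta>) \<in> ropes A"
  shows "axis u 1 - axis v 1 \<in> rope_vecs (u, v, N, \<Delta>)"
proof -
  have uv: "(u, v) \<in> A" using assms by (simp add: ropes_iff)
  note path = reduction_path_props[OF uv]
  let ?p = "reduction_path A u v"
  obtain xs ys where p: "?p = xs @ u # ys" using path(2) by (metis split_list support_def UnI1 insertI1)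
  have "v \<in> set ys" using arc_sorted_split(2)[OF path(1)[unfolded p], of v] uv path(2) p by (auto simp: support_def)
  then have "subseq [v] ys" by (simp add: subseq_singleton_left)
  then have "subseq [u, v] (u # ys)" by simp
  then have "subseq [u, v] ?p" unfolding p by (rule list_emb_append2)
  then have "pairs_vec [(u, v)] \<in> rope_vecs (u, v, N, \<Delta>)"
    unfolding rope_vecs.simps by (intro pairs_vec_in_alt_vecs(1)) auto
  then show ?thesis by simp
qed

text \<open>Before the flip, the upper entry of each pair precedes the lower one in the orientation,
  so no matching has positive value and the vertex is 0. After the flip e_u - e_v is better than
  0.\<close>

lemma shard_vertex_flip_rope:
  assumes f: "flip R u v" and r: "flip_rope R u v = \<rho>"
  shows "shard_vertex \<rho> (insert (u, v) R) \<noteq> shard_vertex \<rho> R"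
proof -
  have \<rho>: "\<rho> \<in> ropes A" using flip_rope_in_ropes[OF f] r by simp
  have AR: "R \<in> AR" "insert (u, v) R \<in> AR" and uv: "(u, v) \<in> A"
    using f flip_arc by (auto simp: flip_def)
  define N where "N = {l \<in> inner u v. (u, l) \<in> R}"
  define D where "D = {l \<in> inner u v. (u, l) \<notin> R}"
  have r': "\<rho> = (u, v, N, D)" using r by (simp add: flip_rope_def N_def D_def)
  note path = reduction_path_props[OF uv]
  let ?p = "reduction_path A u v"
  have E: "(a, b) \<in> reorient A R" if ab: "a = u \<or> a \<in> N" "b = v \<or> b \<in> D" "(a, b) \<in> A" for a b
  proof -
    have "(a, b) \<notin> R"
    proof
      assume abR: "(a, b) \<in> R"
      have uvR: "(u, v) \<notin> R" using f by (simp add: flip_def)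
      show False
      proof (cases "a = u")
        case True
        then show ?thesis using ab abR uvR by (auto simp: D_def)
      next
        case False
        then have "(u, b) \<in> R" using AR_closed[OF AR(1), of u a b] ab abR uv by (auto simp: N_def D_def inner_def)
        then show ?thesis using ab uvR by (auto simp: D_def)
      qed
    qed
    then show ?thesis using ab by (simp add: reorient_iff)
  qed
  obtain w where w: "w \<in> open_chamber R" using open_chamber_nonempty[OF AR(1)] .
  have neg: "w \<bullet> pairs_vec ab \<le> 0"
    if "fst ` set ab \<subseteq> {u} \<union> N" "snd ` set ab \<subseteq> D \<union> {v}" "arc_sorted (pairs_concat ab)" for ab
    using that
  proof (induction ab)
    case (Cons p ab)
    obtain a b where p: "p = (a, b)" by force
    have "(a, b) \<in> reorient A R" using Cons.prems p by (intro E) auto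
    then have "w $ a < w $ b" using open_chamberD[OF w] by blast
    moreover have "w \<bullet> pairs_vec ab \<le> 0" using Cons p by auto
    ultimately show ?case using p by (simp add: inner_add_right inner_root)
  qed simp
  have zero: "shard_vertex \<rho> R = 0"
  proof (rule ccontr)
    assume "shard_vertex \<rho> R \<noteq> 0"
    then have "w \<bullet> 0 < w \<bullet> shard_vertex \<rho> R"
      using shard_opt_less[OF \<rho> shard_opt_vertex[OF AR(1) \<rho>] zero_rope_vecs _ w] by simp
    moreover obtain ab where ab: "shard_vertex \<rho> R = pairs_vec ab" "fst ` set ab \<subseteq> {u} \<union> N"
      "snd ` set ab \<subseteq> D \<union> {v}" "subseq (pairs_concat ab) ?p"
      using alt_vecs_pairs(1)[of "shard_vertex \<rho> R" "{u} \<union> N" "D \<union> {v}" ?p]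
        shard_vertex_in[OF AR(1) \<rho>] unfolding r' rope_vecs.simps by blast
    moreover have "arc_sorted (pairs_concat ab)"
      using path(1) ab(4) sorted_wrt_subseq by blast
    ultimately show False using neg[OF ab(2,3)] by simp
  qed
  have mem: "axis u 1 - axis v 1 \<in> rope_vecs \<rho>" using rope_root_mem \<rho> r' by blast
  have uvS: "u \<in> rope_support \<rho>" "v \<in> rope_support \<rho>" by (auto simp: r' support_def)
  show ?thesis
  proof
    assume "shard_vertex \<rho> (insert (u, v) R) = shard_vertex \<rho> R"
    then have "shard_opt (insert (u, v) R) \<rho> 0" using shard_opt_vertex[OF AR(2) \<rho>] zero by simp
    then have "(u, v) \<in> reorient A (insert (u, v) R)"
      using mem uvS A_neq[OF uv] by (simp add: shard_opt_def)
    then show False using uv A_antisym AR_sub[OF AR(2)] by (auto simp: reorient_iff)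
  qed
qed

section \<open>Minkowski sums over ropes\<close>

text \<open>What a summand has to provide, common to both families. Moving the vertex requires a
  rope contained in \<open>\<rho>\<close>, and the rope \<open>\<rho>\<close> itself guarantees
  it.\<close>

definition rope_vertex_map :: "'v rope \<Rightarrow> (real ^ 'v) set \<Rightarrow> ('v rel \<Rightarrow> real ^ 'v) \<Rightarrow> bool" where
  "rope_vertex_map \<rho> P p \<longleftrightarrow> convex P \<and> (\<forall>R\<in>AR. p R \<in> P) \<and>
     (\<forall>R\<in>AR. \<forall>w\<in>open_chamber R. \<forall>x\<in>P. x \<noteq> p R \<longrightarrow> w \<bullet> x < w \<bullet> p R) \<and>
     (\<forall>R x y. flip R x y \<longrightarrow>
        (\<exists>k. p (insert (x, y) R) - p R = k *\<^sub>R (axis x 1 - axis y 1)) \<and>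
        (p (insert (x, y) R) \<noteq> p R \<longrightarrow> subrope (flip_rope R x y) \<rho>) \<and>
        (flip_rope R x y = \<rho> \<longrightarrow> p (insert (x, y) R) \<noteq> p R))"

lemma inner_sum_less:
  fixes w :: "'a::real_inner"
  assumes fin: "finite I" and i: "i \<in> I" "f i \<noteq> g i"
    and less: "\<And>i. i \<in> I \<Longrightarrow> f i \<noteq> g i \<Longrightarrow> w \<bullet> f i < w \<bullet> g i"
  shows "w \<bullet> sum f I < w \<bullet> sum g I"
  unfolding inner_sum_right
proof (rule sum_strict_mono_ex1[OF fin])
  show "\<forall>i\<in>I. w \<bullet> f i \<le> w \<bullet> g i" using less by (metis less_imp_le order_refl)
  show "\<exists>i\<in>I. w \<bullet> f i < w \<bullet> g i" using less i by blast
qed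

lemma shard_polytope_vertex_map:
  assumes \<rho>: "\<rho> \<in> ropes A"
  shows "rope_vertex_map \<rho> (shard_polytope A \<rho>) (shard_vertex \<rho>)"
  unfolding rope_vertex_map_def
proof (intro conjI allI ballI impI)
  show "convex (shard_polytope A \<rho>)" using shard_polytope_eq[OF \<rho>] by simp
next
  fix R assume "R \<in> AR"
  then show "shard_vertex \<rho> R \<in> shard_polytope A \<rho>"
    using shard_vertex_in[OF _ \<rho>] shard_polytope_eq[OF \<rho>] by (simp add: hull_inc)
next
  fix R w x assume h: "R \<in> AR" "w \<in> open_chamber R" "x \<in> shard_polytope A \<rho>" "x \<noteq> shard_vertex \<rho> R"
  let ?z = "shard_vertex \<rho> R"
  obtain c where c: "\<forall>z\<in>rope_vecs \<rho>. 0 \<le> c z" "sum c (rope_vecs \<rho>) = 1"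
    "x = (\<Sum>z\<in>rope_vecs \<rho>. c z *\<^sub>R z)"
    using h(3) unfolding shard_polytope_eq[OF \<rho>] convex_hull_finite[OF finite_rope_vecs] by auto
  \<comment> \<open>The vertex is written with the same coefficients as \<open>x\<close>, which
    allows a comparison term by term.\<close>
  have z: "?z = (\<Sum>z\<in>rope_vecs \<rho>. c z *\<^sub>R ?z)" using c(2) by (simp flip: scaleR_sum_left)
  then obtain y where y: "y \<in> rope_vecs \<rho>" "c y *\<^sub>R y \<noteq> c y *\<^sub>R ?z"
    using h(4) c(3) by (metis (mono_tags, lifting) sum.cong)
  have "w \<bullet> (\<Sum>z\<in>rope_vecs \<rho>. c z *\<^sub>R z) < w \<bullet> (\<Sum>z\<in>rope_vecs \<rho>. c z *\<^sub>R ?z)"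
  proof (rule inner_sum_less[where i = y])
    fix z assume "z \<in> rope_vecs \<rho>" "c z *\<^sub>R z \<noteq> c z *\<^sub>R ?z"
    then have "c z > 0" "w \<bullet> z < w \<bullet> ?z"
      using c(1) shard_opt_less[OF \<rho> shard_opt_vertex[OF h(1) \<rho>] _ _ h(2), of z] by (auto simp: less_le)
    then show "w \<bullet> (c z *\<^sub>R z) < w \<bullet> (c z *\<^sub>R ?z)" by simp
  qed (use finite_rope_vecs y in auto)
  then show "w \<bullet> x < w \<bullet> ?z" unfolding c(3) z[symmetric] .
next
  fix R x y assume f: "flip R x y"
  show "\<exists>k. shard_vertex \<rho> (insert (x, y) R) - shard_vertex \<rho> R = k *\<^sub>R (axis x 1 - axis y 1)"
    using shard_vertex_flip(1)[OF \<rho> f] by (metis diff_self scaleR_zero_left)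
next
  fix R x y assume f: "flip R x y" "shard_vertex \<rho> (insert (x, y) R) \<noteq> shard_vertex \<rho> R"
  then show "subrope (flip_rope R x y) \<rho>" using shard_vertex_flip(2)[OF \<rho>] by blast
next
  fix R x y assume "flip R x y" "flip_rope R x y = \<rho>"
  then show "shard_vertex \<rho> (insert (x, y) R) \<noteq> shard_vertex \<rho> R" by (rule shard_vertex_flip_rope)
qed

text \<open>A vertex moves by a multiple of the flipped direction, and these multiples all have the same
  sign, so that no cancellation occurs in the sum.\<close>

lemma sum_vertices_neq:
  assumes fin: "finite I" and f: "flip R x y" and i: "i \<in> I" "p i (insert (x, y) R) \<noteq> p i R"
    and le: "\<And>i w. i \<in> I \<Longrightarrow> w \<in> open_chamber R \<Longrightarrow> p i (insert (x, y) R) \<noteq> p i R \<Longrightarrow>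
      w \<bullet> p i (insert (x, y) R) < w \<bullet> p i R"
  shows "(\<Sum>i\<in>I. p i (insert (x, y) R)) \<noteq> (\<Sum>i\<in>I. p i R)"
proof -
  have "R \<in> AR" using f by (simp add: flip_def)
  then obtain w where w: "w \<in> open_chamber R" using open_chamber_nonempty by blast
  have "w \<bullet> (\<Sum>i\<in>I. p i (insert (x, y) R)) < w \<bullet> (\<Sum>i\<in>I. p i R)"
    by (rule inner_sum_less[where i = i, OF fin i(1)]) (use i(2) le[OF _ w] in auto)
  then show ?thesis by force
qed

lemma sum_vertices_root:
  assumes "\<And>i. i \<in> I \<Longrightarrow> \<exists>k. f i - g i = k *\<^sub>R (c :: 'a :: real_vector)"
  shows "\<exists>k. (\<Sum>i\<in>I. f i) - (\<Sum>i\<in>I. g i) = k *\<^sub>R c"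
proof -
  obtain k where "\<And>i. i \<in> I \<Longrightarrow> f i - g i = k i *\<^sub>R c" using assms by metis
  then have "(\<Sum>i\<in>I. f i) - (\<Sum>i\<in>I. g i) = (\<Sum>i\<in>I. k i) *\<^sub>R c"
    by (simp add: sum_subtractf[symmetric] scaleR_sum_left)
  then show ?thesis by blast
qed

text \<open>The summands are the ropes of uncontracted flips. A contracted flip moves none of them,
  since the rope of a moved summand would contain a contracted one and be contracted too; an
  uncontracted flip moves the summand of its own rope.\<close>

lemma quotient_fan_minkowski:
  assumes cong: "lattice_congruence (acyclic_reorientations A) r"
    and "\<And>\<rho>. \<rho> \<in> ropes A \<Longrightarrow> \<exists>p. rope_vertex_map \<rho> (P \<rho>) p"
  shows "\<exists>I \<subseteq> ropes A. quotient_fan A r = normal_fan (\<Sum>\<rho>\<in>I. P \<rho>)"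
proof -
  obtain p where p: "\<And>\<rho>. \<rho> \<in> ropes A \<Longrightarrow> rope_vertex_map \<rho> (P \<rho>) (p \<rho>)" using assms(2) by metis
  define I where "I = {\<rho>. \<exists>R x y. flip R x y \<and> flip_rope R x y = \<rho> \<and> (R, insert (x, y) R) \<notin> r}"
  have I: "I \<subseteq> ropes A" unfolding I_def using flip_rope_in_ropes by blast
  have fin: "finite I" by simp
  define q where "q R = (\<Sum>\<rho>\<in>I. p \<rho> R)" for R
  have convP: "convex (P \<rho>)" and inP: "R \<in> AR \<Longrightarrow> p \<rho> R \<in> P \<rho>"
    and maxP: "\<lbrakk>R \<in> AR; w \<in> open_chamber R; x \<in> P \<rho>; x \<noteq> p \<rho> R\<rbrakk> \<Longrightarrow> w \<bullet> x < w \<bullet> p \<rho> R"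
    and rootP: "flip R s t \<Longrightarrow> \<exists>k. p \<rho> (insert (s, t) R) - p \<rho> R = k *\<^sub>R (axis s 1 - axis t 1)"
    and subP: "flip R s t \<Longrightarrow> p \<rho> (insert (s, t) R) \<noteq> p \<rho> R \<Longrightarrow> subrope (flip_rope R s t) \<rho>"
    and neqP: "flip R s t \<Longrightarrow> flip_rope R s t = \<rho> \<Longrightarrow> p \<rho> (insert (s, t) R) \<noteq> p \<rho> R"
    if "\<rho> \<in> I" for \<rho> R w x s t
    using p[of \<rho>] that I unfolding rope_vertex_map_def by blast+
  have "quotient_fan A r = normal_fan (\<Sum>\<rho>\<in>I. P \<rho>)"
  proof (rule quotient_fan_eq[where p = q])
    show "convex (\<Sum>\<rho>\<in>I. P \<rho>)" using convP by (rule convex_set_sum)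
    show "q R \<in> (\<Sum>\<rho>\<in>I. P \<rho>)" if "R \<in> AR" for R
      unfolding set_sum_alt[OF fin] q_def using inP[OF _ that] by blast
    show "w \<bullet> x < w \<bullet> q R"
      if R: "R \<in> AR" and w: "w \<in> open_chamber R" and x: "x \<in> (\<Sum>\<rho>\<in>I. P \<rho>)" and ne: "x \<noteq> q R" for R w x
    proof -
      obtain s where s: "x = sum s I" "\<And>\<rho>. \<rho> \<in> I \<Longrightarrow> s \<rho> \<in> P \<rho>"
        using x unfolding set_sum_alt[OF fin] by blast
      obtain \<rho> where "\<rho> \<in> I" "s \<rho> \<noteq> p \<rho> R" using ne s(1) unfolding q_def by (meson sum.cong)
      then show ?thesis unfolding s(1) q_def
        by (rule inner_sum_less[OF fin]) (use maxP[OF _ R w] s(2) in blast)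
    qed
    show "lattice_congruence (acyclic_reorientations A) r" by (rule cong)
    show "\<exists>k. q (insert (x, y) R) - q R = k *\<^sub>R (axis x 1 - axis y 1)" if "flip R x y" for R x y
      unfolding q_def by (rule sum_vertices_root) (rule rootP[OF _ that])
    show "(R, insert (x, y) R) \<in> r \<longleftrightarrow> q R = q (insert (x, y) R)" if f: "flip R x y" for R x y
    proof
      assume c: "(R, insert (x, y) R) \<in> r"
      have "p \<rho> R = p \<rho> (insert (x, y) R)" if \<rho>: "\<rho> \<in> I" for \<rho>
      proof (rule ccontr)
        assume "p \<rho> R \<noteq> p \<rho> (insert (x, y) R)"
        then have "subrope (flip_rope R x y) \<rho>" using subP[OF \<rho> f] by metis
        then show False using \<rho> flip_cong_subrope[OF cong f _ _ c] unfolding I_def by blast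
      qed
      then show "q R = q (insert (x, y) R)" unfolding q_def by (rule sum.cong[OF refl])
    next
      assume eq: "q R = q (insert (x, y) R)"
      show "(R, insert (x, y) R) \<in> r"
      proof (rule ccontr)
        assume n: "(R, insert (x, y) R) \<notin> r"
        then have i: "flip_rope R x y \<in> I" using f unfolding I_def by blast
        have AR: "R \<in> AR" "insert (x, y) R \<in> AR" using f by (auto simp: flip_def)
        have "q (insert (x, y) R) \<noteq> q R"
          unfolding q_def
          by (rule sum_vertices_neq[where i = "flip_rope R x y" and p = p, OF fin f i])
            (use neqP[OF i f refl] maxP[OF _ AR(1) _ inP[OF _ AR(2)]] in blast)+
        then show False using eq by simp
      qed
    qed
  qed
  then show ?thesis using I by blast
qed

end

section \<open>Splicing alternating vectors at a cut, and Abel summation\<close>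

lemma inner_ones_cong:
  "(\<And>a. z $ a \<noteq> 0 \<Longrightarrow> a \<in> X \<longleftrightarrow> a \<in> Y) \<Longrightarrow> ones X \<bullet> z = ones Y \<bullet> z"
proof -
  assume h: "\<And>a. z $ a \<noteq> 0 \<Longrightarrow> a \<in> X \<longleftrightarrow> a \<in> Y"
  have "ones X \<bullet> z = (\<Sum>a\<in>UNIV. if a \<in> X then z $ a else 0)" for X
    by (simp add: inner_ones sum.If_cases)
  moreover have "(\<Sum>a\<in>UNIV. if a \<in> X then z $ a else 0) = (\<Sum>a\<in>UNIV. if a \<in> Y then z $ a else 0)"
    by (rule sum.cong) (use h in auto)
  ultimately show ?thesis by simp
qed

lemma inner_ones_alt_vecs:
  assumes "z \<in> alt_vecs U D s t xs" "\<And>a. a \<in> set xs \<Longrightarrow> a \<in> X \<longleftrightarrow> a \<in> Y"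
  shows "ones X \<bullet> z = ones Y \<bullet> z"
  using assms alt_vecs_support by (intro inner_ones_cong) blast

lemma inner_ones_empty [simp]: "ones {} \<bullet> z = 0"
  by (simp add: inner_ones)

lemma inner_ones_disjoint:
  assumes "z \<in> alt_vecs U D s t xs" "X \<inter> set xs = {}"
  shows "ones X \<bullet> z = 0"
  using inner_ones_alt_vecs[OF assms(1), of X "{}"] assms(2) by auto

text \<open>For \<open>X\<close> cut at a missing vertex \<open>j\<close>, the run of
  \<open>z1\<close> before \<open>j\<close> is continued by that of \<open>z2\<close> after
  \<open>j\<close>. If the states do not match, either going up at \<open>j\<close> repairs this for
  free because \<open>j\<close> is not in \<open>X\<close>, or \<open>alt_vecs_start_True\<close>
  does; the latter needs a last vertex in \<open>D\<close>.\<close>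

lemma splice_up:
  assumes j: "j \<in> U" "j \<notin> D" "j \<notin> X" and ys: "ys \<noteq> []" "last ys \<in> D" and d: "distinct (xs @ j # ys)"
    and z1: "z1 \<in> alt_vecs U D False False (xs @ j # ys)"
    and z2: "z2 \<in> alt_vecs U D False False (xs @ j # ys)"
    and X1: "\<And>a. a \<in> set xs \<Longrightarrow> a \<in> X1 \<longleftrightarrow> a \<in> X" "X1 \<inter> set (j # ys) = {}"
    and X2: "\<And>a. a \<in> set ys \<Longrightarrow> a \<in> X2 \<longleftrightarrow> a \<in> X" "X2 \<inter> set (xs @ [j]) = {}"
  shows "\<exists>z\<in>alt_vecs U D False False (xs @ j # ys). ones X \<bullet> z \<le> ones X1 \<bullet> z1 + ones X2 \<bullet> z2"
proof -
  let ?V = "alt_vecs U D"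
  obtain s x1 w1 where 1: "x1 \<in> ?V False s xs" "w1 \<in> ?V s False (j # ys)" "z1 = x1 + w1"
    using z1 unfolding alt_vecs_append by blast
  obtain t x2 w2 where 2: "x2 \<in> ?V False t xs" "w2 \<in> ?V t False (j # ys)" "z2 = x2 + w2"
    using z2 unfolding alt_vecs_append by blast
  have v1: "ones X1 \<bullet> z1 = ones X \<bullet> x1"
    using inner_ones_alt_vecs[OF 1(1) X1(1)] inner_ones_disjoint[OF 1(2) X1(2)]
    by (simp add: 1(3) inner_add_right)
  have "ones X2 \<bullet> x2 = 0" using X2(2) by (intro inner_ones_disjoint[OF 2(1)]) auto
  then have v2: "ones X2 \<bullet> z2 = ones X2 \<bullet> w2" by (simp add: 2(3) inner_add_right)
  have "\<exists>t'. \<exists>y2\<in>?V t' False ys. ones X2 \<bullet> w2 = ones X2 \<bullet> y2"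
  proof -
    consider "w2 \<in> ?V t False ys" | y where "w2 = y + axis j 1" "y \<in> ?V True False ys"
      using 2(2) j by (auto split: if_splits)
    then show ?thesis
      by cases (use X2(2) in \<open>auto simp: inner_add_right inner_ones_axis\<close>)
  qed
  then obtain t' y2 where y2: "y2 \<in> ?V t' False ys" "ones X2 \<bullet> w2 = ones X2 \<bullet> y2" by blast
  have v3: "ones X2 \<bullet> y2 = ones X \<bullet> y2" by (rule inner_ones_alt_vecs[OF y2(1) X2(1)])
  have "\<exists>w\<in>?V s False (j # ys). ones X \<bullet> w \<le> ones X \<bullet> y2"
  proof (cases s; cases t')
    assume st: "s" "\<not> t'"
    then obtain y' where "y' \<in> ?V True False ys" "ones X \<bullet> y' \<le> ones X \<bullet> y2"
      using alt_vecs_start_True[of y2 U D ys] y2(1) ys by auto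
    then show ?thesis using st by auto
  next
    assume st: "\<not> s" "t'"
    then have "y2 + axis j 1 \<in> ?V s False (j # ys)" using y2(1) j by simp
    then show ?thesis
      using j(3) by (intro bexI[of _ "y2 + axis j 1"]) (auto simp: inner_add_right inner_ones_axis simp del: alt_vecs.simps)
  qed (use y2(1) in auto)
  then obtain w where w: "w \<in> ?V s False (j # ys)" "ones X \<bullet> w \<le> ones X \<bullet> y2" by blast
  have "x1 + w \<in> ?V False False (xs @ j # ys)" unfolding alt_vecs_append using 1(1) w(1) by blast
  moreover have "ones X \<bullet> (x1 + w) \<le> ones X1 \<bullet> z1 + ones X2 \<bullet> z2"
    using v1 v2 v3 y2(2) w(2) by (simp add: inner_add_right)
  ultimately show ?thesis by blast
qed

text \<open>The dual cut at \<open>j \<in> X\<close>: now the run of \<open>z2\<close> before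
  \<open>j\<close> is continued by that of \<open>z1\<close> after \<open>j\<close>. The parts
  discarded lie in \<open>X1\<close> or \<open>X2\<close> entirely and contribute differences of
  states, which pay for the repair: going down at \<open>j\<close> gains 1, and
  \<open>alt_vecs_start_False\<close> costs at most 1.\<close>

lemma splice_down:
  assumes j: "j \<in> D" "j \<notin> U" "j \<in> X" and d: "distinct (xs @ j # ys)"
    and z1: "z1 \<in> alt_vecs U D False False (xs @ j # ys)"
    and z2: "z2 \<in> alt_vecs U D False False (xs @ j # ys)"
    and X1: "\<And>a. a \<in> set ys \<Longrightarrow> a \<in> X1 \<longleftrightarrow> a \<in> X" "set (xs @ [j]) \<subseteq> X1"
    and X2: "\<And>a. a \<in> set xs \<Longrightarrow> a \<in> X2 \<longleftrightarrow> a \<in> X" "set (j # ys) \<subseteq> X2"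
  shows "\<exists>z\<in>alt_vecs U D False False (xs @ j # ys). ones X \<bullet> z \<le> ones X1 \<bullet> z1 + ones X2 \<bullet> z2"
proof -
  let ?V = "alt_vecs U D"
  obtain s x2 w2 where 2: "x2 \<in> ?V False s xs" "w2 \<in> ?V s False (j # ys)" "z2 = x2 + w2"
    using z2 unfolding alt_vecs_append by blast
  obtain t x1 w1 where 1: "x1 \<in> ?V False t xs" "w1 \<in> ?V t False (j # ys)" "z1 = x1 + w1"
    using z1 unfolding alt_vecs_append by blast
  have v2: "ones X2 \<bullet> z2 = ones X \<bullet> x2 - of_bool s"
    using inner_ones_alt_vecs[OF 2(1) X2(1)] alt_vecs_total[OF 2(2) X2(2)]
    by (simp add: 2(3) inner_add_right)
  have "ones X1 \<bullet> x1 = of_bool t" using alt_vecs_total[OF 1(1), of X1] X1(2) by simp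
  then have v1: "ones X1 \<bullet> z1 = of_bool t + ones X1 \<bullet> w1" by (simp add: 1(3) inner_add_right)
  have "\<exists>t'. \<exists>y1\<in>?V t' False ys. of_bool t + ones X1 \<bullet> w1 = of_bool t' + ones X1 \<bullet> y1"
  proof -
    consider "w1 \<in> ?V t False ys" | y where "t" "w1 = y - axis j 1" "y \<in> ?V False False ys"
      using 1(2) j by (auto split: if_splits)
    then show ?thesis
    proof cases
      case 1
      then show ?thesis by blast
    next
      case 2
      then have "of_bool t + ones X1 \<bullet> w1 = of_bool False + ones X1 \<bullet> y"
        using X1(2) by (simp add: inner_diff_right inner_ones_axis)
      then show ?thesis using 2(3) by blast
    qed
  qed
  then obtain t' y1 where y1: "y1 \<in> ?V t' False ys" "of_bool t + ones X1 \<bullet> w1 = of_bool t' + ones X1 \<bullet> y1" by blast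
  have v3: "ones X1 \<bullet> y1 = ones X \<bullet> y1" by (rule inner_ones_alt_vecs[OF y1(1) X1(1)])
  have "\<exists>w\<in>?V s False (j # ys). ones X \<bullet> w \<le> ones X \<bullet> y1 + of_bool t' - of_bool s"
  proof (cases s; cases t')
    assume st: "s" "\<not> t'"
    then have "y1 - axis j 1 \<in> ?V s False (j # ys)" using y1(1) j by simp
    then show ?thesis
      using j(3) st by (intro bexI[of _ "y1 - axis j 1"]) (auto simp: inner_diff_right inner_ones_axis simp del: alt_vecs.simps)
  next
    assume st: "\<not> s" "t'"
    then obtain y' where "y' \<in> ?V False False ys" "ones X \<bullet> y' \<le> ones X \<bullet> y1 + 1"
      using alt_vecs_start_False[of y1 U D ys] y1(1) by auto
    then show ?thesis using st by auto
  qed (use y1(1) in auto)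
  then obtain w where w: "w \<in> ?V s False (j # ys)" "ones X \<bullet> w \<le> ones X \<bullet> y1 + of_bool t' - of_bool s" by blast
  have "x2 + w \<in> ?V False False (xs @ j # ys)" unfolding alt_vecs_append using 2(1) w(1) by blast
  moreover have "ones X \<bullet> (x2 + w) \<le> ones X1 \<bullet> z1 + ones X2 \<bullet> z2"
    using v1 v2 v3 y1(2) w(2) by (simp add: inner_add_right)
  ultimately show ?thesis by blast
qed

text \<open>Abel summation over the lower sets of \<open>w\<close>. The bound \<open>M\<close>
  carries the induction: removing the element \<open>m\<close> of largest weight replaces
  \<open>M\<close> by \<open>w m\<close>.\<close>

lemma abel_lower_sets:
  fixes w d :: "'a \<Rightarrow> real"
  assumes "finite S" "inj_on w S" "\<And>c. (\<Sum>s | s \<in> S \<and> w s < c. d s) \<ge> 0"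
    and "\<And>s. s \<in> S \<Longrightarrow> w s < M"
  shows "(\<Sum>s\<in>S. w s * d s) \<le> M * sum d S \<and>
    ((\<Sum>s\<in>S. w s * d s) \<ge> M * sum d S \<longrightarrow> (\<forall>s\<in>S. d s = 0))"
  using assms
proof (induction arbitrary: M rule: finite_ranking_induct[where f = w])
  case empty
  then show ?case by simp
next
  case (insert m S)
  show ?case
  proof (cases "m \<in> S")
    case True
    then have eq: "insert m S = S" by blast
    show ?thesis using insert.prems unfolding eq by (rule insert.IH)
  next
    case False
    have lt: "w s < w m" if "s \<in> S" for s
    proof -
      have "w s \<noteq> w m" using insert.prems(1) that False by (metis inj_onD insertCI)
      then show ?thesis using insert.hyps(2)[OF that] by simp
    qed
    have low: "(\<Sum>s | s \<in> S \<and> w s < c. d s) \<ge> 0" for c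
    proof -
      have "{s \<in> S. w s < c} = {s \<in> insert m S. w s < min c (w m)}" using lt by auto
      then show ?thesis using insert.prems(2)[of "min c (w m)"] by simp
    qed
    have inj: "inj_on w S" using insert.prems(1) by (rule inj_on_subset) auto
    note IH = insert.IH[OF inj low lt]
    have "{s \<in> insert m S. w s < M} = insert m S" using insert.prems(3) by auto
    then have D: "d m + sum d S \<ge> 0" using insert.prems(2)[of M] insert.hyps(1) False by simp
    have M: "w m < M" using insert.prems(3) by simp
    have tot: "(\<Sum>s\<in>insert m S. w s * d s) = w m * d m + (\<Sum>s\<in>S. w s * d s)"
      "sum d (insert m S) = d m + sum d S" using insert.hyps(1) False by auto
    have le: "(\<Sum>s\<in>insert m S. w s * d s) \<le> w m * (d m + sum d S)"
      unfolding tot(1) distrib_left using conjunct1[OF IH] by linarith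
    have le2: "w m * (d m + sum d S) \<le> M * (d m + sum d S)" using M D by (intro mult_right_mono) auto
    show ?thesis
    proof (intro conjI impI)
      show "(\<Sum>s\<in>insert m S. w s * d s) \<le> M * sum d (insert m S)" using le le2 tot by simp
      assume a: "(\<Sum>s\<in>insert m S. w s * d s) \<ge> M * sum d (insert m S)"
      then have "M * (d m + sum d S) \<le> w m * (d m + sum d S)" using le unfolding tot(2) by (rule order_trans)
      then have "(M - w m) * (d m + sum d S) \<le> 0" by (simp add: left_diff_distrib)
      then have z: "d m + sum d S = 0" using M D by (simp add: mult_le_0_iff)
      have dm: "d m = - sum d S" using z by simp
      have "w m * d m + (\<Sum>s\<in>S. w s * d s) \<ge> 0" using a unfolding tot z by simp
      then have "(\<Sum>s\<in>S. w s * d s) \<ge> w m * sum d S" unfolding dm by simp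
      then have "\<forall>s\<in>S. d s = 0" using conjunct2[OF IH] by blast
      then show "\<forall>s\<in>insert m S. d s = 0" using z by simp
    qed
  qed
qed

context skeletal_digraph begin

section \<open>Associahedra\<close>

context
  fixes u v :: 'v and N \<Delta> :: "'v set"
  assumes rope: "(u, v, N, \<Delta>) \<in> ropes A"
begin

abbreviation "S \<equiv> support u v"

lemma S_eq: "S = {u, v} \<union> N \<union> \<Delta>"
  using rope_inner[OF rope] by (auto simp: support_def)

lemma uv: "(u, v) \<in> A" using rope by (simp add: ropes_iff)

text \<open>The condition on facet sets, with path positions replaced by arcs of the clique
  \<open>S\<close>.\<close>

definition balanced :: "'v set \<Rightarrow> bool" where
  "balanced U \<longleftrightarrow> (\<forall>p\<in>S. \<forall>q\<in>S. \<forall>s\<in>S. (p, q) \<in> A \<and> (q, s) \<in> A \<longrightarrow>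
     (p \<in> U \<and> s \<in> U \<and> q \<in> N \<longrightarrow> q \<in> U) \<and> (p \<notin> U \<and> s \<notin> U \<and> q \<in> \<Delta> \<longrightarrow> q \<notin> U))"

lemma associahedron_iff:
  "x \<in> associahedron A (u, v, N, \<Delta>) \<longleftrightarrow> (\<forall>w. w \<notin> S \<longrightarrow> x $ w = 0) \<and>
     ones S \<bullet> x = real ((card S + 1) choose 2) \<and>
     (\<forall>U. U \<noteq> {} \<and> U \<subset> S \<and> balanced U \<longrightarrow> ones U \<bullet> x \<ge> real ((card U + 1) choose 2))"
proof -
  let ?p = "reduction_path A u v"
  note path = reduction_path_props[OF uv]
  have n: "length ?p = card S"
    using distinct_card[OF arc_sorted_distinct[OF path(1)]] path(2) by simp
  have lt: "i < j \<longleftrightarrow> (?p ! i, ?p ! j) \<in> A" if "i < length ?p" "j < length ?p" for i j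
    using path(1) that A_antisym A_irrefl by (metis sorted_wrt_iff_nth_less linorder_neqE_nat)
  have "(\<forall>i j k. i < j \<and> j < k \<and> k < length ?p \<longrightarrow>
      (?p ! i \<in> U \<and> ?p ! k \<in> U \<and> ?p ! j \<in> N \<longrightarrow> ?p ! j \<in> U) \<and>
      (?p ! i \<notin> U \<and> ?p ! k \<notin> U \<and> ?p ! j \<in> \<Delta> \<longrightarrow> ?p ! j \<notin> U)) \<longleftrightarrow> balanced U" (is "?L \<longleftrightarrow> _") for U
  proof
    assume L: ?L
    show "balanced U"
      unfolding balanced_def
    proof (intro ballI impI)
      fix p q s assume h: "p \<in> S" "q \<in> S" "s \<in> S" "(p, q) \<in> A \<and> (q, s) \<in> A"
      obtain i j k where ijk: "i < length ?p" "j < length ?p" "k < length ?p" "p = ?p ! i" "q = ?p ! j" "s = ?p ! k"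
        using h(1-3) unfolding path(2)[symmetric] by (auto simp: in_set_conv_nth)
      then have "i < j" "j < k" using lt h(4) by auto
      then show "(p \<in> U \<and> s \<in> U \<and> q \<in> N \<longrightarrow> q \<in> U) \<and> (p \<notin> U \<and> s \<notin> U \<and> q \<in> \<Delta> \<longrightarrow> q \<notin> U)"
        using L ijk by blast
    qed
  next
    assume b: "balanced U"
    show ?L
    proof (intro allI impI)
      fix i j k assume h: "i < j \<and> j < k \<and> k < length ?p"
      then have "?p ! i \<in> S" "?p ! j \<in> S" "?p ! k \<in> S" unfolding path(2)[symmetric] by auto
      moreover have "(?p ! i, ?p ! j) \<in> A" "(?p ! j, ?p ! k) \<in> A" using h lt[of i j] lt[of j k] by auto
      ultimately show "(?p ! i \<in> U \<and> ?p ! k \<in> U \<and> ?p ! j \<in> N \<longrightarrow> ?p ! j \<in> U) \<and>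
          (?p ! i \<notin> U \<and> ?p ! k \<notin> U \<and> ?p ! j \<in> \<Delta> \<longrightarrow> ?p ! j \<notin> U)"
        using b unfolding balanced_def by blast
    qed
  qed
  note bal = this
  show ?thesis
    unfolding associahedron_def prod.case Let_def S_eq[symmetric] bal unfolding n mem_Collect_eq ..
qed

section \<open>The candidate vertices and the count of arcs entering a set\<close>

definition arcs :: "('v \<times> 'v) set" where
  "arcs = {(x, y) \<in> A. x \<in> S \<and> y \<in> S}"

text \<open>Over all arcs within the support, these are exactly the ropes contained in the given
  one.\<close>

definition restrict_rope :: "'v \<times> 'v \<Rightarrow> 'v rope" where
  "restrict_rope = (\<lambda>(x, y). (x, y, N \<inter> inner x y, \<Delta> \<inter> inner x y))"

definition position :: "'v \<Rightarrow> nat" where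
  "position y = card {x \<in> S. x = y \<or> (x, y) \<in> A}"

text \<open>The vector (1, ..., n) along the path. It is the candidate vertex for the unreversed
  orientation, where no matching has positive value and all shard vertices vanish.\<close>

definition shift :: "real ^ 'v" where
  "shift = (\<chi> y. if y \<in> S then real (position y) else 0)"

abbreviation sub_vecs :: "'v \<times> 'v \<Rightarrow> (real ^ 'v) set" where
  "sub_vecs q \<equiv> rope_vecs (restrict_rope q)"

abbreviation sub_vertex :: "'v \<times> 'v \<Rightarrow> 'v rel \<Rightarrow> real ^ 'v" where
  "sub_vertex q \<equiv> shard_vertex (restrict_rope q)"

definition assoc_vertex :: "'v rel \<Rightarrow> real ^ 'v" where
  "assoc_vertex R = shift + (\<Sum>q\<in>arcs. sub_vertex q R)"

lemma inner_sub: "x \<in> S \<Longrightarrow> y \<in> S \<Longrightarrow> inner x y \<subseteq> N \<union> \<Delta>"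
  using support_between[OF uv] rope_inner[OF rope] by (auto simp: inner_def)

lemma restrict_rope_ropes: "q \<in> arcs \<Longrightarrow> restrict_rope q \<in> ropes A"
  using inner_sub rope_disj[OF rope] by (cases q) (auto simp: arcs_def restrict_rope_def ropes_iff)

lemma restrict_rope_support:
  "q \<in> arcs \<Longrightarrow> rope_support (restrict_rope q) \<subseteq> S"
  using support_mono[OF uv] by (cases q) (auto simp: arcs_def restrict_rope_def)

lemma restrict_vecs_support:
  assumes "q \<in> arcs" "z \<in> sub_vecs q" "a \<notin> rope_support (restrict_rope q)"
  shows "z $ a = 0"
proof -
  obtain x y where q: "q = (x, y)" by force
  have "(x, y) \<in> A" using assms q by (simp add: arcs_def)
  then show ?thesis using assms alt_vecs_support[of z _ _ _ _ "reduction_path A x y" a] reduction_path_props(2)[of x y]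
    by (auto simp: q restrict_rope_def)
qed

lemma sum_card_before:
  "U \<subseteq> S \<Longrightarrow> (\<Sum>y\<in>U. card {x \<in> U. x = y \<or> (x, y) \<in> A}) = (card U + 1) choose 2"
proof -
  assume U: "U \<subseteq> S"
  obtain w :: "real ^ 'v" where w: "\<And>x y. (x, y) \<in> A \<Longrightarrow> w $ x < w $ y" using arc_height by blast
  show ?thesis
    using finite[of U] U
  proof (induction rule: finite_ranking_induct[where f = "\<lambda>x. w $ x"])
    case empty
    then show ?case by (simp add: numeral_2_eq_2)
  next
    case (insert m U)
    show ?case
    proof (cases "m \<in> U")
      case True
      then show ?thesis using insert by (simp add: insert_absorb)
    next
      case False
      have nA: "(m, x) \<notin> A" if "x \<in> U" for x using w[of m x] insert.hyps(2)[OF that] by force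
      have A: "(x, m) \<in> A" if "x \<in> U" for x
        using support_total[OF uv, of x m] insert.prems that nA[OF that] False by blast
      have 1: "{x \<in> insert m U. x = m \<or> (x, m) \<in> A} = insert m U" using A by auto
      have 2: "{x \<in> insert m U. x = y \<or> (x, y) \<in> A} = {x \<in> U. x = y \<or> (x, y) \<in> A}" if "y \<in> U" for y
        using nA[OF that] that False by auto
      have "(\<Sum>y\<in>insert m U. card {x \<in> insert m U. x = y \<or> (x, y) \<in> A})
          = card (insert m U) + (\<Sum>y\<in>U. card {x \<in> U. x = y \<or> (x, y) \<in> A})"
        using False 1 2 by simp
      also have "\<dots> = Suc (card U) + ((card U + 1) choose 2)" using insert False by simp
      also have "\<dots> = (card (insert m U) + 1) choose 2" using False by (simp add: numeral_2_eq_2)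
      finally show ?thesis .
    qed
  qed
qed

definition crossing :: "'v set \<Rightarrow> ('v \<times> 'v) set" where
  "crossing U = {(x, y) \<in> arcs. x \<notin> U \<and> y \<in> U}"

text \<open>The position of a vertex of \<open>U\<close> is its rank within \<open>U\<close> plus
  the number of its predecessors outside \<open>U\<close>. The ranks add up to the binomial
  coefficient, the predecessors to the arcs entering \<open>U\<close>.\<close>

lemma inner_ones_shift:
  assumes U: "U \<subseteq> S"
  shows "ones U \<bullet> shift = real ((card U + 1) choose 2) + real (card (crossing U))"
proof -
  have "position y = card {x \<in> U. x = y \<or> (x, y) \<in> A} + card {x \<in> S - U. (x, y) \<in> A}" if "y \<in> U" for y
  proof -
    have "{x \<in> S. x = y \<or> (x, y) \<in> A} = {x \<in> U. x = y \<or> (x, y) \<in> A} \<union> {x \<in> S - U. (x, y) \<in> A}"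
      using U that by auto
    then show ?thesis unfolding position_def by (simp add: card_Un_disjoint disjoint_iff)
  qed
  then have 1: "(\<Sum>y\<in>U. position y) = ((card U + 1) choose 2) + (\<Sum>y\<in>U. card {x \<in> S - U. (x, y) \<in> A})"
    using sum_card_before[OF U] by (simp add: sum.distrib)
  have "crossing U = (\<lambda>(y, x). (x, y)) ` (SIGMA y : U. {x \<in> S - U. (x, y) \<in> A})"
    using U by (auto simp: crossing_def arcs_def image_iff)
  moreover have "inj_on (\<lambda>(y, x). (x, y)) (SIGMA y : U. {x \<in> S - U. (x, y) \<in> A})" by (auto simp: inj_on_def)
  ultimately have "card (crossing U) = (\<Sum>y\<in>U. card {x \<in> S - U. (x, y) \<in> A})"
    by (simp add: card_image)
  moreover have "ones U \<bullet> shift = (\<Sum>y\<in>U. real (position y))"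
    unfolding inner_ones shift_def using U by (intro sum.cong) auto
  ultimately show ?thesis using 1 by (simp flip: of_nat_sum of_nat_add)
qed

lemma sum_crossing: "(\<Sum>q\<in>arcs. of_bool (fst q \<notin> U \<and> snd q \<in> U)) = real (card (crossing U))"
proof -
  have "arcs \<inter> {q. fst q \<notin> U \<and> snd q \<in> U} = crossing U" by (auto simp: crossing_def)
  then show ?thesis by (simp add: of_bool_def sum.If_cases)
qed

text \<open>Only pairs with \<open>a\<close> outside and \<open>b\<close> inside \<open>U\<close>
  contribute -1. Between two such pairs the first \<open>b\<close> would be a \<Delta> vertex of
  \<open>U\<close> between two vertices outside, which balance forbids. Unless \<open>(x, y)\<close>
  enters \<open>U\<close>, even one such pair is forbidden by comparison with \<open>x\<close> or
  \<open>y\<close>.\<close>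

lemma balanced_bound:
  assumes q: "(x, y) \<in> arcs" and z: "z \<in> sub_vecs (x, y)" and b: "balanced U"
  shows "ones U \<bullet> z \<ge> - of_bool (x \<notin> U \<and> y \<in> U)"
proof -
  have xy: "(x, y) \<in> A" "x \<in> S" "y \<in> S" using q by (auto simp: arcs_def)
  note path = reduction_path_props[OF xy(1)]
  obtain ab where ab: "z = pairs_vec ab" "fst ` set ab \<subseteq> {x} \<union> (N \<inter> inner x y)"
    "snd ` set ab \<subseteq> (\<Delta> \<inter> inner x y) \<union> {y}" "subseq (pairs_concat ab) (reduction_path A x y)"
    using alt_vecs_pairs(1)[of z] z unfolding restrict_rope_def prod.case rope_vecs.simps by metis
  have sorted: "arc_sorted (pairs_concat ab)" using ab(4) path(1) by (rule sorted_wrt_subseq)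
  have sub: "inner x y \<subseteq> S" using inner_sub[OF xy(2,3)] S_eq by auto
  have none: "ones U \<bullet> pairs_vec ab \<ge> 0" if "\<And>a b. (a, b) \<in> set ab \<Longrightarrow> a \<in> U \<or> b \<notin> U" for ab
    using that
  proof (induction ab)
    case (Cons p ab)
    obtain a b where p: "p = (a, b)" by force
    have "ones U \<bullet> pairs_vec ab \<ge> 0" using Cons by simp
    moreover have "a \<in> U \<or> b \<notin> U" using Cons.prems p by auto
    ultimately show ?case
      unfolding p by (auto simp: inner_add_right inner_diff_right inner_ones_axis)
  qed simp
  have one: "ones U \<bullet> pairs_vec ab \<ge> - 1"
    if "fst ` set ab \<subseteq> {x} \<union> (N \<inter> inner x y)" "snd ` set ab \<subseteq> (\<Delta> \<inter> inner x y) \<union> {y}"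
      "arc_sorted (pairs_concat ab)" for ab
    using that
  proof (induction ab)
    case (Cons p ab)
    obtain a b where p: "p = (a, b)" by force
    have ab: "(a, b) \<in> A" "a \<in> {x} \<union> (N \<inter> inner x y)" "b \<in> (\<Delta> \<inter> inner x y) \<union> {y}"
      using Cons.prems p by auto
    show ?case
    proof (cases "a \<notin> U \<and> b \<in> U")
      case True
      have "a' \<in> U \<or> b' \<notin> U" if h: "(a', b') \<in> set ab" for a' b'
      proof (rule ccontr)
        assume n: "\<not> (a' \<in> U \<or> b' \<notin> U)"
        have a'c: "a' \<in> set (pairs_concat ab)" unfolding pairs_concat_set using h by force
        then have ba': "(b, a') \<in> A" using Cons.prems(3) unfolding p by fastforce
        have a': "a' \<in> {x} \<union> inner x y" using Cons.prems(1) h by force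
        then have "b \<noteq> y" using ba' xy(1) A_antisym by (auto simp: inner_def)
        then have "b \<in> \<Delta>" "b \<in> S" using ab(3) sub by auto
        moreover have "a \<in> S" "a' \<in> S" using ab(2) a' sub xy(2) by auto
        ultimately show False using b True n ab(1) ba' unfolding balanced_def by blast
      qed
      then have "ones U \<bullet> pairs_vec ab \<ge> 0" by (rule none)
      then show ?thesis using True unfolding p by (simp add: inner_add_right inner_diff_right inner_ones_axis)
    next
      case False
      have "ones U \<bullet> pairs_vec ab \<ge> - 1" using Cons.prems p by (intro Cons.IH) auto
      then show ?thesis using False unfolding p
        by (auto simp: inner_add_right inner_diff_right inner_ones_axis)
    qed
  qed simp
  show ?thesis
  proof (cases "x \<notin> U \<and> y \<in> U")
    case True
    then show ?thesis using one[OF ab(2,3) sorted] ab(1) by simp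
  next
    case False
    have "a \<in> U \<or> b \<notin> U" if h: "(a, b) \<in> set ab" for a b
    proof (rule ccontr)
      assume n: "\<not> (a \<in> U \<or> b \<notin> U)"
      have "a \<in> {x} \<union> (N \<inter> inner x y)" "b \<in> (\<Delta> \<inter> inner x y) \<union> {y}" using ab(2,3) h by force+
      moreover have "(a, b) \<in> A"
        using sorted h by (induction ab) auto
      ultimately show False
        using False n b xy sub unfolding balanced_def by (auto simp: inner_def; blast)
    qed
    then show ?thesis using none[of ab] False ab(1) by simp
  qed
qed

section \<open>Cutting sets at a violating vertex\<close>

definition unbalanced :: "'v set \<Rightarrow> 'v set" where
  "unbalanced U = {q \<in> S. \<exists>p\<in>S. \<exists>s\<in>S. (p, q) \<in> A \<and> (q, s) \<in> A \<and>
     (p \<in> U \<and> s \<in> U \<and> q \<in> N \<and> q \<notin> U \<or> p \<notin> U \<and> s \<notin> U \<and> q \<in> \<Delta> \<and> q \<in> U)}"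

lemma balanced_iff: "balanced U \<longleftrightarrow> unbalanced U = {}"
  unfolding balanced_def unbalanced_def by blast

abbreviation cut_gap :: "'v \<Rightarrow> 'v set \<Rightarrow> 'v set \<Rightarrow> 'v set \<Rightarrow> bool" where
  "cut_gap j U U1 U2 \<equiv> j \<in> N \<and> j \<notin> U \<and> U1 = {a \<in> U. (a, j) \<in> A} \<and> U2 = {a \<in> U. (j, a) \<in> A}"

abbreviation cut_member :: "'v \<Rightarrow> 'v set \<Rightarrow> 'v set \<Rightarrow> 'v set \<Rightarrow> bool" where
  "cut_member j U U1 U2 \<equiv> j \<in> \<Delta> \<and> j \<in> U \<and>
     U1 = U \<union> {a \<in> S. (a, j) \<in> A} \<and> U2 = U \<union> {a \<in> S. (j, a) \<in> A}"

text \<open>The two splicing lemmas for a cut of \<open>U\<close>, applied to the path of the arc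
  \<open>(x, y)\<close>, whose last vertex \<open>y\<close> may always go down.\<close>

lemma splice:
  assumes q: "(x, y) \<in> arcs" and z: "z1 \<in> sub_vecs (x, y)" "z2 \<in> sub_vecs (x, y)"
    and j: "j \<in> S" and U: "U \<subseteq> S"
    and cut: "cut_gap j U U1 U2 \<or> cut_member j U U1 U2"
  shows "\<exists>z\<in>sub_vecs (x, y). ones U \<bullet> z \<le> ones U1 \<bullet> z1 + ones U2 \<bullet> z2"
proof -
  have xy: "(x, y) \<in> A" "x \<in> S" "y \<in> S" using q by (auto simp: arcs_def)
  have sup: "support x y \<subseteq> S" using support_mono[OF uv xy(2,3,1)] .
  note path = reduction_path_props[OF xy(1)]
  let ?p = "reduction_path A x y"
  let ?V = "alt_vecs ({x} \<union> (N \<inter> inner x y)) ((\<Delta> \<inter> inner x y) \<union> {y})"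
  have V: "sub_vecs (x, y) = ?V False False ?p" by (simp add: restrict_rope_def)
  have z': "z1 \<in> ?V False False ?p" "z2 \<in> ?V False False ?p" using z V by auto
  have dis: "N \<inter> \<Delta> = {}" by (rule rope_disj[OF rope])
  have const: "ones X \<bullet> z = 0" if "z \<in> ?V False False ?p" "\<And>a. a \<in> set ?p \<Longrightarrow> a \<in> X \<longleftrightarrow> j \<in> U" for z X
    using inner_ones_alt_vecs[OF that(1), of X "if j \<in> U then set ?p else {}"] that(2)
      alt_vecs_total[OF that(1) order_refl] by (cases "j \<in> U") auto
  \<comment> \<open>If \<open>j\<close> is not an inner vertex of the path, one of the two pieces
    contains all or none of the path and contributes 0, while the other agrees with \<open>U\<close>
    on it.\<close>
  have trivial: ?thesis
    if "(\<forall>a\<in>set ?p. (a \<in> U1 \<longleftrightarrow> j \<in> U) \<and> (a \<in> U2 \<longleftrightarrow> a \<in> U)) \<or>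
        (\<forall>a\<in>set ?p. (a \<in> U2 \<longleftrightarrow> j \<in> U) \<and> (a \<in> U1 \<longleftrightarrow> a \<in> U))"
    using that
  proof
    assume "(\<forall>a\<in>set ?p. (a \<in> U1 \<longleftrightarrow> j \<in> U) \<and> (a \<in> U2 \<longleftrightarrow> a \<in> U))"
    then have "ones U1 \<bullet> z1 = 0" "ones U2 \<bullet> z2 = ones U \<bullet> z2"
      using const[OF z'(1), of U1] inner_ones_alt_vecs[OF z'(2), of U2 U] by blast+
    then show ?thesis using z by (intro bexI[of _ z2]) auto
  next
    assume "(\<forall>a\<in>set ?p. (a \<in> U2 \<longleftrightarrow> j \<in> U) \<and> (a \<in> U1 \<longleftrightarrow> a \<in> U))"
    then have "ones U2 \<bullet> z2 = 0" "ones U1 \<bullet> z1 = ones U \<bullet> z1"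
      using const[OF z'(2), of U2] inner_ones_alt_vecs[OF z'(1), of U1 U] by blast+
    then show ?thesis using z by (intro bexI[of _ z1]) auto
  qed
  consider "j \<in> inner x y" | "j = x \<or> (j, x) \<in> A" | "j = y \<or> (y, j) \<in> A"
    using support_total[OF uv j xy(2)] support_total[OF uv j xy(3)] by (auto simp: inner_def)
  then show ?thesis
  proof cases
    case 1
    then have "j \<in> set ?p" using path(2) by (simp add: support_def)
    then obtain xs ys where p: "?p = xs @ j # ys" by (metis split_list)
    have d: "distinct (xs @ j # ys)" using arc_sorted_distinct[OF path(1)] p by simp
    have bef: "(a, j) \<in> A" if "a \<in> set xs" for a using path(1) that by (auto simp: p sorted_wrt_append)
    have aft: "(j, a) \<in> A" if "a \<in> set ys" for a using path(1) that by (auto simp: p sorted_wrt_append)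
    have sS: "set xs \<subseteq> S" "set ys \<subseteq> S" using sup path(2) p by auto
    have jy: "j \<noteq> x" "j \<noteq> y" using 1 A_irrefl by (auto simp: inner_def)
    have "y \<in> set ys" using arc_sorted_split(2)[OF path(1)[unfolded p], of y] 1 path(2) p
      by (auto simp: inner_def support_def)
    then have ys: "ys \<noteq> []" by auto
    then have last: "last ys = y" using reduction_path_last[OF xy(1)] p by simp
    from cut show ?thesis
    proof
      assume c: "cut_gap j U U1 U2"
      have X1: "a \<in> U1 \<longleftrightarrow> a \<in> U" if "a \<in> set xs" for a using c bef[OF that] by blast
      have X1': "U1 \<inter> set (j # ys) = {}" using c aft A_antisym A_irrefl by auto
      have X2: "a \<in> U2 \<longleftrightarrow> a \<in> U" if "a \<in> set ys" for a using c aft[OF that] by blast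
      have X2': "U2 \<inter> set (xs @ [j]) = {}" using c bef A_antisym A_irrefl by auto
      have jj: "j \<in> {x} \<union> N \<inter> inner x y" "j \<notin> \<Delta> \<inter> inner x y \<union> {y}" "j \<notin> U"
        using c 1 dis jy by auto
      have l: "last ys \<in> \<Delta> \<inter> inner x y \<union> {y}" using last by simp
      show ?thesis unfolding V p
        by (rule splice_up[OF jj ys l d z'[unfolded p] X1 X1' X2 X2'])
    next
      assume c: "cut_member j U U1 U2"
      have X1: "a \<in> U1 \<longleftrightarrow> a \<in> U" if "a \<in> set ys" for a using c aft[OF that] A_antisym by blast
      have X1': "set (xs @ [j]) \<subseteq> U1" using c bef sS by auto
      have X2: "a \<in> U2 \<longleftrightarrow> a \<in> U" if "a \<in> set xs" for a using c bef[OF that] A_antisym by blast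
      have X2': "set (j # ys) \<subseteq> U2" using c aft sS by auto
      have jj: "j \<in> \<Delta> \<inter> inner x y \<union> {y}" "j \<notin> {x} \<union> N \<inter> inner x y" "j \<in> U"
        using c 1 dis jy by auto
      show ?thesis unfolding V p
        by (rule splice_down[OF jj d z'[unfolded p] X1 X1' X2 X2'])
    qed
  next
    case 2
    have aft: "a = j \<or> (j, a) \<in> A" if "a \<in> set ?p" for a
    proof -
      have a: "a = x \<or> (x, a) \<in> A" "a \<in> S" using that sup xy(1) unfolding path(2) by (auto simp: support_def inner_def)
      then show ?thesis using 2 support_trans[OF uv j a(2), of x] by blast
    qed
    have "a \<in> S \<and> (a, j) \<notin> A" if "a \<in> set ?p" for a
      using aft[OF that] that sup path(2) A_antisym A_irrefl by blast
    then show ?thesis using cut aft by (intro trivial) blast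
  next
    case 3
    have bef: "a = j \<or> (a, j) \<in> A" if "a \<in> set ?p" for a
    proof -
      have a: "a = y \<or> (a, y) \<in> A" "a \<in> S" using that sup xy(1) unfolding path(2) by (auto simp: support_def inner_def)
      then show ?thesis using 3 support_trans[OF uv a(2) j, of y] by blast
    qed
    have "a \<in> S \<and> (j, a) \<notin> A" if "a \<in> set ?p" for a
      using bef[OF that] that sup path(2) A_antisym A_irrefl by blast
    then show ?thesis using cut bef by (intro trivial) blast
  qed
qed

text \<open>A set that violates the condition on facets at a vertex \<open>j\<close> is cut at \<open>j\<close> into two sets with
  fewer violations, so that all inequalities follow from those of the facets.\<close>

lemma associahedron_bound:
  assumes x: "x \<in> associahedron A (u, v, N, \<Delta>)" and U: "U \<subseteq> S"
  shows "\<exists>z. (\<forall>q\<in>arcs. z q \<in> sub_vecs q) \<and>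
    ones U \<bullet> x \<ge> ones U \<bullet> shift + (\<Sum>q\<in>arcs. ones U \<bullet> z q)"
  using U
proof (induction "card (unbalanced U)" arbitrary: U rule: less_induct)
  case (less U)
  note x' = x[unfolded associahedron_iff]
  show ?case
  proof (cases "balanced U")
    case True
    \<comment> \<open>On a balanced set each entering arc contributes -1 and every other arc 0,
      which cancels the surplus of \<open>shift\<close>.\<close>
    define z where "z = (\<lambda>(a, b). if a \<notin> U \<and> b \<in> U then axis a 1 - axis b 1 else 0 :: real ^ 'v)"
    have "z q \<in> sub_vecs q" if "q \<in> arcs" for q
      using rope_root_mem restrict_rope_ropes[OF that] zero_rope_vecs
      unfolding z_def by (cases q) (auto simp: restrict_rope_def simp del: rope_vecs.simps)
    moreover have "ones U \<bullet> z q = - of_bool (fst q \<notin> U \<and> snd q \<in> U)" for q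
      unfolding z_def by (cases q) (auto simp: inner_diff_right inner_ones_axis)
    then have "(\<Sum>q\<in>arcs. ones U \<bullet> z q) = - real (card (crossing U))"
      by (simp add: sum_negf sum_crossing)
    moreover have "ones U \<bullet> x \<ge> real ((card U + 1) choose 2)"
    proof -
      consider "U = {}" | "U = S" | "U \<noteq> {}" "U \<subset> S" using less.prems by blast
      then show ?thesis
        by cases (use x' True in \<open>auto simp: numeral_2_eq_2\<close>)
    qed
    ultimately show ?thesis using inner_ones_shift[OF less.prems] by (intro exI[of _ z]) auto
  next
    case False
    then obtain j p s where j: "j \<in> S" "p \<in> S" "s \<in> S" "(p, j) \<in> A" "(j, s) \<in> A"
      "p \<in> U \<and> s \<in> U \<and> j \<in> N \<and> j \<notin> U \<or> p \<notin> U \<and> s \<notin> U \<and> j \<in> \<Delta> \<and> j \<in> U"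
      and ju: "j \<in> unbalanced U"
      unfolding balanced_iff unbalanced_def by blast
    have Acmp: "a = j \<or> (a, j) \<in> A \<or> (j, a) \<in> A" if "a \<in> S" for a
      using support_total[OF uv that j(1)] by blast
    have "\<exists>U1 U2. (cut_gap j U U1 U2 \<or> cut_member j U U1 U2)"
      using j(6) by blast
    then obtain U1 U2 where cut: "cut_gap j U U1 U2 \<or> cut_member j U U1 U2" by blast
    have sub: "U1 \<subseteq> S" "U2 \<subseteq> S" using cut less.prems by auto
    have jnot: "j \<notin> unbalanced U1" "j \<notin> unbalanced U2"
      using cut A_antisym A_irrefl unfolding unbalanced_def by blast+
    \<comment> \<open>Reversing the path exchanges the two pieces, so \<open>B\<close> stands for
      \<open>A\<close> or its converse and one argument serves both. A violation in a piece is one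
      in \<open>U\<close>, possibly with \<open>j\<close> in place of one of the two outer
      vertices.\<close>
    have ub: "unbalanced V \<subseteq> unbalanced U" if B: "B = A \<or> B = A\<inverse>"
      and V: "j \<in> N \<and> j \<notin> U \<and> V = {a \<in> U. (a, j) \<in> B} \<or> j \<in> \<Delta> \<and> j \<in> U \<and> V = U \<union> {a \<in> S. (a, j) \<in> B}" for B V
    proof
      have tr: "(a, c) \<in> B" if "a \<in> S" "c \<in> S" "(a, b) \<in> B" "(b, c) \<in> B" for a b c
        using B support_trans[OF uv] that by blast
      have asym: "(b, a) \<notin> B" if "(a, b) \<in> B" for a b using B A_antisym that by blast
      have cmp: "a = j \<or> (a, j) \<in> B \<or> (j, a) \<in> B" if "a \<in> S" for a using Acmp[OF that] B by blast
      have ubI: "q \<in> unbalanced U" if "a \<in> S" "q \<in> S" "c \<in> S" "(a, q) \<in> B" "(q, c) \<in> B"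
        "a \<in> U \<and> c \<in> U \<and> q \<in> N \<and> q \<notin> U \<or> a \<notin> U \<and> c \<notin> U \<and> q \<in> \<Delta> \<and> q \<in> U" for a q c
        using that B unfolding unbalanced_def by blast
      fix q assume "q \<in> unbalanced V"
      then obtain a c where q: "q \<in> S" "a \<in> S" "c \<in> S" "(a, q) \<in> B" "(q, c) \<in> B"
        and h: "a \<in> V \<and> c \<in> V \<and> q \<in> N \<and> q \<notin> V \<or> a \<notin> V \<and> c \<notin> V \<and> q \<in> \<Delta> \<and> q \<in> V"
        using B unfolding unbalanced_def by blast
      from h show "q \<in> unbalanced U"
      proof (elim disjE conjE)
        assume h: "a \<in> V" "c \<in> V" "q \<in> N" "q \<notin> V"
        from V show ?thesis
        proof (elim disjE conjE)
          assume c: "j \<notin> U" "V = {a \<in> U. (a, j) \<in> B}"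
          then have "(q, j) \<in> B" using h tr[OF q(1) j(1) q(5)] by blast
          then show ?thesis using ubI[OF q(2,1,3,4,5)] h c by blast
        next
          assume c: "j \<in> U" "V = U \<union> {a \<in> S. (a, j) \<in> B}"
          then have jq: "(j, q) \<in> B" "q \<notin> U" using h q cmp[OF q(1)] by blast+
          then have "c \<in> U" using h c asym tr[OF j(1) q(3) _ q(5)] by blast
          then show ?thesis using ubI[OF j(1) q(1,3) _ q(5)] jq h c by blast
        qed
      next
        assume h: "a \<notin> V" "c \<notin> V" "q \<in> \<Delta>" "q \<in> V"
        from V show ?thesis
        proof (elim disjE conjE)
          assume c: "j \<notin> U" "V = {a \<in> U. (a, j) \<in> B}"
          then have qj: "(q, j) \<in> B" "q \<in> U" using h by blast+
          then have "a \<notin> U" using h c tr[OF q(2) j(1) q(4)] by blast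
          then show ?thesis using ubI[OF q(2,1) j(1) q(4)] qj h c by blast
        next
          assume c: "j \<in> U" "V = U \<union> {a \<in> S. (a, j) \<in> B}"
          then have "(j, a) \<in> B" using h q cmp[OF q(2)] by blast
          then have "q \<in> U" using h c asym tr[OF j(1) q(1) _ q(4)] by blast
          then show ?thesis using ubI[OF q(2,1,3,4,5)] h c by blast
        qed
      qed
    qed
    have ub1: "unbalanced U1 \<subseteq> unbalanced U" by (rule ub[of A]) (use cut in auto)
    have ub2: "unbalanced U2 \<subseteq> unbalanced U" by (rule ub[of "A\<inverse>"]) (use cut in auto)
    have "unbalanced U1 \<subset> unbalanced U" "unbalanced U2 \<subset> unbalanced U" using ub1 ub2 jnot ju by blast+
    then have "card (unbalanced U1) < card (unbalanced U)" "card (unbalanced U2) < card (unbalanced U)"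
      by (auto intro: psubset_card_mono)
    then obtain z1 z2 where z1: "\<forall>q\<in>arcs. z1 q \<in> sub_vecs q"
        "ones U1 \<bullet> x \<ge> ones U1 \<bullet> shift + (\<Sum>q\<in>arcs. ones U1 \<bullet> z1 q)"
      and z2: "\<forall>q\<in>arcs. z2 q \<in> sub_vecs q"
        "ones U2 \<bullet> x \<ge> ones U2 \<bullet> shift + (\<Sum>q\<in>arcs. ones U2 \<bullet> z2 q)"
      using less.hyps[of U1] less.hyps[of U2] sub by blast
    have "\<forall>q\<in>arcs. \<exists>z\<in>sub_vecs q. ones U \<bullet> z \<le> ones U1 \<bullet> z1 q + ones U2 \<bullet> z2 q"
      using splice[OF _ _ _ j(1) less.prems cut] z1(1) z2(1) by fast
    then obtain z where z: "\<forall>q\<in>arcs. z q \<in> sub_vecs q"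
      "\<forall>q\<in>arcs. ones U \<bullet> z q \<le> ones U1 \<bullet> z1 q + ones U2 \<bullet> z2 q" by metis
    have le: "(\<Sum>q\<in>arcs. ones U \<bullet> z q) \<le> (\<Sum>q\<in>arcs. ones U1 \<bullet> z1 q) + (\<Sum>q\<in>arcs. ones U2 \<bullet> z2 q)"
      unfolding sum.distrib[symmetric] using z(2) by (intro sum_mono) blast
    \<comment> \<open>In the first case \<open>U\<close> is the disjoint union of the pieces. In the
      second they cover \<open>S\<close> and meet in \<open>U\<close>, and \<open>x\<close> and
      \<open>shift\<close> have the same sum over \<open>S\<close>.\<close>
    have add: "ones U \<bullet> x - ones U \<bullet> shift = ones U1 \<bullet> x - ones U1 \<bullet> shift + (ones U2 \<bullet> x - ones U2 \<bullet> shift)"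
      using cut
    proof
      assume c: "cut_gap j U U1 U2"
      then have "U = U1 \<union> U2" "U1 \<inter> U2 = {}" using Acmp less.prems A_antisym by auto
      then have "ones U \<bullet> y = ones U1 \<bullet> y + ones U2 \<bullet> y" for y by (simp add: inner_ones sum.union_disjoint)
      then show ?thesis by simp
    next
      assume c: "cut_member j U U1 U2"
      then have "S = U1 \<union> U2" "U1 \<inter> U2 = U" using Acmp less.prems A_antisym by auto
      then have "ones U1 \<bullet> y + ones U2 \<bullet> y = ones S \<bullet> y + ones U \<bullet> y" for y
        using sum.union_inter[of U1 U2 "\<lambda>w. y $ w"] by (simp add: inner_ones)
      moreover have "ones S \<bullet> x = ones S \<bullet> shift"
        using x' inner_ones_shift[of S] by (auto simp: crossing_def arcs_def)
      ultimately show ?thesis by (smt (verit))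
    qed
    show ?thesis
      using z(1) le add z1(2) z2(2) by (intro exI[of _ z]) auto
  qed
qed

section \<open>Membership and optimality of the candidate vertices\<close>

lemma associahedron_convex: "convex (associahedron A (u, v, N, \<Delta>))"
proof -
  have "associahedron A (u, v, N, \<Delta>) =
      (\<Inter>w\<in>- S. {x. axis w 1 \<bullet> x = 0}) \<inter> {x. ones S \<bullet> x = real ((card S + 1) choose 2)} \<inter>
      (\<Inter>U\<in>{U. U \<noteq> {} \<and> U \<subset> S \<and> balanced U}. {x. ones U \<bullet> x \<ge> real ((card U + 1) choose 2)})"
    unfolding set_eq_iff Int_iff INT_iff mem_Collect_eq Compl_iff associahedron_iff
    by (simp add: inner_axis') blast
  then show ?thesis
    by (simp only:) (intro convex_Int convex_INT convex_hyperplane convex_halfspace_ge)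
qed

lemma assoc_vertex_outside:
  assumes "R \<in> AR" "a \<notin> S"
  shows "assoc_vertex R $ a = 0"
proof -
  have "sub_vertex q R $ a = 0" if "q \<in> arcs" for q
    using restrict_vecs_support[OF that shard_vertex_in[OF assms(1) restrict_rope_ropes[OF that]]]
      restrict_rope_support[OF that] assms(2) by blast
  then show ?thesis using assms(2) by (simp add: assoc_vertex_def shift_def)
qed

lemma inner_assoc_vertex:
  "ones U \<bullet> assoc_vertex R = ones U \<bullet> shift + (\<Sum>q\<in>arcs. ones U \<bullet> sub_vertex q R)"
  by (simp add: assoc_vertex_def inner_add_right inner_sum_right)

lemma assoc_vertex_total:
  assumes R: "R \<in> AR"
  shows "ones S \<bullet> assoc_vertex R = real ((card S + 1) choose 2)"
proof -
  have "ones S \<bullet> sub_vertex q R = 0" if q: "q \<in> arcs" for q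
  proof -
    obtain x y where xy: "q = (x, y)" by force
    have "(x, y) \<in> A" using q xy by (simp add: arcs_def)
    then have "set (reduction_path A x y) \<subseteq> S"
      using restrict_rope_support[OF q] reduction_path_props(2)[of x y] by (simp add: xy restrict_rope_def)
    then show ?thesis
      using alt_vecs_total shard_vertex_in[OF R restrict_rope_ropes[OF q]]
      unfolding xy restrict_rope_def prod.case rope_vecs.simps by fastforce
  qed
  moreover have "crossing S = {}" by (auto simp: crossing_def arcs_def)
  ultimately show ?thesis using inner_ones_shift[of S] by (simp add: inner_assoc_vertex)
qed

lemma assoc_vertex_in:
  assumes R: "R \<in> AR"
  shows "assoc_vertex R \<in> associahedron A (u, v, N, \<Delta>)"
  unfolding associahedron_iff
proof (intro conjI allI impI)
  fix U assume U: "U \<noteq> {} \<and> U \<subset> S \<and> balanced U"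
  \<comment> \<open>Summed over all arcs, the lower bounds use up exactly the surplus of
    \<open>shift\<close> over the binomial coefficient.\<close>
  have "- of_bool (fst q \<notin> U \<and> snd q \<in> U) \<le> ones U \<bullet> sub_vertex q R" if q: "q \<in> arcs" for q
    using balanced_bound[of "fst q" "snd q"] q U shard_vertex_in[OF R restrict_rope_ropes[OF q]] by simp
  then have "(\<Sum>q\<in>arcs. - of_bool (fst q \<notin> U \<and> snd q \<in> U))
      \<le> (\<Sum>q\<in>arcs. ones U \<bullet> sub_vertex q R)" by (rule sum_mono)
  then show "real ((card U + 1) choose 2) \<le> ones U \<bullet> assoc_vertex R"
    using inner_ones_shift[of U] U unfolding inner_assoc_vertex sum_negf sum_crossing by auto
qed (use assoc_vertex_outside[OF R] assoc_vertex_total[OF R] in auto)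

text \<open>On every lower set of \<open>w\<close> the sum of \<open>x\<close> is at least that of
  the candidate vertex: \<open>associahedron_bound\<close> compares \<open>x\<close> with some
  matching vectors, and the shard vertices minimise the sum over a lower set. Abel summation turns
  this into optimality in direction \<open>w\<close>, strict unless the two points agree.\<close>

lemma assoc_vertex_max:
  assumes R: "R \<in> AR" and w: "w \<in> open_chamber R" and x: "x \<in> associahedron A (u, v, N, \<Delta>)"
    and ne: "x \<noteq> assoc_vertex R"
  shows "w \<bullet> x < w \<bullet> assoc_vertex R"
proof (rule ccontr)
  assume n: "\<not> w \<bullet> x < w \<bullet> assoc_vertex R"
  define d where "d = x - assoc_vertex R"
  have out: "d $ a = 0" if "a \<notin> S" for a
    using x assoc_vertex_outside[OF R that] that by (simp add: d_def associahedron_iff)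
  have sumS: "sum (\<lambda>a. d $ a) S = 0"
    using x assoc_vertex_total[OF R] unfolding associahedron_iff
    by (simp add: d_def inner_ones[symmetric] sum_subtractf)
  have inj: "inj_on (\<lambda>a. w $ a) S"
  proof (rule inj_onI, rule ccontr)
    fix a b assume h: "a \<in> S" "b \<in> S" "w $ a = w $ b" "a \<noteq> b"
    then have "(a, b) \<in> reorient A R \<or> (b, a) \<in> reorient A R"
      using support_total[OF uv h(1,2,4)] by (auto simp: reorient_iff)
    then show False using open_chamberD[OF w] h(3) by fastforce
  qed
  have low: "(\<Sum>a | a \<in> S \<and> w $ a < c. d $ a) \<ge> 0" for c
  proof -
    let ?U = "{a \<in> S. w $ a < c}"
    obtain z where z: "\<forall>q\<in>arcs. z q \<in> sub_vecs q"
      "ones ?U \<bullet> x \<ge> ones ?U \<bullet> shift + (\<Sum>q\<in>arcs. ones ?U \<bullet> z q)"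
      using associahedron_bound[OF x, of ?U] by blast
    have "ones ?U \<bullet> sub_vertex q R \<le> ones ?U \<bullet> z q" if q: "q \<in> arcs" for q
    proof -
      have comp: "(- ones ?U) $ a = - of_bool (a \<in> ?U)" for a
        using inner_ones_axis[of ?U a] by (simp add: inner_axis)
      \<comment> \<open>The negated indicator of a lower set of \<open>w\<close> is weakly monotone
        along the orientation, so the local optimum maximises it.\<close>
      have "(- ones ?U) \<bullet> z q \<le> (- ones ?U) \<bullet> sub_vertex q R"
      proof (rule shard_opt_le[OF restrict_rope_ropes[OF q] shard_opt_vertex[OF R restrict_rope_ropes[OF q]]])
        show "z q \<in> sub_vecs q" using z q by blast
        fix a b assume h: "a \<in> rope_support (restrict_rope q)" "b \<in> rope_support (restrict_rope q)"
          "(a, b) \<in> reorient A R"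
        have "w $ a < w $ b" using open_chamberD[OF w h(3)] .
        moreover have "a \<in> S" "b \<in> S" using restrict_rope_support[OF q] h by auto
        ultimately show "(- ones ?U) $ a \<le> (- ones ?U) $ b" unfolding comp by auto
      qed
      then show ?thesis by simp
    qed
    then have "(\<Sum>q\<in>arcs. ones ?U \<bullet> sub_vertex q R) \<le> (\<Sum>q\<in>arcs. ones ?U \<bullet> z q)"
      by (rule sum_mono)
    then have "ones ?U \<bullet> d \<ge> 0" using z(2) unfolding d_def inner_diff_right inner_assoc_vertex by linarith
    then show ?thesis by (simp add: inner_ones)
  qed
  \<comment> \<open>Any bound above the weights on \<open>S\<close> serves, because \<open>d\<close>
    has total sum 0 there.\<close>
  define M where "M = Max ((\<lambda>a. w $ a) ` S) + 1"
  have M: "w $ a < M" if "a \<in> S" for a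
  proof -
    have "w $ a \<le> Max ((\<lambda>a. w $ a) ` S)" by (rule Max_ge) (use that in auto)
    then show ?thesis by (simp add: M_def)
  qed
  have "w \<bullet> d = (\<Sum>a\<in>UNIV. w $ a * d $ a)" by (simp add: inner_vec_def)
  also have "\<dots> = (\<Sum>a\<in>S. w $ a * d $ a)"
    by (rule sum.mono_neutral_right) (use out in auto)
  finally have "w \<bullet> d = (\<Sum>a\<in>S. w $ a * d $ a)" .
  moreover have "w \<bullet> d \<ge> 0" using n by (simp add: d_def inner_diff_right)
  ultimately have pos: "(\<Sum>a\<in>S. w $ a * d $ a) \<ge> 0" by linarith
  have "\<forall>a\<in>S. d $ a = 0"
    using conjunct2[OF abel_lower_sets[of S "\<lambda>a. w $ a" "\<lambda>a. d $ a" M, OF finite inj low M]] pos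
    unfolding sumS mult_zero_right by blast
  then have "d = 0" using out by (metis vec_eq_iff zero_index)
  then show False using ne by (simp add: d_def)
qed

lemma restrict_subrope:
  assumes q: "q \<in> arcs" and s: "subrope \<sigma> (restrict_rope q)"
  shows "subrope \<sigma> (u, v, N, \<Delta>)"
proof -
  obtain x y where xy: "q = (x, y)" by force
  obtain a b N' \<Delta>' where \<sigma>: "\<sigma> = (a, b, N', \<Delta>')" by (cases \<sigma>)
  have A: "(x, y) \<in> A" "x \<in> S" "y \<in> S" using q xy by (auto simp: arcs_def)
  have sub: "support x y \<subseteq> S" using support_mono[OF uv A(2,3,1)] .
  have sxy: "{x, y} \<union> (N \<inter> inner x y) \<union> (\<Delta> \<inter> inner x y) \<subseteq> support x y" by (auto simp: support_def)
  have ab: "(a, b) \<in> A" "a \<in> support x y" "b \<in> support x y" "N' = N \<inter> inner x y \<inter> inner a b"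
    "\<Delta>' = \<Delta> \<inter> inner x y \<inter> inner a b"
    using s sxy by (auto simp: \<sigma> xy subrope_def restrict_rope_def)
  have "inner a b \<subseteq> inner x y" using support_between[OF A(1) ab(2,3)] by (auto simp: inner_def)
  then show ?thesis using ab sub S_eq by (auto simp: \<sigma> subrope_def)
qed

lemma associahedron_vertex_map:
  "rope_vertex_map (u, v, N, \<Delta>) (associahedron A (u, v, N, \<Delta>)) assoc_vertex"
  unfolding rope_vertex_map_def
proof (intro conjI allI ballI impI)
  show "convex (associahedron A (u, v, N, \<Delta>))" by (rule associahedron_convex)
next
  fix R assume "R \<in> AR"
  then show "assoc_vertex R \<in> associahedron A (u, v, N, \<Delta>)" by (rule assoc_vertex_in)
next
  fix R w x assume "R \<in> AR" "w \<in> open_chamber R" "x \<in> associahedron A (u, v, N, \<Delta>)" "x \<noteq> assoc_vertex R"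
  then show "w \<bullet> x < w \<bullet> assoc_vertex R" by (rule assoc_vertex_max)
next
  fix R x y assume f: "flip R x y"
  have "\<exists>k. sub_vertex q (insert (x, y) R) - sub_vertex q R
      = k *\<^sub>R (axis x 1 - axis y 1)" if "q \<in> arcs" for q
    using shard_vertex_flip(1)[OF restrict_rope_ropes[OF that] f] by (metis diff_self scaleR_zero_left)
  then show "\<exists>k. assoc_vertex (insert (x, y) R) - assoc_vertex R = k *\<^sub>R (axis x 1 - axis y 1)"
    unfolding assoc_vertex_def add_diff_cancel_left by (rule sum_vertices_root)
next
  fix R x y assume f: "flip R x y" and "assoc_vertex (insert (x, y) R) \<noteq> assoc_vertex R"
  then obtain q where q: "q \<in> arcs"
    "sub_vertex q (insert (x, y) R) \<noteq> sub_vertex q R"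
    unfolding assoc_vertex_def by (metis (no_types, lifting) sum.cong)
  then show "subrope (flip_rope R x y) (u, v, N, \<Delta>)"
    using restrict_subrope[OF q(1)] shard_vertex_flip(2)[OF restrict_rope_ropes[OF q(1)] f q(2)] by blast
next
  fix R x y assume f: "flip R x y" and fr: "flip_rope R x y = (u, v, N, \<Delta>)"
  then have xy: "x = u" "y = v" by (auto simp: flip_rope_def)
  have AR: "R \<in> AR" "insert (x, y) R \<in> AR" using f by (auto simp: flip_def)
  \<comment> \<open>The summand of the arc \<open>(u, v)\<close> is the shard polytope of the full
    rope, whose vertex moves under this flip.\<close>
  have uvq: "(u, v) \<in> arcs" using uv by (simp add: arcs_def support_def)
  have r: "restrict_rope (u, v) = (u, v, N, \<Delta>)"
    using rope_inner[OF rope] by (auto simp: restrict_rope_def)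
  have "(\<Sum>q\<in>arcs. sub_vertex q (insert (x, y) R)) \<noteq> (\<Sum>q\<in>arcs. sub_vertex q R)"
  proof (rule sum_vertices_neq[where p = "\<lambda>q. sub_vertex q", OF _ f uvq])
    show "sub_vertex (u, v) (insert (x, y) R) \<noteq> sub_vertex (u, v) R"
      unfolding r using shard_vertex_flip_rope[OF f fr] xy by simp
    fix q w assume q: "q \<in> arcs" "w \<in> open_chamber R"
      "sub_vertex q (insert (x, y) R) \<noteq> sub_vertex q R"
    note \<rho> = restrict_rope_ropes[OF q(1)]
    show "w \<bullet> sub_vertex q (insert (x, y) R) < w \<bullet> sub_vertex q R"
      by (rule shard_opt_less[OF \<rho> shard_opt_vertex[OF AR(1) \<rho>] shard_vertex_in[OF AR(2) \<rho>] q(3,2)])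
  qed simp
  then show "assoc_vertex (insert (x, y) R) \<noteq> assoc_vertex R" unfolding assoc_vertex_def by simp
qed

end

end

theorem theorem4:
  fixes A :: "'v::finite rel" and r :: "'v rel rel"
  assumes "acyclic A" and "skeletal A"
    and "lattice_congruence (acyclic_reorientations A) r"
  shows "(\<exists>I \<subseteq> ropes A. quotient_fan A r = normal_fan (\<Sum>\<rho>\<in>I. associahedron A \<rho>)) \<and>
         (\<exists>J \<subseteq> ropes A. quotient_fan A r = normal_fan (\<Sum>\<rho>\<in>J. shard_polytope A \<rho>))"
proof -
  interpret skeletal_digraph A using assms by unfold_locales
  have "\<exists>p. rope_vertex_map \<rho> (associahedron A \<rho>) p" if "\<rho> \<in> ropes A" for \<rho>
    using that associahedron_vertex_map by (cases \<rho>) blast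
  moreover have "\<exists>p. rope_vertex_map \<rho> (shard_polytope A \<rho>) p" if "\<rho> \<in> ropes A" for \<rho>
    using shard_polytope_vertex_map[OF that] by blast
  ultimately show ?thesis using quotient_fan_minkowski[OF assms(3)] by blast
qed

end
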